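(* In the setting described in the context, there exists a unique function $M\in\mathcal M=\mathrm{Hol}(\mathbb H,\mathcal A)$ such that $$(\mathbb E L-\mathcal S(M(z))-z\Lambda)M(z)=I_\ell\qquad\text{for every } z\in\mathbb H.$$ Additionally, $$M(z)=\begin{bmatrix}0_{n\times n}&0_{n\times d}\\ 0_{d\times n}&(\mathbb E Q)^{-1}\end{bmatrix}+\int_{\mathbb R}\frac{\Omega(d\lambda)}{\lambda-z}\qquad\text{for all } z\in\mathbb H,$$ where $\Omega$ is a compactly supported (positive semidefinite) matrix-valued measure on bounded Borel subsets of $\mathbb R$ satisfying $$\int_{\mathbb R}\Omega(d\lambda)=\begin{bmatrix}I_n&-\mathbb E[B^\top](\mathbb E Q)^{-1}\\ -(\mathbb E Q)^{-1}\mathbb E[B]&(\mathbb E Q)^{-1}\mathbb E[BB^\top](\mathbb E Q)^{-1}\end{bmatrix}.$$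
   Context: Let $n,d\ge1$ and $\ell=n+d$. For $W\in\mathbb C^{\ell\times\ell}$ write $W=\begin{bmatrix}W_{1,1}&W_{1,2}\\ W_{2,1}&W_{2,2}\end{bmatrix}$ with $W_{1,1}\in\mathbb C^{n\times n}$, $W_{2,2}\in\mathbb C^{d\times d}$. For a square complex matrix $W$, $\Re[W]=(W+W^* )/2$ and $\Im[W]=(W-W^* )/(2i)$; $\succeq,\succ$ denote the Loewner order on Hermitian matrices. $\mathbb H=\{z\in\mathbb C:\Im z>0\}$. Let $L=\begin{bmatrix}A&B^\top\\ B&Q\end{bmatrix}\in\mathbb R^{\ell\times\ell}$ be a random real symmetric matrix with $A\in\mathbb R^{n\times n}$ symmetric, $B\in\mathbb R^{d\times n}$, $Q\in\mathbb R^{d\times d}$ symmetric, such that $Q$ and $\mathbb E Q$ are non-singular, and all entries have finite second moments. Let $\Lambda=\mathrm{diag}\{I_n,0_{d\times d}\}$. The superoperator $\mathcal S:\mathbb C^{\ell\times\ell}\to\mathbb C^{\ell\times\ell}$ is a positivity-preserving linear map (it maps positive semidefinite matrices to positive semidefinite matrices) of the form $$\mathcal S(M)=\begin{bmatrix}\mathcal S_{1,1}(M)&\mathbb E[(A-\mathbb EA)M_{1,1}(B-\mathbb EB)^\top]\\ \mathbb E[(B-\mathbb EB)M_{1,1}(A-\mathbb EA)]&\mathbb E[(B-\mathbb EB)M_{1,1}(B-\mathbb EB)^\top]\end{bmatrix},$$ where $\mathcal S_{1,1}:\mathbb C^{\ell\times\ell}\to\mathbb C^{n\times n}$ is a given positivity-preserving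 linear map and the expectations are over $L$ only (the argument $M$ is held fixed). The admissible set is $\mathcal M=\mathrm{Hol}(\mathbb H,\mathcal A)$, the set of holomorphic functions $\mathbb H\to\mathbb C^{\ell\times\ell}$ with values in $\mathcal A=\{W\in\mathbb C^{\ell\times\ell}:\Im[W]\succeq0,\ \Im[W_{1,1}]\succ0\}$. *)

theory Defs
  imports "HOL-Probability.Probability"
begin

section \<open>Complex matrices and the Loewner order\<close>

type_synonym 'k cmat = "complex ^ 'k ^ 'k"

definition mscale :: "complex \<Rightarrow> complex ^ 'm ^ 'k \<Rightarrow> complex ^ 'm ^ 'k" where
  "mscale c W = map_matrix ((*) c) W"

text \<open>
  Complex-linearity of a map between matrix spaces can thus be expressed as
  \<^term>\<open>Vector_Spaces.linear mscale mscale\<close>.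
\<close>

lemma vector_space_mscale: "vector_space mscale"
  by unfold_locales (simp_all add: mscale_def vec_eq_iff algebra_simps)

abbreviation cplx :: "real ^ 'm ^ 'k \<Rightarrow> complex ^ 'm ^ 'k" where
  "cplx \<equiv> map_matrix complex_of_real"

definition ctranspose :: "complex ^ 'm ^ 'k \<Rightarrow> complex ^ 'k ^ 'm" where
  "ctranspose W = map_matrix cnj (transpose W)"

definition matrix_Im :: "'k::finite cmat \<Rightarrow> 'k cmat" where
  "matrix_Im W = mscale (1 / (2 * \<i>)) (W - ctranspose W)"

definition qform :: "'k::finite cmat \<Rightarrow> complex ^ 'k \<Rightarrow> complex" where
  "qform W v = (\<Sum>i\<in>UNIV. \<Sum>j\<in>UNIV. cnj (v $ i) * W $ i $ j * v $ j)"

definition psd :: "'k::finite cmat \<Rightarrow> bool" where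
  "psd W \<longleftrightarrow> ctranspose W = W \<and> (\<forall>v. 0 \<le> Re (qform W v))"

definition pd :: "'k::finite cmat \<Rightarrow> bool" where
  "pd W \<longleftrightarrow> ctranspose W = W \<and> (\<forall>v. v \<noteq> 0 \<longrightarrow> 0 < Re (qform W v))"

definition positivity_preserving :: "('k::finite cmat \<Rightarrow> 'm::finite cmat) \<Rightarrow> bool" where
  "positivity_preserving T \<longleftrightarrow> (\<forall>W. psd W \<longrightarrow> psd (T W))"


section \<open>Block matrices\<close>

text \<open>
  Matrices of size $n + d$ are indexed by the sum type \<^typ>\<open>'n + 'd\<close>, where \<^term>\<open>Inl\<close> picks
  the first $n$ and \<^term>\<open>Inr\<close> the last $d$ indices.
\<close>

definition block :: "'a ^ 'n::finite ^ 'n \<Rightarrow> 'a ^ 'd::finite ^ 'n \<Rightarrow> 'a ^ 'n ^ 'd \<Rightarrow> 'a ^ 'd ^ 'd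
    \<Rightarrow> 'a ^ ('n + 'd) ^ ('n + 'd)" where
  "block W11 W12 W21 W22 = (\<chi> i j.
     case i of
       Inl i' \<Rightarrow> (case j of Inl j' \<Rightarrow> W11 $ i' $ j' | Inr j' \<Rightarrow> W12 $ i' $ j')
     | Inr i' \<Rightarrow> (case j of Inl j' \<Rightarrow> W21 $ i' $ j' | Inr j' \<Rightarrow> W22 $ i' $ j'))"

definition block11 :: "'a ^ ('n::finite + 'd::finite) ^ ('n + 'd) \<Rightarrow> 'a ^ 'n ^ 'n" where
  "block11 W = (\<chi> i j. W $ Inl i $ Inl j)"

definition Lam :: "('n::finite + 'd::finite) cmat" where
  "Lam = block (mat 1) 0 0 0"


section \<open>The admissible set\<close>

definition upper_half_plane :: "complex set" where
  "upper_half_plane = {z. 0 < Im z}"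

definition admissible_values :: "('n::finite + 'd::finite) cmat set" where
  "admissible_values = {W. psd (matrix_Im W) \<and> pd (matrix_Im (block11 W))}"

text \<open>
  The functions with domain \<^const>\<open>upper_half_plane\<close> are represented extensionally (by
  \<^const>\<open>PiE\<close>), so that equality in the admissible set is equality on that domain.
\<close>

definition admissible :: "(complex \<Rightarrow> ('n::finite + 'd::finite) cmat) set" where
  "admissible = {M \<in> upper_half_plane \<rightarrow>\<^sub>E admissible_values.
     \<forall>i j. (\<lambda>z. M z $ i $ j) holomorphic_on upper_half_plane}"

definition MDE_solution :: "(real ^ ('n::finite + 'd::finite) ^ ('n + 'd))
    \<Rightarrow> (('n + 'd) cmat \<Rightarrow> ('n + 'd) cmat) \<Rightarrow> (complex \<Rightarrow> ('n + 'd) cmat) \<Rightarrow> bool" where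
  "MDE_solution EL S M \<longleftrightarrow> M \<in> admissible \<and>
     (\<forall>z\<in>upper_half_plane. (cplx EL - S (M z) - mscale z Lam) ** M z = mat 1)"


section \<open>Matrix-valued measures\<close>

definition bounded_borel :: "real set set" where
  "bounded_borel = {X \<in> sets borel. bounded X}"

definition matrix_measure :: "(real set \<Rightarrow> 'k::finite cmat) \<Rightarrow> bool" where
  "matrix_measure \<Omega> \<longleftrightarrow>
     \<Omega> {} = 0 \<and> (\<forall>X\<in>bounded_borel. psd (\<Omega> X)) \<and>
     (\<forall>F :: nat \<Rightarrow> real set. range F \<subseteq> bounded_borel \<and> disjoint_family F \<and>
        (\<Union>i. F i) \<in> bounded_borel \<longrightarrow> (\<lambda>i. \<Omega> (F i)) sums \<Omega> (\<Union>i. F i))"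

definition compactly_supported :: "(real set \<Rightarrow> 'k::finite cmat) \<Rightarrow> bool" where
  "compactly_supported \<Omega> \<longleftrightarrow>
     (\<exists>K. compact K \<and> (\<forall>X\<in>bounded_borel. X \<inter> K = {} \<longrightarrow> \<Omega> X = 0))"

text \<open>
  The scalar measure $v^* \Omega(\cdot)\, v$, extended from the bounded to all Borel sets by
  exhaustion. That the set function below is indeed a measure is confirmed by
  \<open>emeasure_scalar_measure\<close>.
\<close>

definition scalar_measure :: "(real set \<Rightarrow> 'k::finite cmat) \<Rightarrow> complex ^ 'k \<Rightarrow> real measure" where
  "scalar_measure \<Omega> v = measure_of UNIV (sets borel)
     (\<lambda>X. SUP k::nat. ennreal (Re (qform (\<Omega> (X \<inter> {- real k..real k})) v)))"

text \<open>
  Integration of scalar functions against \<open>\<Omega>\<close>, understood through the associated quadratic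
  forms: $T = \int f\,d\Omega$ iff $v^* T v = \int f\,d(v^* \Omega v)$ for all $v$. As $v$ is
  complex, polarization shows that this determines \<open>T\<close> (see \<open>has_matrix_integral_unique\<close>),
  and that it amounts to integrating against each of the complex measures $\Omega_{ij}$.
\<close>

definition has_matrix_integral ::
  "(real \<Rightarrow> complex) \<Rightarrow> 'k::finite cmat \<Rightarrow> (real set \<Rightarrow> 'k cmat) \<Rightarrow> bool" where
  "has_matrix_integral f T \<Omega> \<longleftrightarrow>
     (\<forall>v. integrable (scalar_measure \<Omega> v) f \<and>
          qform T v = (\<integral>x. f x \<partial>scalar_measure \<Omega> v))"

lemma qform_polarization:
  assumes "\<And>v. qform V v = qform W v"
  shows "V = W"
proof -
  define s where "s = (\<lambda>(X :: 'a cmat) u v. \<Sum>i\<in>UNIV. \<Sum>j\<in>UNIV. cnj (u $ i) * X $ i $ j * v $ j)"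
  have s_axis: "s X (axis i 1) (axis j 1) = X $ i $ j" for X i j
  proof -
    have "s X (axis i 1) (axis j 1)
        = (\<Sum>k\<in>UNIV. \<Sum>l\<in>UNIV. if l = j then (if k = i then X $ k $ l else 0) else 0)"
      unfolding s_def by (intro sum.cong refl) (auto simp: axis_def)
    then show ?thesis by simp
  qed
  have expand: "qform X (u + c *s v) = s X u u + c * s X u v + cnj c * s X v u + cnj c * c * s X v v"
    for X u v c
    by (simp add: qform_def s_def algebra_simps sum.distrib sum_distrib_left)
  have diag: "s V u u = s W u u" for u
    using assms[of u] by (simp add: qform_def s_def)
  have "s V u v = s W u v" for u v
  proof -
    have 1: "s V u v + s V v u = s W u v + s W v u"
      using assms[of "u + 1 *s v", unfolded expand] diag by simp
    have "\<i> * s V u v - \<i> * s V v u = \<i> * s W u v - \<i> * s W v u"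
      using assms[of "u + \<i> *s v", unfolded expand] diag by simp
    then have "\<i> * (s V u v - s V v u) = \<i> * (s W u v - s W v u)"
      by (simp add: right_diff_distrib)
    then have "s V u v - s V v u = s W u v - s W v u" by simp
    with 1 have "2 * s V u v = 2 * s W u v" by algebra
    then show ?thesis by simp
  qed
  then show ?thesis by (metis s_axis vec_eq_iff)
qed

lemma has_matrix_integral_unique:
  "has_matrix_integral f T \<Omega> \<Longrightarrow> has_matrix_integral f T' \<Omega> \<Longrightarrow> T = T'"
  by (rule qform_polarization) (simp add: has_matrix_integral_def)

lemma qform_0: "qform 0 v = 0"
  by (simp add: qform_def)

lemma qform_add: "qform (V + W) v = qform V v + qform W v"
  by (simp add: qform_def algebra_simps sum.distrib)

lemma matrix_measure_Un:
  assumes "matrix_measure \<Omega>" "X \<in> bounded_borel" "Y \<in> bounded_borel" "X \<inter> Y = {}"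
  shows "\<Omega> (X \<union> Y) = \<Omega> X + \<Omega> Y"
proof -
  have "range (binaryset X Y) \<subseteq> bounded_borel" "(\<Union>i. binaryset X Y i) \<in> bounded_borel"
    using assms(2,3) by (auto simp: range_binaryset_eq UN_binaryset_eq bounded_borel_def)
  moreover have "disjoint_family (binaryset X Y)"
    using assms(4) by (auto simp: disjoint_family_on_def binaryset_def)
  ultimately have "(\<lambda>i. \<Omega> (binaryset X Y i)) sums \<Omega> (\<Union>i. binaryset X Y i)"
    using assms(1) unfolding matrix_measure_def by blast
  moreover have "(\<lambda>i. \<Omega> (binaryset X Y i)) sums (\<Omega> X + \<Omega> Y)"
    using assms(1) by (intro binaryset_sums) (simp add: matrix_measure_def)
  ultimately show ?thesis
    by (simp add: UN_binaryset_eq sums_unique2)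
qed

lemma matrix_measure_mono:
  assumes "matrix_measure \<Omega>" "X \<in> bounded_borel" "Y \<in> bounded_borel" "X \<subseteq> Y"
  shows "Re (qform (\<Omega> X) v) \<le> Re (qform (\<Omega> Y) v)"
proof -
  have *: "Y - X \<in> bounded_borel"
    using assms by (auto simp: bounded_borel_def intro: bounded_subset)
  have "\<Omega> (X \<union> (Y - X)) = \<Omega> X + \<Omega> (Y - X)"
    using assms * by (intro matrix_measure_Un) auto
  moreover have "X \<union> (Y - X) = Y" using assms(4) by blast
  moreover have "0 \<le> Re (qform (\<Omega> (Y - X)) v)"
    using assms(1) * by (auto simp: matrix_measure_def psd_def)
  ultimately show ?thesis by (simp add: qform_add)
qed

lemma bounded_borel_Int: "X \<in> sets borel \<Longrightarrow> X \<inter> {- real k..real k} \<in> bounded_borel"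
  by (auto simp: bounded_borel_def intro: bounded_subset[of "{- real k..real k}"])

lemma sets_scalar_measure [simp, measurable_cong]: "sets (scalar_measure \<Omega> v) = sets borel"
  using sets.sets_measure_of_eq[of borel] by (simp add: scalar_measure_def)

lemma emeasure_scalar_measure:
  assumes "matrix_measure \<Omega>" "X \<in> sets borel"
  shows "emeasure (scalar_measure \<Omega> v) X
    = (SUP k::nat. ennreal (Re (qform (\<Omega> (X \<inter> {- real k..real k})) v)))"
proof -
  let ?q = "\<lambda>X. Re (qform (\<Omega> X) v)"
  let ?I = "\<lambda>k::nat. {- real k..real k}"
  let ?\<mu> = "\<lambda>X. SUP k::nat. ennreal (?q (X \<inter> ?I k))"
  have "countably_additive (sets borel) ?\<mu>"
  proof (rule countably_additiveI)
    fix F :: "nat \<Rightarrow> real set"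
    assume F: "range F \<subseteq> sets borel" "disjoint_family F" "(\<Union>i. F i) \<in> sets borel"
    have inc: "incseq (\<lambda>k. ennreal (?q (F i \<inter> ?I k)))" for i
      using F by (intro incseq_SucI ennreal_leI matrix_measure_mono[OF assms(1)] bounded_borel_Int) auto
    have sum: "(\<Sum>i. ennreal (?q (F i \<inter> ?I k))) = ennreal (?q ((\<Union>i. F i) \<inter> ?I k))" for k
    proof -
      have "range (\<lambda>i. F i \<inter> ?I k) \<subseteq> bounded_borel"
        using F by (auto intro!: bounded_borel_Int)
      moreover have "disjoint_family (\<lambda>i. F i \<inter> ?I k)"
        using F(2) by (auto simp: disjoint_family_on_def)
      moreover have U: "(\<Union>i. F i \<inter> ?I k) = (\<Union>i. F i) \<inter> ?I k" by blast
      moreover have "(\<Union>i. F i) \<inter> ?I k \<in> bounded_borel"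
        using F(3) by (rule bounded_borel_Int)
      ultimately have "(\<lambda>i. \<Omega> (F i \<inter> ?I k)) sums \<Omega> ((\<Union>i. F i) \<inter> ?I k)"
        using assms(1)[unfolded matrix_measure_def, THEN conjunct2, THEN conjunct2,
            rule_format, of "\<lambda>i. F i \<inter> ?I k"] by auto
      then have "(\<lambda>i. ?q (F i \<inter> ?I k)) sums ?q ((\<Union>i. F i) \<inter> ?I k)"
        unfolding qform_def
        by (intro sums_Re sums_sum sums_mult sums_mult2 bounded_linear.sums[OF bounded_linear_vec_nth])
      moreover have "0 \<le> ?q (F i \<inter> ?I k)" for i
        using assms(1) F(1) bounded_borel_Int[of "F i" k] by (auto simp: matrix_measure_def psd_def)
      ultimately show ?thesis by (intro suminf_ennreal_eq)
    qed
    show "(\<Sum>i. ?\<mu> (F i)) = ?\<mu> (\<Union>i. F i)"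
      by (simp add: ennreal_suminf_SUP_eq[OF inc] sum)
  qed
  then show ?thesis
    using assms(1,2)
    by (subst emeasure_measure_of[OF scalar_measure_def])
       (auto simp: positive_def matrix_measure_def qform_0)
qed

end

theory Submission
  imports Defs "HOL-Complex_Analysis.Complex_Analysis"
begin

text \<open>
  Existence comes from the fixed-point iteration \<open>M\<^sub>k\<^sub>+\<^sub>1(z) = (E L - S(M\<^sub>k(z)) - z \<Lambda>)\<^sup>-\<^sup>1\<close>, started at
  \<open>diag (-1/z, (E Q)\<^sup>-\<^sup>1)\<close>. Positivity of \<open>S\<close> keeps the iterates in the admissible set on the upper half
  plane. For large \<open>|z|\<close>, on both sides of the real axis, conjugation by \<open>diag (z\<^sup>1\<^sup>/\<^sup>2, 1)\<close> turns the
  equation into a perturbation of size \<open>|z|\<^sup>-\<^sup>1\<^sup>/\<^sup>2\<close> of a constant one: although \<open>S\<close> is not small,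
  its off-diagonal and lower right blocks only see the upper left block of \<open>M\<close>, which is of
  order \<open>1/z\<close>. There the iteration is a contraction.

  In the coordinate \<open>w\<close> with \<open>z = r (w + 1/w)\<close> the quadratic forms of the iterates become typically
  real functions on the unit disc. Their Taylor coefficients satisfy \<open>|a\<^sub>n| \<le> n a\<^sub>1\<close>, so convergence near
  \<open>w = 0\<close>, that is, near \<open>z = \<infinity>\<close>, extends to the whole disc and hence to the upper half plane.
  Robertson's integral representation of typically real functions, obtained from Helly's selection
  theorem, is then a Cauchy transform of a measure on \<open>[-2r, 2r]\<close>; polarization assembles
  these scalar measures into \<open>\<Omega>\<close>.

  For uniqueness, taking imaginary parts in the equation gives \<open>\<parallel>M\<^sub>1\<^sub>1(z)\<parallel> \<le> 1 / Im z\<close>, and the block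
  equations then determine the behaviour of every solution along the imaginary axis. Far up the
  axis all solutions lie in the ball on which the equation is contractive, so they agree there, and
  the identity theorem applies. The same asymptotics give the total mass of \<open>\<Omega>\<close>.
\<close>

unbundle no Formal_Power_Series.fps_syntax

section \<open>Typically real functions\<close>

text \<open>No contraction is at hand for moderate z: \<open>S\<close> is not small there, and the
  imaginary part of the pencil may be degenerate. So convergence is proved near infinity only and
  carried inwards by the coefficient bound, which needs no size estimate on the iterates there. It
  does need a full neighbourhood of w = 0, hence also real z and z in the lower half plane; these
  are reached by the contraction and by reflection, not by positivity. The map r (w + 1/w) takes the
  punctured disc bijectively onto the complement of [-2r, 2r], so the half planes and the
  neighbourhood of infinity become one disc, and compact support comes with the representation. Two
  properties do not simply survive the limit. Strict positivity of the imaginary part of the upper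
  left block could degenerate; it is recovered from the Cauchy transform together with z M11 + 1 ->
  0. And the scalar measures are chosen separately for each vector, so nothing makes them quadratic
  in it; this is why linear relations between Cauchy transforms are first shown to carry over to the
  measures.\<close>

abbreviation "angles \<equiv> restrict_space lborel {0..pi::real}"

lemma finite_measure_angles: "finite_measure angles"
  by (rule finite_measureI) (simp add: emeasure_restrict_space space_restrict_space)

lemma integrable_angles:
  fixes f :: "real \<Rightarrow> 'a::{banach, second_countable_topology}"
  assumes "continuous_on {0..pi} f"
  shows "integrable angles f"
  using borel_integrable_atLeastAtMost'[OF assms]
  by (simp add: integrable_restrict_space set_integrable_def)

section \<open>Sine orthogonality and the generating function of the sines\<close>

lemma integral_angles_sin_sin:
  "(\<integral>t. sin (real m * t) * sin (real n * t) \<partial>angles) = (if m = n \<and> n > 0 then pi / 2 else 0)"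
proof -
  \<comment> \<open>The product of sines is half a difference of cosines with the integer
    frequencies m - n and m + n. \<open>G k\<close> is an antiderivative of cos (k t); frequency 0,
    which occurs for m = n, needs its own formula.\<close>
  define G where "G k t = (if k = 0 then t else sin (real_of_int k * t) / real_of_int k)" for k t
  have G: "(G k has_vector_derivative cos (real_of_int k * t)) (at t within S)" for k t S
    unfolding G_def has_real_derivative_iff_has_vector_derivative[symmetric]
    by (cases "k = 0") (auto intro!: derivative_eq_intros)
  define H where "H t = (G (int m - int n) t - G (int m + int n) t) / 2" for t
  have H: "(H has_vector_derivative sin (real m * t) * sin (real n * t)) (at t within S)" for t S
  proof -
    have "(H has_vector_derivative
        (cos (real_of_int (int m - int n) * t) - cos (real_of_int (int m + int n) * t)) / 2) (at t within S)"
      unfolding H_def by (intro derivative_intros G has_vector_derivative_divide)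
    also have "(cos (real_of_int (int m - int n) * t) - cos (real_of_int (int m + int n) * t)) / 2
        = sin (real m * t) * sin (real n * t)"
      by (simp add: sin_times_sin algebra_simps)
    finally show ?thesis .
  qed
  have s: "sin (real_of_int k * pi) = 0" for k
    using sin_integer_2pi[of "k"] sin_npi_int by (metis mult.commute)
  have "(\<integral>t. sin (real m * t) * sin (real n * t) \<partial>angles)
      = (\<integral>t. indicator {0..pi} t *\<^sub>R (sin (real m * t) * sin (real n * t)) \<partial>lborel)"
    by (rule integral_restrict_space) simp
  also have "\<dots> = H pi - H 0"
    by (intro integral_FTC_Icc H continuous_intros) simp
  also have "\<dots> = (if m = n \<and> n > 0 then pi / 2 else 0)"
    using s[of "int m - int n"] s[of "int m + int n"] by (auto simp: H_def G_def)
  finally show ?thesis .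
qed

text \<open>Induction through the addition formula for the sine. The factor \<open>n\<close> of the
  coefficient bound originates here.\<close>

lemma abs_sin_mult_le: "\<bar>sin (real n * t)\<bar> \<le> real n * \<bar>sin t\<bar>"
proof (induction n)
  case (Suc n)
  have "\<bar>sin (real (Suc n) * t)\<bar> \<le> \<bar>sin (real n * t)\<bar> * \<bar>cos t\<bar> + \<bar>cos (real n * t)\<bar> * \<bar>sin t\<bar>"
    by (simp add: algebra_simps sin_add flip: abs_mult)
  also have "\<dots> \<le> \<bar>sin (real n * t)\<bar> * 1 + 1 * \<bar>sin t\<bar>"
    by (intro add_mono mult_mono) auto
  finally show ?case using Suc by (simp add: algebra_simps)
qed simp

text \<open>As a polynomial in \<open>w\<close> this has the zeros \<open>cis t\<close> and
  \<open>cis (- t)\<close> on the unit circle, which is why the bounds below keep it away from 0 in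
  the open disc.\<close>

lemma one_minus_two_cos: "1 - 2 * w * complex_of_real (cos t) + w\<^sup>2 = (1 - w * cis t) * (1 - w * cis (- t))"
proof -
  have "cis t * cis (-t) = 1" by (simp add: cis_mult)
  moreover have "cis t + cis (-t) = 2 * complex_of_real (cos t)"
    by (simp add: complex_eq_iff)
  ultimately show ?thesis by algebra
qed

lemma one_minus_cis_ge: "norm w < 1 \<Longrightarrow> 1 - norm w \<le> norm (1 - w * cis t)"
  using norm_triangle_ineq2[of 1 "w * cis t"] by (simp add: norm_mult)

lemma one_minus_two_cos_ge:
  assumes "norm w < 1"
  shows "(1 - norm w)\<^sup>2 \<le> norm (1 - 2 * w * complex_of_real (cos t) + w\<^sup>2)"
  unfolding one_minus_two_cos norm_mult power2_eq_square[of "1 - norm w"]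
  using assms by (intro mult_mono one_minus_cis_ge) auto

lemma one_minus_two_cos_nz:
  assumes "norm w < 1"
  shows "1 - 2 * w * complex_of_real (cos t) + w\<^sup>2 \<noteq> 0"
  using one_minus_two_cos_ge[OF assms, of t] assms
  by (metis diff_gt_0_iff_gt linorder_not_le norm_zero zero_less_power)

text \<open>\<open>sin (n t)\<close> is a difference of powers of \<open>cis t\<close> and
  \<open>cis (- t)\<close>, so the series splits into two geometric ones. Without the factor
  \<open>sin t\<close> the sum is Robertson's kernel, itself typically real in
  \<open>w\<close>.\<close>

lemma sums_power_sin:
  assumes "norm w < 1"
  shows "(\<lambda>n. w ^ n * complex_of_real (sin (real n * t)))
    sums (w * sin t / (1 - 2 * w * complex_of_real (cos t) + w\<^sup>2))"
proof -
  have g: "(\<lambda>n. (w * cis s) ^ n) sums (1 / (1 - w * cis s))" for s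
    using assms by (intro geometric_sums) (simp add: norm_mult)
  have nz: "1 - w * cis s \<noteq> 0" for s
    using one_minus_cis_ge[OF assms, of s] assms by auto
  have "(\<lambda>n. ((w * cis t) ^ n - (w * cis (-t)) ^ n) / (2 * \<i>))
     sums ((1 / (1 - w * cis t) - 1 / (1 - w * cis (-t))) / (2 * \<i>))"
    by (intro sums_divide sums_diff g)
  moreover have "((w * cis t) ^ n - (w * cis (-t)) ^ n) / (2 * \<i>) = w ^ n * complex_of_real (sin (real n * t))" for n
  proof -
    have "cis (real n * t) - cis (- (real n * t)) = 2 * \<i> * complex_of_real (sin (real n * t))"
      by (simp add: complex_eq_iff)
    then show ?thesis
      by (simp add: power_mult_distrib Complex.DeMoivre flip: right_diff_distrib) (simp add: field_simps)
  qed
  moreover have "(1 / (1 - w * cis t) - 1 / (1 - w * cis (-t))) / (2 * \<i>)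
     = w * sin t / (1 - 2 * w * complex_of_real (cos t) + w\<^sup>2)"
  proof -
    have "cis t - cis (- t) = 2 * \<i> * complex_of_real (sin t)"
      by (simp add: complex_eq_iff)
    then have "1 / (1 - w * cis t) - 1 / (1 - w * cis (-t))
      = w * (2 * \<i> * complex_of_real (sin t)) / ((1 - w * cis t) * (1 - w * cis (-t)))"
      using nz[of t] nz[of "-t"] by (simp add: field_simps)
    then show ?thesis unfolding one_minus_two_cos by (simp add: mult.left_commute[of w])
  qed
  ultimately show ?thesis by simp
qed

text \<open>The derivative at 0 is not normalized and \<open>pos\<close> is a weak inequality, so
  that 0 belongs to the class and limits of sequences stay in it.\<close>

locale typically_real =
  fixes F :: "complex \<Rightarrow> complex"
  assumes hol: "F holomorphic_on ball 0 1"
    and zero: "F 0 = 0"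
    and sym: "norm w < 1 \<Longrightarrow> F (cnj w) = cnj (F w)"
    and pos: "norm w < 1 \<Longrightarrow> 0 < Im w \<Longrightarrow> 0 \<le> Im (F w)"
begin

section \<open>Taylor coefficients as sine integrals over half circles\<close>

definition coef :: "nat \<Rightarrow> real" where "coef n = Re ((deriv ^^ n) F 0 / fact n)"

text \<open>By \<open>sym\<close> the series with conjugated coefficients sums to \<open>F\<close>
  as well, and a power series is determined by its sum.\<close>

lemma coef_eq: "(deriv ^^ n) F 0 / fact n = of_real (coef n)"
proof -
  define c where "c n = (deriv ^^ n) F 0 / fact n" for n
  have S: "(\<lambda>n. c n * w ^ n) sums F w" if "norm w < 1" for w
    using holomorphic_power_series[OF hol, of w] that by (simp add: c_def)
  have S': "(\<lambda>n. cnj (c n) * w ^ n) sums F w" if "norm w < 1" for w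
    using S[of "cnj w"] that sym[of w] by (subst sums_cnj[symmetric]) simp
  have d: "(\<lambda>n. (c n - cnj (c n)) * (w - 0) ^ n) sums 0" if "norm (w - 0) < 1" for w
    using sums_diff[OF S[of w] S'[of w]] that by (simp add: left_diff_distrib)
  have "c n - cnj (c n) = 0"
  proof (cases "n = 0")
    case True then show ?thesis using zero by (simp add: c_def)
  next
    case False
    show ?thesis
    proof (rule ccontr)
      assume "c n - cnj (c n) \<noteq> 0"
      \<comment> \<open>A nonzero difference of coefficients would leave the zero function without
        zeros in a punctured disc. The fact used speaks of positive indices, so index 0 is settled
        beforehand by \<open>F 0 = 0\<close>.\<close>
      show False
      proof (rule powser_0_nonzero[OF zero_less_one d refl \<open>c n - cnj (c n) \<noteq> 0\<close>])
        fix s :: real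
        assume "0 < s" and nz: "\<And>z. z \<in> cball (0::complex) s - {0} \<Longrightarrow> (0::complex) \<noteq> 0"
        then show False using nz[of "of_real s"] by simp
      qed (use False in simp_all)
    qed
  qed
  then have "Im (c n) = 0" by (simp add: complex_eq_iff)
  then show ?thesis unfolding coef_def c_def[symmetric] by (simp add: complex_eq_iff)
qed

lemma power_series: "norm w < 1 \<Longrightarrow> (\<lambda>n. of_real (coef n) * w ^ n) sums F w"
  using holomorphic_power_series[OF hol, of w] by (simp add: coef_eq)

lemma coef_0: "coef 0 = 0"
  by (simp add: coef_def zero)

lemma summable_coef:
  assumes "0 \<le> \<rho>" "\<rho> < 1"
  shows "summable (\<lambda>n. \<bar>coef n\<bar> * \<rho> ^ n)"
proof -
  \<comment> \<open>\<open>(\<rho> + 1) / 2\<close> lies strictly between \<rho> and 1; convergence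
    there forces absolute convergence at \<rho>.\<close>
  have "summable (\<lambda>n. of_real (coef n) * complex_of_real ((\<rho> + 1) / 2) ^ n)"
    using power_series[of "of_real ((\<rho> + 1) / 2)"] assms
    by (intro sums_summable) (auto simp del: of_real_divide of_real_add of_real_power)
  then have "summable (\<lambda>n. norm (of_real (coef n) * complex_of_real \<rho> ^ n))"
    by (rule powser_insidea) (use assms in \<open>auto simp del: of_real_divide of_real_add\<close>)
  then show ?thesis using assms by (simp add: norm_mult norm_power)
qed

text \<open>Taken on circles inside the disc because \<open>F\<close> need not have boundary values;
  the radius tends to 1 only after the estimates.\<close>

definition bdry :: "real \<Rightarrow> real \<Rightarrow> real" where
  "bdry \<rho> t = Im (F (complex_of_real \<rho> * cis t))"

lemma bdry_sums:
  assumes "0 \<le> \<rho>" "\<rho> < 1"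
  shows "(\<lambda>n. coef n * \<rho> ^ n * sin (real n * t)) sums bdry \<rho> t"
proof -
  have "(\<lambda>n. Im (of_real (coef n) * (complex_of_real \<rho> * cis t) ^ n)) sums bdry \<rho> t"
    unfolding bdry_def using assms by (intro sums_Im power_series) (simp add: norm_mult)
  then show ?thesis
    by (simp add: power_mult_distrib Complex.DeMoivre algebra_simps flip: of_real_power)
qed

lemma continuous_on_bdry [continuous_intros]:
  assumes "0 \<le> \<rho>" "\<rho> < 1"
  shows "continuous_on S (bdry \<rho>)"
  unfolding bdry_def
  by (intro continuous_intros continuous_on_compose2[OF holomorphic_on_imp_continuous_on[OF hol]])
     (use assms in \<open>auto simp: norm_mult\<close>)

text \<open>At the end points, where \<open>pos\<close> says nothing, the sine vanishes. Up to a
  constant this product is the density of the representing measures.\<close>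

lemma bdry_nonneg:
  assumes "0 \<le> \<rho>" "\<rho> < 1" "t \<in> {0..pi}"
  shows "0 \<le> bdry \<rho> t * sin t"
proof (cases "\<rho> * sin t = 0")
  case True then show ?thesis by (auto simp: bdry_def zero)
next
  case False
  then have "0 < \<rho> * sin t" using assms sin_ge_zero[of t] by (simp add: less_le)
  then have "0 \<le> bdry \<rho> t"
    unfolding bdry_def using assms by (intro pos) (auto simp: norm_mult)
  then show ?thesis using assms by (simp add: sin_ge_zero)
qed

text \<open>Absolute summability of \<open>coef m * \<rho> ^ m\<close> allows integrating the sine
  series term by term, and orthogonality leaves a single term.\<close>

lemma coef_integral:
  assumes "0 \<le> \<rho>" "\<rho> < 1" "0 < n"
  shows "coef n * \<rho> ^ n = (2 / pi) * (\<integral>t. bdry \<rho> t * sin (real n * t) \<partial>angles)"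
proof -
  let ?f = "\<lambda>m t. coef m * \<rho> ^ m * sin (real m * t) * sin (real n * t)"
  interpret angles: finite_measure angles by (rule finite_measure_angles)
  have int: "integrable angles (?f m)" for m
    by (intro integrable_angles continuous_intros)
  have le: "norm (?f m t) \<le> \<bar>coef m\<bar> * \<rho> ^ m" for m t
  proof -
    have "norm (?f m t) = (\<bar>coef m\<bar> * \<rho> ^ m) * (\<bar>sin (real m * t)\<bar> * \<bar>sin (real n * t)\<bar>)"
      using assms by (simp add: abs_mult)
    also have "\<dots> \<le> (\<bar>coef m\<bar> * \<rho> ^ m) * (1 * 1)"
      using assms by (intro mult_left_mono mult_mono) auto
    finally show ?thesis by simp
  qed
  have s1: "summable (\<lambda>m. norm (?f m t))" for t
    by (rule summable_comparison_test'[OF summable_coef[OF assms(1,2)]]) (use le in auto)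
  have s2: "summable (\<lambda>m. \<integral>t. norm (?f m t) \<partial>angles)"
  proof (rule summable_comparison_test'[OF summable_mult[OF summable_coef[OF assms(1,2)], of pi]])
    fix m
    have "norm (\<integral>t. norm (?f m t) \<partial>angles) = (\<integral>t. norm (?f m t) \<partial>angles)"
      by (simp add: integral_nonneg_AE)
    also have "\<dots> \<le> (\<integral>t. \<bar>coef m\<bar> * \<rho> ^ m \<partial>angles)"
      using int le by (intro integral_mono integrable_norm) auto
    also have "\<dots> = pi * (\<bar>coef m\<bar> * \<rho> ^ m)"
      by (simp add: measure_restrict_space space_restrict_space)
    finally show "norm (\<integral>t. norm (?f m t) \<partial>angles) \<le> pi * (\<bar>coef m\<bar> * \<rho> ^ m)" .
  qed
  have "(\<lambda>m. integral\<^sup>L angles (?f m)) sums (\<integral>t. (\<Sum>m. ?f m t) \<partial>angles)"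
    using int s1 s2 by (intro sums_integral) auto
  moreover have "(\<Sum>m. ?f m t) = bdry \<rho> t * sin (real n * t)" for t
    using sums_mult2[OF bdry_sums[OF assms(1,2), of t], of "sin (real n * t)"] by (simp add: sums_iff)
  moreover have "integral\<^sup>L angles (?f m) = (if m = n then coef n * \<rho> ^ n * (pi / 2) else 0)" for m
    using integral_angles_sin_sin[of m n] assms(3) by (simp add: mult.assoc)
  ultimately have "(\<lambda>m. if m = n then coef n * \<rho> ^ n * (pi / 2) else 0)
      sums (\<integral>t. bdry \<rho> t * sin (real n * t) \<partial>angles)"
    by simp
  then have "coef n * \<rho> ^ n * (pi / 2) = (\<integral>t. bdry \<rho> t * sin (real n * t) \<partial>angles)"
    using sums_single[of n "\<lambda>_. coef n * \<rho> ^ n * (pi / 2)"] sums_unique2 by blast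
  then show ?thesis by (simp add: field_simps)
qed

text \<open>As \<open>bdry \<rho> t * sin t\<close> is nonnegative, \<open>abs_sin_mult_le\<close>
  bounds the integral for index \<open>n\<close> by \<open>n\<close> times the integral for index 1,
  without any loss from absolute values.\<close>

lemma coef_le_aux:
  assumes "0 \<le> \<rho>" "\<rho> < 1"
  shows "\<bar>coef n\<bar> * \<rho> ^ n \<le> real n * (coef 1 * \<rho>)"
proof (cases "n = 0")
  case True then show ?thesis by (simp add: coef_0)
next
  case False
  have "\<bar>coef n * \<rho> ^ n\<bar> = (2 / pi) * \<bar>\<integral>t. bdry \<rho> t * sin (real n * t) \<partial>angles\<bar>"
    using False by (subst coef_integral[OF assms]) (auto simp: abs_mult)
  also have "\<dots> \<le> (2 / pi) * (\<integral>t. \<bar>bdry \<rho> t * sin (real n * t)\<bar> \<partial>angles)"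
    by (intro mult_left_mono integral_abs_bound) auto
  also have "\<dots> \<le> (2 / pi) * (\<integral>t. real n * (bdry \<rho> t * sin t) \<partial>angles)"
  proof (intro mult_left_mono integral_mono integrable_angles continuous_intros assms)
    fix t assume t: "t \<in> space angles"
    have "\<bar>bdry \<rho> t * sin (real n * t)\<bar> \<le> \<bar>bdry \<rho> t\<bar> * (real n * \<bar>sin t\<bar>)"
      unfolding abs_mult by (intro mult_left_mono abs_sin_mult_le) auto
    also have "\<dots> = real n * \<bar>bdry \<rho> t * sin t\<bar>" by (simp add: abs_mult)
    also have "\<dots> = real n * (bdry \<rho> t * sin t)"
      using bdry_nonneg[OF assms, of t] t by (simp add: space_restrict_space)
    finally show "\<bar>bdry \<rho> t * sin (real n * t)\<bar> \<le> real n * (bdry \<rho> t * sin t)" .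
  qed auto
  also have "\<dots> = real n * (coef 1 * \<rho>)"
    using coef_integral[OF assms, of 1] by simp
  finally show ?thesis using assms by (simp add: abs_mult)
qed

lemma coef_le: "\<bar>coef n\<bar> \<le> real n * coef 1"
proof (rule tendsto_le)
  show "((\<lambda>\<rho>. \<bar>coef n\<bar> * \<rho> ^ n) \<longlongrightarrow> \<bar>coef n\<bar>) (at_left (1::real))"
    by (auto intro!: tendsto_eq_intros)
  show "((\<lambda>\<rho>. real n * (coef 1 * \<rho>)) \<longlongrightarrow> real n * coef 1) (at_left (1::real))"
    by (auto intro!: tendsto_eq_intros)
  have "eventually (\<lambda>\<rho>. \<rho> \<in> {0<..<1}) (at_left (1::real))"
    by (rule eventually_at_leftI[of 0]) auto
  then show "eventually (\<lambda>\<rho>. \<bar>coef n\<bar> * \<rho> ^ n \<le> real n * (coef 1 * \<rho>)) (at_left (1::real))"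
    by eventually_elim (rule coef_le_aux; simp)
qed auto

section \<open>Robertson's integral representation\<close>

lemma integral_kernel:
  assumes "0 \<le> \<rho>" "\<rho> < 1" "norm w < 1"
  shows "F (of_real \<rho> * w) = (\<integral>t. (2 / pi) *\<^sub>R ((bdry \<rho> t * sin t) *\<^sub>R
     (w / (1 - 2 * w * complex_of_real (cos t) + w\<^sup>2))) \<partial>angles)"
proof -
  \<comment> \<open>The terms of the power series of \<open>F\<close> at \<rho> times
    \<open>w\<close>, with each coefficient replaced by its sine integral; summing them under the
    integral produces the kernel. The term for n = 0 is 0 on both sides.\<close>
  let ?f = "\<lambda>n t. w ^ n * complex_of_real ((2 / pi) * (bdry \<rho> t * sin (real n * t)))"
  interpret angles: finite_measure angles by (rule finite_measure_angles)
  have int: "integrable angles (?f n)" for n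
    by (intro integrable_angles continuous_intros assms)
  have norm_f: "norm (?f n t) \<le> norm w ^ n * (2 / pi * \<bar>bdry \<rho> t\<bar>)" for n t
  proof -
    have "norm (?f n t) = norm w ^ n * (2 / pi * (\<bar>bdry \<rho> t\<bar> * \<bar>sin (real n * t)\<bar>))"
      unfolding norm_mult norm_power norm_of_real by (simp add: abs_mult)
    also have "\<dots> \<le> norm w ^ n * (2 / pi * (\<bar>bdry \<rho> t\<bar> * 1))"
      by (intro mult_left_mono) auto
    finally show ?thesis by simp
  qed
  have s0: "summable (\<lambda>n. norm w ^ n)"
    using assms by (intro summable_geometric) auto
  have s1: "summable (\<lambda>n. norm (?f n t))" for t
    by (rule summable_comparison_test'[OF summable_mult2[OF s0, of "2 / pi * \<bar>bdry \<rho> t\<bar>"]])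
       (use norm_f in auto)
  have s2: "summable (\<lambda>n. \<integral>t. norm (?f n t) \<partial>angles)"
  proof (rule summable_comparison_test'[OF summable_mult2[OF s0, of "\<integral>t. 2 / pi * \<bar>bdry \<rho> t\<bar> \<partial>angles"]])
    fix n
    have "norm (\<integral>t. norm (?f n t) \<partial>angles) = (\<integral>t. norm (?f n t) \<partial>angles)"
      by (simp add: integral_nonneg_AE)
    also have "\<dots> \<le> (\<integral>t. norm w ^ n * (2 / pi * \<bar>bdry \<rho> t\<bar>) \<partial>angles)"
      using int norm_f by (intro integral_mono integrable_norm integrable_angles continuous_intros assms)
    finally show "norm (\<integral>t. norm (?f n t) \<partial>angles) \<le> norm w ^ n * (\<integral>t. 2 / pi * \<bar>bdry \<rho> t\<bar> \<partial>angles)"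
      by simp
  qed
  have "(\<lambda>n. integral\<^sup>L angles (?f n)) sums (\<integral>t. (\<Sum>n. ?f n t) \<partial>angles)"
    using int s1 s2 by (intro sums_integral) auto
  moreover have "(\<Sum>n. ?f n t) = (2 / pi) *\<^sub>R ((bdry \<rho> t * sin t) *\<^sub>R
     (w / (1 - 2 * w * complex_of_real (cos t) + w\<^sup>2)))" for t
    using sums_mult[OF sums_power_sin[OF assms(3), of t], of "of_real ((2 / pi) * bdry \<rho> t)"]
    by (simp add: sums_iff scaleR_conv_of_real mult_ac)
  moreover have "integral\<^sup>L angles (?f n) = of_real (coef n) * (of_real \<rho> * w) ^ n" for n
  proof (cases "n = 0")
    case True then show ?thesis by (simp add: coef_0)
  next
    case False
    have "integral\<^sup>L angles (?f n) = w ^ n * of_real (\<integral>t. (2 / pi) * (bdry \<rho> t * sin (real n * t)) \<partial>angles)"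
      by (simp only: integral_mult_right_zero integral_complex_of_real)
    also have "(\<integral>t. (2 / pi) * (bdry \<rho> t * sin (real n * t)) \<partial>angles) = coef n * \<rho> ^ n"
      using coef_integral[OF assms(1,2), of n] False by simp
    finally show ?thesis by (simp add: power_mult_distrib mult_ac)
  qed
  ultimately have "(\<lambda>n. of_real (coef n) * (of_real \<rho> * w) ^ n) sums (\<integral>t. (2 / pi) *\<^sub>R ((bdry \<rho> t * sin t) *\<^sub>R
     (w / (1 - 2 * w * complex_of_real (cos t) + w\<^sup>2))) \<partial>angles)"
    by simp
  moreover have "norm (of_real \<rho> * w) < 1"
  proof -
    have "\<rho> * norm w \<le> 1 * norm w" using assms by (intro mult_right_mono) auto
    then show ?thesis using assms by (simp add: norm_mult)
  qed
  ultimately show ?thesis using power_series sums_unique2 by blast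
qed

text \<open>By \<open>coef_integral\<close> for index 1, division by \<open>coef 1 * \<rho>\<close>
  makes the total mass 1. The measure is placed on the whole line, the setting of weak convergence
  and Helly's theorem.\<close>

definition angle_measure :: "real \<Rightarrow> real measure" where
  "angle_measure \<rho> = density lborel
     (\<lambda>t. ennreal (indicator {0..pi} t * ((2 / pi) * (bdry \<rho> t * sin t) / (coef 1 * \<rho>))))"

lemma bdry_measurable [measurable]:
  assumes "0 \<le> \<rho>" "\<rho> < 1"
  shows "bdry \<rho> \<in> borel_measurable borel"
  using assms by (intro borel_measurable_continuous_onI continuous_intros)

lemma integral_angle_measure:
  fixes g :: "real \<Rightarrow> 'a::{banach, second_countable_topology}"
  assumes \<rho>: "0 < \<rho>" "\<rho> < 1" and c: "0 < coef 1" and [measurable]: "g \<in> borel_measurable borel"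
  shows "(\<integral>t. g t \<partial>angle_measure \<rho>)
    = (\<integral>t. ((2 / pi) * (bdry \<rho> t * sin t) / (coef 1 * \<rho>)) *\<^sub>R g t \<partial>angles)"
proof -
  have [measurable]: "bdry \<rho> \<in> borel_measurable borel" using \<rho> by (intro bdry_measurable) auto
  have "(\<integral>t. g t \<partial>angle_measure \<rho>)
    = (\<integral>t. (indicator {0..pi} t * ((2 / pi) * (bdry \<rho> t * sin t) / (coef 1 * \<rho>))) *\<^sub>R g t \<partial>lborel)"
    unfolding angle_measure_def using \<rho> c bdry_nonneg[of \<rho>]
    by (intro integral_density) (auto simp: indicator_def intro!: divide_nonneg_nonneg)
  also have "\<dots> = (\<integral>t. indicator {0..pi} t *\<^sub>R (((2 / pi) * (bdry \<rho> t * sin t) / (coef 1 * \<rho>)) *\<^sub>R g t) \<partial>lborel)"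
    by simp
  also have "\<dots> = (\<integral>t. ((2 / pi) * (bdry \<rho> t * sin t) / (coef 1 * \<rho>)) *\<^sub>R g t \<partial>angles)"
    by (rule integral_restrict_space[symmetric]) simp
  finally show ?thesis .
qed

lemma angle_measure:
  assumes \<rho>: "0 < \<rho>" "\<rho> < 1" and c: "0 < coef 1"
  shows "real_distribution (angle_measure \<rho>)" "measure (angle_measure \<rho>) {-1<..4} = 1"
proof -
  have [measurable]: "bdry \<rho> \<in> borel_measurable borel" using \<rho> by (intro bdry_measurable) auto
  let ?d = "\<lambda>t. (2 / pi) * (bdry \<rho> t * sin t) / (coef 1 * \<rho>)"
  have I: "(2 / pi) * (\<integral>t. bdry \<rho> t * sin t \<partial>angles) = coef 1 * \<rho>"
    using coef_integral[of \<rho> 1] \<rho> by simp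
  have "(\<integral>t. ?d t \<partial>angles) = (2 / pi) * (\<integral>t. bdry \<rho> t * sin t \<partial>angles) / (coef 1 * \<rho>)"
    by simp
  also have "\<dots> = 1"
    by (subst I) (use \<rho> c in simp)
  finally have I1: "(\<integral>t. ?d t \<partial>angles) = 1" .
  have nn: "0 \<le> indicator {0..pi} t * ?d t" for t
    using \<rho> c bdry_nonneg[of \<rho>] by (auto simp: indicator_def intro!: divide_nonneg_nonneg)
  have *: "emeasure (angle_measure \<rho>) X = 1" if X: "X \<in> sets borel" "{0..pi} \<subseteq> X" for X
  proof -
    have "emeasure (angle_measure \<rho>) X = (\<integral>\<^sup>+t. ennreal (indicator {0..pi} t * ?d t) * indicator X t \<partial>lborel)"
      unfolding angle_measure_def using X by (intro emeasure_density) auto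
    also have "\<dots> = (\<integral>\<^sup>+t. ennreal (indicator {0..pi} t *\<^sub>R ?d t) \<partial>lborel)"
      using X(2) by (intro nn_integral_cong) (auto simp: indicator_def)
    also have "\<dots> = ennreal (\<integral>t. indicator {0..pi} t *\<^sub>R ?d t \<partial>lborel)"
    proof (rule nn_integral_eq_integral)
      show "integrable lborel (\<lambda>t. indicator {0..pi} t *\<^sub>R ?d t)"
        using \<rho> c by (intro borel_integrable_atLeastAtMost'[unfolded set_integrable_def] continuous_intros) auto
    qed (use nn in simp)
    also have "(\<integral>t. indicator {0..pi} t *\<^sub>R ?d t \<partial>lborel) = (\<integral>t. ?d t \<partial>angles)"
      by (rule integral_restrict_space[symmetric]) simp
    finally show ?thesis by (simp only: I1 ennreal_1)
  qed
  have sp: "space (angle_measure \<rho>) = UNIV" "sets (angle_measure \<rho>) = sets borel"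
    by (simp_all add: angle_measure_def)
  have "prob_space (angle_measure \<rho>)"
    by (rule prob_spaceI) (simp add: * sp)
  then show "real_distribution (angle_measure \<rho>)"
    by (simp add: real_distribution_def real_distribution_axioms_def sp)
  \<comment> \<open>The half-open interval is the form in which tightness is stated.\<close>
  have "{0..pi} \<subseteq> {-1<..4}" using pi_less_4 by auto
  then show "measure (angle_measure \<rho>) {-1<..4} = 1"
    by (simp add: measure_def *)
qed

lemma coef_1_nonneg: "0 \<le> coef 1"
  using coef_le[of 1] by simp

text \<open>For fixed \<open>w\<close> the kernel is bounded and continuous in \<open>t\<close>, so
  the formula on the smaller circles passes to a weak limit of the angle measures. The subsequence
  is chosen before \<open>w\<close>, so one measure serves all points.\<close>

lemma measure_representation_aux:
  assumes c: "0 < coef 1"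
  shows "\<exists>M. real_distribution M \<and> (\<forall>w. norm w < 1 \<longrightarrow>
    F w = coef 1 *\<^sub>R (\<integral>t. w / (1 - 2 * w * complex_of_real (cos t) + w\<^sup>2) \<partial>M))"
proof -
  \<comment> \<open>Runs from 1/2 up to 1; with a single \<open>Suc\<close> the first radius would
    be 0, where \<open>angle_measure\<close> divides by 0.\<close>
  define \<rho> where "\<rho> k = 1 - inverse (real (Suc (Suc k)))" for k
  have \<rho>: "0 < \<rho> k" "\<rho> k < 1" for k by (auto simp: \<rho>_def field_simps)
  have "tight (\<lambda>k. angle_measure (\<rho> k))"
    unfolding tight_def
  proof (intro conjI allI impI)
    fix \<epsilon> :: real assume "0 < \<epsilon>"
    then have "- 1 < (4::real) \<and> (\<forall>k. 1 - \<epsilon> < measure (angle_measure (\<rho> k)) {-1<..4})"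
      using angle_measure[OF \<rho> c] by simp
    then show "\<exists>a b. a < b \<and> (\<forall>k. 1 - \<epsilon> < measure (angle_measure (\<rho> k)) {a<..b})" by blast
  qed (rule angle_measure[OF \<rho> c])
  from tight_imp_convergent_subsubsequence[OF this, of id]
  obtain r M where r: "strict_mono (r :: nat \<Rightarrow> nat)" and M: "real_distribution M"
    and wc: "weak_conv_m (\<lambda>k. angle_measure (\<rho> (r k))) M"
    by (auto simp: strict_mono_def o_def)
  have \<rho>_lim: "(\<lambda>k. \<rho> (r k)) \<longlonglongrightarrow> 1"
  proof -
    have "\<rho> \<longlonglongrightarrow> 1 - 0"
      unfolding \<rho>_def by (intro tendsto_intros LIMSEQ_Suc[OF LIMSEQ_inverse_real_of_nat])
    then show ?thesis using LIMSEQ_subseq_LIMSEQ[OF _ r] by (fastforce simp: o_def)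
  qed
  have "F w = coef 1 *\<^sub>R (\<integral>t. w / (1 - 2 * w * complex_of_real (cos t) + w\<^sup>2) \<partial>M)" if w: "norm w < 1" for w
  proof -
    let ?g = "\<lambda>t. w / (1 - 2 * w * complex_of_real (cos t) + w\<^sup>2)"
    have cont: "isCont ?g t" for t
      using one_minus_two_cos_nz[OF w] by (intro continuous_intros) auto
    have bd: "norm (?g t) \<le> norm w / (1 - norm w)\<^sup>2" for t
      unfolding norm_divide using one_minus_two_cos_ge[OF w, of t] w by (intro frac_le) auto
    have meas: "?g \<in> borel_measurable borel"
      by (intro borel_measurable_continuous_onI) (use cont in \<open>auto simp: continuous_on_eq_continuous_at\<close>)
    have lim: "(\<lambda>k. \<integral>t. ?g t \<partial>angle_measure (\<rho> (r k))) \<longlonglongrightarrow> (\<integral>t. ?g t \<partial>M)"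
      using angle_measure[OF \<rho> c] M wc cont bd
      by (intro weak_conv_imp_integral_bdd_continuous_conv) auto
    have "(\<integral>t. ?g t \<partial>angle_measure (\<rho> k)) = F (of_real (\<rho> k) * w) /\<^sub>R (coef 1 * \<rho> k)" for k
    proof -
      have "(\<integral>t. ?g t \<partial>angle_measure (\<rho> k))
          = (\<integral>t. ((2 / pi) * (bdry (\<rho> k) t * sin t) / (coef 1 * \<rho> k)) *\<^sub>R ?g t \<partial>angles)"
        by (rule integral_angle_measure[OF \<rho> c meas])
      also have "\<dots> = (\<integral>t. inverse (coef 1 * \<rho> k) *\<^sub>R ((2 / pi) *\<^sub>R ((bdry (\<rho> k) t * sin t) *\<^sub>R ?g t)) \<partial>angles)"
        by (simp add: divide_inverse mult_ac)
      also have "\<dots> = inverse (coef 1 * \<rho> k) *\<^sub>R (\<integral>t. (2 / pi) *\<^sub>R ((bdry (\<rho> k) t * sin t) *\<^sub>R ?g t) \<partial>angles)"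
        by (rule integral_scaleR_right)
      also have "\<dots> = inverse (coef 1 * \<rho> k) *\<^sub>R F (of_real (\<rho> k) * w)"
        by (subst integral_kernel) (use \<rho>[of k] w in simp_all)
      finally show ?thesis .
    qed
    with lim have "(\<lambda>k. (coef 1 * \<rho> (r k)) *\<^sub>R (F (of_real (\<rho> (r k)) * w) /\<^sub>R (coef 1 * \<rho> (r k))))
        \<longlonglongrightarrow> (coef 1 * 1) *\<^sub>R (\<integral>t. ?g t \<partial>M)"
      by (intro tendsto_intros \<rho>_lim) simp
    moreover have "(coef 1 * \<rho> k) *\<^sub>R (x /\<^sub>R (coef 1 * \<rho> k)) = x" for k and x :: complex
      using c \<rho>[of k] by (simp add: field_simps)
    ultimately have "(\<lambda>k. F (of_real (\<rho> (r k)) * w)) \<longlonglongrightarrow> coef 1 *\<^sub>R (\<integral>t. ?g t \<partial>M)"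
      by simp
    moreover have "(\<lambda>k. F (of_real (\<rho> (r k)) * w)) \<longlonglongrightarrow> F w"
    proof -
      have "isCont F w"
        using holomorphic_on_imp_continuous_on[OF hol] w
        by (auto simp: continuous_on_eq_continuous_at)
      moreover have "(\<lambda>k. of_real (\<rho> (r k)) * w) \<longlonglongrightarrow> of_real 1 * w"
        by (intro tendsto_intros \<rho>_lim)
      ultimately show ?thesis using isCont_tendsto_compose by fastforce
    qed
    ultimately show ?thesis using LIMSEQ_unique by blast
  qed
  with M show ?thesis by blast
qed

text \<open>Dividing numerator and denominator of the kernel by \<open>w\<close> leaves
  \<open>w + 1 / w - 2 * cos t\<close> below; pushing the angle measure forward along
  \<open>2 * cos t\<close> turns this into a Cauchy kernel on [-2, 2].\<close>

lemma measure_representation: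
  "\<exists>\<mu>. finite_measure \<mu> \<and> sets \<mu> = sets borel \<and> emeasure \<mu> (- {-2..2}) = 0
    \<and> (\<forall>w. norm w < 1 \<longrightarrow> w \<noteq> 0 \<longrightarrow> F w = (\<integral>x. 1 / (w + 1 / w - complex_of_real x) \<partial>\<mu>))"
proof (cases "coef 1 = 0")
  case True
  \<comment> \<open>No probability measure can be normalized here, but \<open>coef_le\<close> kills
    all coefficients and the null measure represents \<open>F = 0\<close>.\<close>
  then have "coef n = 0" for n using coef_le[of n] by simp
  then have "F w = 0" if "norm w < 1" for w
    using power_series[OF that] by (simp add: sums_iff)
  then show ?thesis
    by (intro exI[of _ "null_measure borel"]) (auto intro!: finite_measureI)
next
  case False
  then have c: "0 < coef 1" using coef_1_nonneg by simp
  obtain M where M: "real_distribution M" and F: "\<And>w. norm w < 1 \<Longrightarrow>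
    F w = coef 1 *\<^sub>R (\<integral>t. w / (1 - 2 * w * complex_of_real (cos t) + w\<^sup>2) \<partial>M)"
    using measure_representation_aux[OF c] by blast
  interpret M: real_distribution M by (rule M)
  have [measurable_cong]: "sets M = sets borel" by simp
  define \<nu> where "\<nu> = density M (\<lambda>_. ennreal (coef 1))"
  have [measurable_cong]: "sets \<nu> = sets borel" by (simp add: \<nu>_def)
  have "space \<nu> = UNIV" by (simp add: \<nu>_def)
  have tot: "emeasure \<nu> UNIV = ennreal (coef 1)"
    using M.emeasure_space_1 by (simp add: \<nu>_def emeasure_density)
  define \<mu> where "\<mu> = distr \<nu> borel (\<lambda>t. 2 * cos t)"
  have meas[measurable]: "(\<lambda>t::real. 2 * cos t) \<in> borel_measurable borel"
    by measurable
  have tot': "emeasure \<mu> UNIV = ennreal (coef 1)"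
    unfolding \<mu>_def by (subst emeasure_distr) (auto simp: tot \<open>space \<nu> = UNIV\<close>)
  have "finite_measure \<mu>"
    by (rule finite_measureI) (use tot' in \<open>simp add: \<mu>_def\<close>)
  moreover have "emeasure \<mu> (- {-2..2}) = 0"
  proof -
    have "(\<lambda>t::real. 2 * cos t) -` (- {-2..2}) \<inter> space \<nu> = {}"
      using cos_le_one cos_ge_minus_one by (auto simp: mult_le_cancel_left)
    then show ?thesis unfolding \<mu>_def by (subst emeasure_distr) auto
  qed
  moreover have "F w = (\<integral>x. 1 / (w + 1 / w - complex_of_real x) \<partial>\<mu>)" if w: "norm w < 1" "w \<noteq> 0" for w
  proof -
    have "(\<integral>x. 1 / (w + 1 / w - complex_of_real x) \<partial>\<mu>) = (\<integral>t. 1 / (w + 1 / w - complex_of_real (2 * cos t)) \<partial>\<nu>)"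
      unfolding \<mu>_def by (rule integral_distr) auto
    also have "\<dots> = (\<integral>t. coef 1 *\<^sub>R (1 / (w + 1 / w - complex_of_real (2 * cos t))) \<partial>M)"
      unfolding \<nu>_def using c by (intro integral_density) auto
    also have "(\<lambda>t. 1 / (w + 1 / w - complex_of_real (2 * cos t)))
       = (\<lambda>t. w / (1 - 2 * w * complex_of_real (cos t) + w\<^sup>2))"
      using w(2) by (auto simp: fun_eq_iff field_simps power2_eq_square)
    also have "(\<integral>t. coef 1 *\<^sub>R (w / (1 - 2 * w * complex_of_real (cos t) + w\<^sup>2)) \<partial>M) = F w"
      using F[OF w(1)] by simp
    finally show ?thesis by simp
  qed
  ultimately show ?thesis
    by (intro exI[of _ \<mu>]) (auto simp: \<mu>_def)
qed

text \<open>Cauchy's inequality on radius 1/4. Through \<open>coef_le\<close> a bound near the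
  origin thus controls all coefficients, uniformly along a sequence.\<close>

lemma coef_1_le:
  assumes "\<And>w. norm w < 1 / 2 \<Longrightarrow> norm (F w) \<le> K"
  shows "coef 1 \<le> 4 * K"
proof -
  have "norm ((deriv ^^ 1) F 0) \<le> fact 1 * K / (1 / 4) ^ 1"
    by (rule Cauchy_inequality)
       (use assms in \<open>auto intro!: holomorphic_on_subset[OF hol] continuous_on_subset[OF holomorphic_on_imp_continuous_on[OF hol]]\<close>)
  then show ?thesis
    using coef_eq[of 1] coef_1_nonneg by simp
qed

end

text \<open>
  The coefficients converge by Cauchy's inequality near the origin and are dominated by multiples of \<open>n\<close>,
  so Tannery's theorem applies on the whole disc.
\<close>

lemma typically_real_convergent:
  assumes "\<And>k. typically_real (F k)"
    and K: "\<And>k w. norm w < 1 / 2 \<Longrightarrow> norm (F k w) \<le> K"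
    and C: "\<And>k w. norm w < 1 / 2 \<Longrightarrow> norm (F (Suc k) w - F k w) \<le> C * (1 / 2) ^ k"
  shows "\<exists>G. typically_real G \<and> (\<forall>w. norm w < 1 \<longrightarrow> (\<lambda>k. F k w) \<longlonglongrightarrow> G w)"
proof -
  interpret typically_real "F k" for k by (rule assms)
  \<comment> \<open>Each coefficient inherits the rate 2^-k from the neighbourhood of 0. The
    constant grows exponentially in \<open>n\<close>, so this alone would give convergence near 0
    only.\<close>
  have dif: "\<bar>coef (Suc k) n - coef k n\<bar> \<le> C * (1 / 2) ^ k / (1 / 4) ^ n" for k n
  proof -
    have h: "(\<lambda>w. F (Suc k) w - F k w) holomorphic_on ball 0 1" for k
      by (intro holomorphic_intros hol)
    have "norm ((deriv ^^ n) (\<lambda>w. F (Suc k) w - F k w) 0) \<le> fact n * (C * (1 / 2) ^ k) / (1 / 4) ^ n"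
      by (rule Cauchy_inequality)
         (use C in \<open>auto intro!: holomorphic_on_subset[OF h] continuous_on_subset[OF holomorphic_on_imp_continuous_on[OF h]]\<close>)
    moreover have "(deriv ^^ n) (\<lambda>w. F (Suc k) w - F k w) 0 = (deriv ^^ n) (F (Suc k)) 0 - (deriv ^^ n) (F k) 0"
      by (rule higher_deriv_diff[OF hol hol]) auto
    moreover have "(deriv ^^ n) (F k) 0 = fact n * of_real (coef k n)" for k
      using coef_eq[of n k] by (simp add: field_simps)
    ultimately have "norm (fact n * complex_of_real (coef (Suc k) n - coef k n)) \<le> fact n * (C * (1 / 2) ^ k) / (1 / 4) ^ n"
      by (simp add: right_diff_distrib)
    then have "fact n * \<bar>coef (Suc k) n - coef k n\<bar> \<le> fact n * (C * (1 / 2) ^ k / (1 / 4) ^ n)"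
      by (simp only: norm_mult norm_fact norm_of_real times_divide_eq_right)
    then show ?thesis by (simp only: mult_le_cancel_left_pos fact_gt_zero)
  qed
  have "convergent (\<lambda>k. coef k n)" for n
  proof -
    have "summable (\<lambda>k. coef (Suc k) n - coef k n)"
    proof (rule summable_comparison_test')
      show "summable (\<lambda>k. C / (1 / 4) ^ n * (1 / 2) ^ k)"
        by (intro summable_mult summable_geometric) auto
      show "norm (coef (Suc k) n - coef k n) \<le> C / (1 / 4) ^ n * (1 / 2) ^ k" for k
        using dif[of k n] by simp
    qed
    then have "(\<lambda>k. \<Sum>j<k. coef (Suc j) n - coef j n) \<longlonglongrightarrow> (\<Sum>j. coef (Suc j) n - coef j n)"
      by (rule summable_LIMSEQ)
    then have "convergent (\<lambda>k. coef k n - coef 0 n)"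
      unfolding sum_lessThan_telescope[of "\<lambda>k. coef k n"] convergent_def by blast
    then show ?thesis
      using convergent_diff_const_right_iff by blast
  qed
  then obtain b where b: "(\<lambda>k. coef k n) \<longlonglongrightarrow> b n" for n
    unfolding convergent_def by metis
  define G where "G w = (\<Sum>n. of_real (b n) * w ^ n)" for w :: complex
  have lim: "(\<lambda>n. of_real (b n) * w ^ n) sums G w \<and> (\<lambda>k. F k w) \<longlonglongrightarrow> G w" if w: "norm w < 1" for w
  proof -
    \<comment> \<open>Growth linear in \<open>n\<close> and uniform in \<open>k\<close>, hence a
      summable majorant at every point of the disc.\<close>
    have bound: "norm (of_real (coef k n) * w ^ n) \<le> real n * (4 * K) * norm w ^ n" for k n
    proof -
      have "\<bar>coef k n\<bar> \<le> real n * coef k 1" by (rule coef_le)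
      also have "\<dots> \<le> real n * (4 * K)"
        using coef_1_le K by (intro mult_left_mono) auto
      finally show ?thesis by (auto simp: norm_mult norm_power intro!: mult_right_mono)
    qed
    have "summable (\<lambda>n. real (Suc n) * norm w ^ n)"
      using w geometric_deriv_sums[of "norm w"] by (auto simp: sums_iff)
    then have "summable (\<lambda>n. real n * norm w ^ n)"
      by (rule summable_comparison_test') (auto intro!: mult_right_mono)
    from summable_mult[OF this, of "4 * K"]
    have "summable (\<lambda>n. real n * (4 * K) * norm w ^ n)" by (simp add: mult_ac)
    then have T: "eventually (\<lambda>k. summable (\<lambda>n. norm (of_real (coef k n) * w ^ n))) sequentially
        \<and> summable (\<lambda>n. norm (of_real (b n) * w ^ n))
        \<and> (\<lambda>k. \<Sum>n. of_real (coef k n) * w ^ n) \<longlonglongrightarrow> (\<Sum>n. of_real (b n) * w ^ n)"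
      using bound
      by (intro tannerys_theorem[where M = "\<lambda>n. real n * (4 * K) * norm w ^ n"])
         (auto intro!: tendsto_intros b always_eventually)
    have "(\<lambda>n. of_real (b n) * w ^ n) sums G w"
      unfolding G_def using T by (intro summable_sums) (auto dest: summable_norm_cancel)
    moreover have "(\<Sum>n. of_real (coef k n) * w ^ n) = F k w" for k
      using power_series[OF w] by (simp add: sums_iff)
    ultimately show ?thesis using T by (simp add: G_def)
  qed
  have "typically_real G"
  proof
    show "G holomorphic_on ball 0 1"
      by (rule power_series_holomorphic[where a = "\<lambda>n. of_real (b n)"]) (use lim in auto)
    show "G 0 = 0"
      using lim[of 0] zero by (simp add: LIMSEQ_const_iff)
    show "G (cnj w) = cnj (G w)" if w: "norm w < 1" for w
    proof -
      have "(\<lambda>k. F k (cnj w)) \<longlonglongrightarrow> G (cnj w)" using lim[of "cnj w"] w by simp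
      moreover have "(\<lambda>k. cnj (F k w)) \<longlonglongrightarrow> cnj (G w)" using lim[OF w] by (intro tendsto_cnj) simp
      ultimately show ?thesis using sym[OF w] by (simp add: LIMSEQ_unique)
    qed
    show "0 \<le> Im (G w)" if w: "norm w < 1" "0 < Im w" for w
    proof (rule LIMSEQ_le_const)
      show "(\<lambda>k. Im (F k w)) \<longlonglongrightarrow> Im (G w)" using lim[OF w(1)] by (intro tendsto_Im) simp
    qed (use pos[OF w] in auto)
  qed
  with lim show ?thesis by blast
qed

section \<open>Uniqueness of Cauchy transforms\<close>

lemma cauchy_kernel_nz: "0 < Im z \<Longrightarrow> complex_of_real x - z \<noteq> 0"
  by (auto simp: complex_eq_iff)

lemma cauchy_kernel_bound: "0 < Im z \<Longrightarrow> norm (1 / (complex_of_real x - z)) \<le> 1 / Im z"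
  using abs_Im_le_cmod[of "complex_of_real x - z"] unfolding norm_divide norm_one
  by (intro frac_le) auto

text \<open>On the imaginary axis \<open>z / (x - z)\<close> has norm at most 1 and tends to -1, so
  dominated convergence applies with any integrable weight \<open>g\<close>. \<open>Suc k\<close>
  keeps the points off the real axis.\<close>

lemma cauchy_transform_limit:
  fixes g :: "real \<Rightarrow> complex"
  assumes \<mu>: "sets \<mu> = sets borel" and g: "integrable \<mu> g"
  defines "z \<equiv> \<lambda>k. \<i> * complex_of_real (real (Suc k))"
  shows "(\<lambda>k. z k * (\<integral>x. g x * (1 / (complex_of_real x - z k)) \<partial>\<mu>)) \<longlonglongrightarrow> - (\<integral>x. g x \<partial>\<mu>)"
proof -
  have Im: "0 < Im (z k)" for k by (simp add: z_def)
  have "(\<lambda>k. \<integral>x. z k * (g x * (1 / (complex_of_real x - z k))) \<partial>\<mu>) \<longlonglongrightarrow> (\<integral>x. - g x \<partial>\<mu>)"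
  proof (rule integral_dominated_convergence[where w = "\<lambda>x. norm (g x)"])
    show "AE x in \<mu>. (\<lambda>k. z k * (g x * (1 / (complex_of_real x - z k)))) \<longlonglongrightarrow> - g x"
    proof (rule AE_I2)
      fix x
      have "z k * (g x * (1 / (complex_of_real x - z k)))
          = - (g x * (1 / (1 + \<i> * of_real x * of_real (inverse (real (Suc k))))))" for k
      proof -
        have "1 + (complex_of_nat k + \<i> * complex_of_real x) \<noteq> 0"
          by (auto simp: complex_eq_iff)
        then have "z k * (1 / (of_real x - z k)) = - (1 / (1 + \<i> * of_real x * of_real (inverse (real (Suc k)))))"
          using cauchy_kernel_nz[OF Im, of x k]
          by (simp add: z_def divide_simps del: of_nat_Suc) (auto simp: algebra_simps)
        then have "g x * (z k * (1 / (of_real x - z k))) = g x * - (1 / (1 + \<i> * of_real x * of_real (inverse (real (Suc k)))))"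
          by (simp only:)
        then show ?thesis by (simp only: mult.left_commute[of "z k"] mult_minus_right)
      qed
      moreover have "(\<lambda>k. - (g x * (1 / (1 + \<i> * of_real x * of_real (inverse (real (Suc k)))))))
         \<longlonglongrightarrow> - (g x * (1 / (1 + \<i> * complex_of_real x * of_real 0)))"
        by (intro tendsto_intros LIMSEQ_inverse_real_of_nat) auto
      ultimately show "(\<lambda>k. z k * (g x * (1 / (complex_of_real x - z k)))) \<longlonglongrightarrow> - g x" by simp
    qed
    show "AE x in \<mu>. norm (z k * (g x * (1 / (complex_of_real x - z k)))) \<le> norm (g x)" for k
    proof (rule AE_I2)
      fix x
      have "norm (z k) * norm (1 / (complex_of_real x - z k)) \<le> Im (z k) * (1 / Im (z k))"
        by (intro mult_mono cauchy_kernel_bound Im) (use Im in \<open>auto simp: z_def norm_mult simp del: of_nat_Suc\<close>)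
      also have "\<dots> = 1" using Im[of k] by simp
      finally have "norm (g x) * (norm (z k) * norm (1 / (complex_of_real x - z k))) \<le> norm (g x) * 1"
        by (intro mult_left_mono) auto
      then show "norm (z k * (g x * (1 / (complex_of_real x - z k)))) \<le> norm (g x)"
        by (simp only: norm_mult mult.left_commute[of "norm (z k)"] mult_1_right)
    qed
  qed (use g borel_measurable_integrable[OF g] in \<open>auto simp: measurable_cong_sets[OF \<mu>]\<close>)
  then show ?thesis by (simp only: integral_mult_right_zero integral_minus)
qed

text \<open>Uniqueness of Cauchy transforms in the form of a finite complex combination, since it
  will be applied to a polarization identity with many terms and complex coefficients. The goal is
  \<open>measure_relation\<close>.\<close>

locale stieltjes_relation =
  fixes \<mu> :: "'i \<Rightarrow> real measure" and c :: "'i \<Rightarrow> complex" and I :: "'i set" and R :: real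
  assumes fin: "finite I"
    and finite_measure: "i \<in> I \<Longrightarrow> finite_measure (\<mu> i)"
    and sets_eq: "i \<in> I \<Longrightarrow> sets (\<mu> i) = sets borel"
    and supp: "i \<in> I \<Longrightarrow> emeasure (\<mu> i) (- {-R..R}) = 0"
    and relation: "0 < Im z \<Longrightarrow> (\<Sum>i\<in>I. c i * (\<integral>x. 1 / (complex_of_real x - z) \<partial>\<mu> i)) = 0"
begin

text \<open>Integration against the complex measure with parts \<open>c i\<close> times
  \<open>\<mu> i\<close>, without forming that measure.\<close>

definition comb :: "(real \<Rightarrow> complex) \<Rightarrow> complex" where
  "comb g = (\<Sum>i\<in>I. c i * (\<integral>x. g x \<partial>\<mu> i))"

lemma AE_bounded: "i \<in> I \<Longrightarrow> AE x in \<mu> i. \<bar>x\<bar> \<le> R"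
  by (rule AE_I[where N = "- {-R..R}"])
     (use supp sets_eq in \<open>auto simp: sets_eq_imp_space_eq[OF sets_eq]\<close>)

lemma integrable_bounded:
  fixes g :: "real \<Rightarrow> complex"
  assumes "i \<in> I" "g \<in> borel_measurable borel" "\<And>x. \<bar>x\<bar> \<le> R \<Longrightarrow> norm (g x) \<le> B"
  shows "integrable (\<mu> i) g"
proof -
  interpret finite_measure "\<mu> i" by (rule finite_measure[OF assms(1)])
  show ?thesis
    using assms(2) AE_bounded[OF assms(1)]
    by (intro integrable_const_bound[where B = B])
       (auto simp: measurable_cong_sets[OF sets_eq[OF assms(1)]] assms(3) elim!: eventually_mono)
qed

lemma comb_tendsto:
  assumes meas: "\<And>k. g k \<in> borel_measurable borel" "h \<in> borel_measurable borel"
    and B: "\<And>k x. \<bar>x\<bar> \<le> R \<Longrightarrow> norm (g k x) \<le> B"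
    and lim: "\<And>x. \<bar>x\<bar> \<le> R \<Longrightarrow> (\<lambda>k. g k x) \<longlonglongrightarrow> h x"
  shows "(\<lambda>k. comb (g k)) \<longlonglongrightarrow> comb h"
  unfolding comb_def
proof (intro tendsto_intros)
  fix i assume i: "i \<in> I"
  interpret finite_measure "\<mu> i" by (rule finite_measure[OF i])
  show "(\<lambda>k. \<integral>x. g k x \<partial>\<mu> i) \<longlonglongrightarrow> (\<integral>x. h x \<partial>\<mu> i)"
    using AE_bounded[OF i] meas
    by (intro integral_dominated_convergence[where w = "\<lambda>_. B"])
       (auto simp: measurable_cong_sets[OF sets_eq[OF i]] B lim elim!: eventually_mono)
qed

lemma comb_add:
  assumes "\<And>i. i \<in> I \<Longrightarrow> integrable (\<mu> i) g" "\<And>i. i \<in> I \<Longrightarrow> integrable (\<mu> i) h"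
  shows "comb (\<lambda>x. g x + h x) = comb g + comb h"
  using assms by (simp add: comb_def distrib_left sum.distrib)

lemma comb_cmult: "comb (\<lambda>x. a * g x) = a * comb g"
  by (simp add: comb_def sum_distrib_left mult_ac)

lemma power_bound: "\<bar>x\<bar> \<le> R \<Longrightarrow> norm (complex_of_real x ^ n) \<le> R ^ n"
  by (simp add: norm_power power_mono)

lemma power_resolvent_bound:
  assumes "\<bar>x\<bar> \<le> R" "0 < Im z"
  shows "norm (complex_of_real x ^ n * (1 / (complex_of_real x - z))) \<le> R ^ n * (1 / Im z)"
  unfolding norm_mult using assms
  by (intro mult_mono power_bound cauchy_kernel_bound) auto

lemma integrable_power: "i \<in> I \<Longrightarrow> integrable (\<mu> i) (\<lambda>x. complex_of_real x ^ n)"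
  by (rule integrable_bounded[OF _ _ power_bound]) auto

lemma integrable_power_resolvent:
  "i \<in> I \<Longrightarrow> 0 < Im z \<Longrightarrow> integrable (\<mu> i) (\<lambda>x. complex_of_real x ^ n * (1 / (of_real x - z)))"
  by (rule integrable_bounded[OF _ _ power_resolvent_bound]) auto

text \<open>
  Multiplying by \<open>- z\<close> and letting \<open>z \<rightarrow> i \<infinity>\<close> turns the transform of \<open>x\<^sup>n\<close> into its integral, and
  \<open>x / (x - z) = 1 + z / (x - z)\<close> leads from \<open>n\<close> to \<open>n + 1\<close>.
\<close>

lemma comb_resolvent_power: "(\<forall>z. 0 < Im z \<longrightarrow> comb (\<lambda>x. of_real x ^ n * (1 / (of_real x - z))) = 0)
   \<and> comb (\<lambda>x. of_real x ^ n) = 0"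
proof (induction n)
  have moment: "comb (\<lambda>x. of_real x ^ n) = 0"
    if "\<And>z. 0 < Im z \<Longrightarrow> comb (\<lambda>x. of_real x ^ n * (1 / (of_real x - z))) = 0" for n
  proof -
    define z where "z k = \<i> * complex_of_real (real (Suc k))" for k
    have "(\<lambda>k. \<Sum>i\<in>I. c i * (z k * (\<integral>x. of_real x ^ n * (1 / (of_real x - z k)) \<partial>\<mu> i)))
        \<longlonglongrightarrow> (\<Sum>i\<in>I. c i * - (\<integral>x. of_real x ^ n \<partial>\<mu> i))"
      unfolding z_def by (intro tendsto_intros cauchy_transform_limit sets_eq integrable_power)
    moreover have "(\<Sum>i\<in>I. c i * (z k * (\<integral>x. of_real x ^ n * (1 / (of_real x - z k)) \<partial>\<mu> i))) = 0" for k
    proof -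
      have "(\<Sum>i\<in>I. c i * (z k * (\<integral>x. of_real x ^ n * (1 / (of_real x - z k)) \<partial>\<mu> i)))
          = z k * comb (\<lambda>x. of_real x ^ n * (1 / (of_real x - z k)))"
        unfolding comb_def sum_distrib_left by (simp only: mult.left_commute)
      then show ?thesis using that[of "z k"] by (simp add: z_def)
    qed
    ultimately have "(\<Sum>i\<in>I. c i * - (\<integral>x. of_real x ^ n \<partial>\<mu> i)) = 0"
      by (simp only: LIMSEQ_const_iff)
    then show ?thesis by (simp add: comb_def sum_negf)
  qed
  {
    case 0
    have "comb (\<lambda>x. of_real x ^ 0 * (1 / (of_real x - z))) = 0" if "0 < Im z" for z
      using relation[OF that] by (simp add: comb_def)
    then show ?case using moment[of 0] by blast
  next
    case (Suc n)
    have "comb (\<lambda>x. of_real x ^ Suc n * (1 / (of_real x - z))) = 0" if z: "0 < Im z" for z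
    proof -
      have "(\<lambda>x. of_real x ^ Suc n * (1 / (of_real x - z)))
         = (\<lambda>x. of_real x ^ n + z * (of_real x ^ n * (1 / (of_real x - z))))"
      proof
        fix x
        have "complex_of_real x * (1 / (of_real x - z)) = 1 + z * (1 / (of_real x - z))"
          using cauchy_kernel_nz[OF z, of x] by (simp add: divide_simps)
        then have "complex_of_real x ^ n * (of_real x * (1 / (of_real x - z)))
            = of_real x ^ n * (1 + z * (1 / (of_real x - z)))" by simp
        then show "complex_of_real x ^ Suc n * (1 / (of_real x - z))
            = of_real x ^ n + z * (of_real x ^ n * (1 / (of_real x - z)))"
          by (simp add: distrib_left mult_ac)
      qed
      moreover have "comb (\<lambda>x. of_real x ^ n + z * (of_real x ^ n * (1 / (of_real x - z))))
          = comb (\<lambda>x. of_real x ^ n) + comb (\<lambda>x. z * (of_real x ^ n * (1 / (of_real x - z))))"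
        by (intro comb_add integrable_mult_right integrable_power integrable_power_resolvent z)
      moreover have "comb (\<lambda>x. z * (of_real x ^ n * (1 / (of_real x - z)))) = 0"
        unfolding comb_cmult using Suc z by simp
      ultimately show ?thesis using Suc by (simp only: add_0_left)
    qed
    then show ?case using moment[of "Suc n"] by blast
  }
qed

section \<open>From moments to Borel sets\<close>

lemma comb_polynomial:
  assumes "real_polynomial_function p"
  shows "comb (\<lambda>x. of_real (p x)) = 0"
proof -
  obtain a n where p: "p = (\<lambda>x. \<Sum>i\<le>n. a i * x ^ i)"
    using assms real_polynomial_function_iff_sum by blast
  have "comb (\<lambda>x. \<Sum>i\<in>S. of_real (a i) * of_real x ^ i) = 0" if "finite S" for S
    using that
  proof (induction S)
    case empty then show ?case by (simp add: comb_def)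
  next
    case (insert j S)
    have "comb (\<lambda>x. of_real (a j) * of_real x ^ j + (\<Sum>i\<in>S. of_real (a i) * of_real x ^ i))
       = comb (\<lambda>x. of_real (a j) * of_real x ^ j) + comb (\<lambda>x. \<Sum>i\<in>S. of_real (a i) * of_real x ^ i)"
      by (intro comb_add Bochner_Integration.integrable_sum integrable_mult_right integrable_power)
    then show ?case
      using insert comb_resolvent_power[of j] by (simp add: comb_cmult)
  qed
  from this[of "{..n}"] show ?thesis by (simp add: p)
qed

text \<open>All the measures live on [-R, R], where polynomials approximate \<open>g\<close>
  uniformly; off this interval the approximants may be arbitrary.\<close>

lemma comb_continuous:
  assumes g: "continuous_on UNIV (g :: real \<Rightarrow> real)"
  shows "comb (\<lambda>x. of_real (g x)) = 0"
proof -
  have gR: "continuous_on {-R..R} g" using g continuous_on_subset by blast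
  have "\<exists>p. real_polynomial_function p \<and> (\<forall>x. \<bar>x\<bar> \<le> R \<longrightarrow> \<bar>g x - p x\<bar> < inverse (real (Suc k)))" for k
  proof -
    have "0 < inverse (real (Suc k))" by simp
    from Stone_Weierstrass_real_polynomial_function[OF compact_Icc gR this]
    obtain p where "real_polynomial_function p" "\<And>x. x \<in> {-R..R} \<Longrightarrow> \<bar>g x - p x\<bar> < inverse (real (Suc k))"
      by blast
    then show ?thesis by (intro exI[of _ p]) (auto simp: abs_le_iff simp del: of_nat_Suc)
  qed
  then obtain p where p: "real_polynomial_function (p k)"
    and pg: "\<bar>x\<bar> \<le> R \<Longrightarrow> \<bar>g x - p k x\<bar> < inverse (real (Suc k))" for k x
    by metis
  obtain B where "\<forall>y\<in>g ` {-R..R}. norm y \<le> B"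
    using compact_imp_bounded[OF compact_continuous_image[OF gR compact_Icc]]
    unfolding bounded_iff by blast
  then have B: "\<bar>g x\<bar> \<le> B" if "\<bar>x\<bar> \<le> R" for x
    using that by (simp add: abs_le_iff)
  have "(\<lambda>k. comb (\<lambda>x. of_real (p k x))) \<longlonglongrightarrow> comb (\<lambda>x. of_real (g x))"
  proof (rule comb_tendsto)
    show "(\<lambda>x. complex_of_real (p k x)) \<in> borel_measurable borel" for k
    proof -
      have "continuous_on UNIV (p k)"
        by (intro continuous_at_imp_continuous_on ballI continuous_real_polymonial_function p)
      then show ?thesis by (intro borel_measurable_continuous_onI continuous_on_of_real)
    qed
    show "(\<lambda>x. complex_of_real (g x)) \<in> borel_measurable borel"
      by (intro borel_measurable_continuous_onI continuous_intros g)
    fix x assume x: "\<bar>x\<bar> \<le> R"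
    show "norm (complex_of_real (p k x)) \<le> B + 1" for k
    proof -
      have "inverse (real (Suc k)) \<le> 1" by (simp add: inverse_le_1_iff)
      then show ?thesis unfolding norm_of_real using pg[OF x, of k] B[OF x] by linarith
    qed
    have "(\<lambda>k. p k x) \<longlonglongrightarrow> g x"
    proof (rule LIMSEQ_I)
      fix r :: real assume "0 < r"
      then obtain N where "inverse (real (Suc N)) < r" by (rule reals_Archimedean[THEN exE])
      moreover have "norm (p n x - g x) < inverse (real (Suc N))" if "n \<ge> N" for n
      proof -
        have "inverse (real (Suc n)) \<le> inverse (real (Suc N))"
          using that by (intro le_imp_inverse_le) auto
        then show ?thesis unfolding real_norm_def using pg[OF x, of n] by linarith
      qed
      ultimately show "\<exists>no. \<forall>n\<ge>no. norm (p n x - g x) < r"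
        by (intro exI[of _ N] allI impI) (rule order.strict_trans)
    qed
    then show "(\<lambda>k. complex_of_real (p k x)) \<longlonglongrightarrow> of_real (g x)" by (rule tendsto_of_real)
  qed
  then have "(\<lambda>k. 0) \<longlonglongrightarrow> comb (\<lambda>x. of_real (g x))"
    by (simp only: comb_polynomial[OF p])
  then show ?thesis by (simp only: LIMSEQ_const_iff)
qed

lemma measure_relation_atMost: "(\<Sum>i\<in>I. c i * measure (\<mu> i) {..a}) = 0"
proof -
  \<comment> \<open>For k > 0 these ramps are 1 up to \<open>a\<close>, fall linearly to 0 on
    [a, a + 1/k], and so tend pointwise to the indicator of the half line.\<close>
  define g where "g k x = max 0 (min 1 (1 - real k * (x - a)))" for k :: nat and x
  have "(\<lambda>k. comb (\<lambda>x. of_real (g k x))) \<longlonglongrightarrow> comb (\<lambda>x. of_real (indicator {..a} x))"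
  proof (rule comb_tendsto)
    show "(\<lambda>x. complex_of_real (g k x)) \<in> borel_measurable borel" for k
      unfolding g_def by measurable
    show "norm (complex_of_real (g k x)) \<le> 1" for k x by (simp add: g_def)
    fix x
    have "(\<lambda>k. g k x) \<longlonglongrightarrow> indicator {..a} x"
    proof (cases "x \<le> a")
      case True
      then have "real k * (x - a) \<le> 0" for k by (simp add: mult_nonneg_nonpos)
      then have "g k x = 1" for k by (simp add: g_def)
      then show ?thesis using True by simp
    next
      case False
      then have "0 < x - a" by simp
      then obtain N where N: "1 < real N * (x - a)" using ex_less_of_nat_mult by blast
      have "eventually (\<lambda>k. g k x = 0) sequentially"
      proof (rule eventually_sequentiallyI)
        fix k assume "N \<le> k"
        then have "real N * (x - a) \<le> real k * (x - a)" using False by (intro mult_right_mono) auto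
        then show "g k x = 0" using N by (simp add: g_def)
      qed
      then show ?thesis using False by (simp add: tendsto_eventually)
    qed
    then show "(\<lambda>k. complex_of_real (g k x)) \<longlonglongrightarrow> of_real (indicator {..a} x)" by (rule tendsto_of_real)
  qed auto
  moreover have "comb (\<lambda>x. of_real (g k x)) = 0" for k
    unfolding g_def by (intro comb_continuous continuous_intros)
  ultimately have "comb (\<lambda>x. of_real (indicator {..a} x)) = 0"
    by (simp add: LIMSEQ_const_iff)
  moreover have "(\<integral>x. complex_of_real (indicator {..a} x) \<partial>\<mu> i) = measure (\<mu> i) {..a}" if "i \<in> I" for i
    by (simp add: sets_eq_imp_space_eq[OF sets_eq[OF that]])
  ultimately show ?thesis by (simp add: comb_def)
qed

text \<open>Half lines form a generator stable under intersection, so Dynkin's argument applies.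
  Complements use that the combination of the total masses vanishes, which is the zeroth
  moment.\<close>

lemma measure_relation:
  assumes X: "X \<in> sets borel"
  shows "(\<Sum>i\<in>I. c i * measure (\<mu> i) X) = 0"
proof -
  have borel: "sets borel = sigma_sets UNIV (range (\<lambda>a::real. {..a}))"
    by (subst borel_eq_atMost) simp
  have total: "(\<Sum>i\<in>I. c i * measure (\<mu> i) UNIV) = 0"
  proof -
    have "comb (\<lambda>x. 1) = 0" using comb_resolvent_power[of 0] by simp
    then show ?thesis by (simp add: comb_def sets_eq_imp_space_eq[OF sets_eq] scaleR_conv_of_real)
  qed
  have "Int_stable (range (\<lambda>a::real. {..a}))"
    by (auto simp: Int_stable_def)
  moreover have "range (\<lambda>a::real. {..a}) \<subseteq> Pow UNIV" by simp
  ultimately show ?thesis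
    using X unfolding borel
  proof (induction rule: sigma_sets_induct_disjoint)
    case (basic A) then show ?case using measure_relation_atMost by auto
  next
    case empty then show ?case by simp
  next
    case (compl A)
    have "measure (\<mu> i) (UNIV - A) = measure (\<mu> i) UNIV - measure (\<mu> i) A" if i: "i \<in> I" for i
    proof -
      interpret finite_measure "\<mu> i" by (rule finite_measure[OF i])
      have "A \<in> sets (\<mu> i)"
        using compl(1) by (simp only: sets_eq[OF i] borel)
      from finite_measure_compl[OF this] show ?thesis
        by (simp only: sets_eq_imp_space_eq[OF sets_eq[OF i]] space_borel)
    qed
    then have "(\<Sum>i\<in>I. c i * measure (\<mu> i) (UNIV - A))
        = (\<Sum>i\<in>I. c i * measure (\<mu> i) UNIV) - (\<Sum>i\<in>I. c i * measure (\<mu> i) A)"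
      by (simp add: right_diff_distrib sum_subtractf)
    then show ?case using compl total by simp
  next
    case (union A)
    have "(\<lambda>n. \<Sum>i\<in>I. c i * of_real (measure (\<mu> i) (A n))) sums (\<Sum>i\<in>I. c i * of_real (measure (\<mu> i) (\<Union>n. A n)))"
    proof (intro sums_sum sums_mult sums_of_real)
      fix i assume i: "i \<in> I"
      interpret finite_measure "\<mu> i" by (rule finite_measure[OF i])
      show "(\<lambda>n. measure (\<mu> i) (A n)) sums measure (\<mu> i) (\<Union>n. A n)"
        using union(1,2) unfolding sets_eq[OF i, unfolded borel, symmetric]
        by (intro finite_measure_UNION)
    qed
    then have "(\<lambda>n. 0) sums (\<Sum>i\<in>I. c i * of_real (measure (\<mu> i) (\<Union>n. A n)))"
      by (simp only: union(3))
    then show ?case using sums_unique2 sums_zero by blast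
  qed
qed

end

section \<open>Matrix algebra\<close>

lemma mscale_nth [simp]: "mscale c W $ i $ j = c * W $ i $ j"
  by (simp add: mscale_def)

lemma cplx_nth [simp]: "cplx W $ i $ j = complex_of_real (W $ i $ j)"
  by simp

lemma ctranspose_nth [simp]: "ctranspose W $ i $ j = cnj (W $ j $ i)"
  by (simp add: ctranspose_def transpose_def)

lemma ctranspose_ctranspose [simp]: "ctranspose (ctranspose W) = W"
  by (simp add: vec_eq_iff)

lemma ctranspose_add: "ctranspose (V + W) = ctranspose V + ctranspose W"
  by (simp add: vec_eq_iff)

lemma ctranspose_diff: "ctranspose (V - W) = ctranspose V - ctranspose W"
  by (simp add: vec_eq_iff)

lemma ctranspose_mscale: "ctranspose (mscale c W) = mscale (cnj c) (ctranspose W)"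
  by (simp add: vec_eq_iff)

lemma ctranspose_mult: "ctranspose (V ** W) = ctranspose W ** ctranspose V"
  by (simp add: vec_eq_iff matrix_matrix_mult_def mult.commute)

lemma ctranspose_mat: "ctranspose (mat c) = mat (cnj c)"
  by (simp add: vec_eq_iff mat_def)

lemma mscale_mat: "mscale c (mat a) = mat (c * a)"
  by (simp add: vec_eq_iff mat_def)

lemma mscale_mult_left: "mscale c V ** W = mscale c (V ** W)"
  by (simp add: vec_eq_iff matrix_matrix_mult_def sum_distrib_left mult_ac)

lemma mscale_mult_right: "V ** mscale c W = mscale c (V ** W)"
  by (simp add: vec_eq_iff matrix_matrix_mult_def sum_distrib_left mult_ac)

lemma mscale_mscale: "mscale a (mscale b W) = mscale (a * b) W"
  by (simp add: vec_eq_iff)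

lemma mscale_1 [simp]: "mscale 1 W = W"
  by (simp add: vec_eq_iff)

lemma mscale_0 [simp]: "mscale 0 W = 0" "mscale c 0 = 0"
  by (simp_all add: vec_eq_iff)

lemma mscale_minus_1: "mscale (- 1) W = - W"
  by (simp add: vec_eq_iff)

lemma mscale_vector: "mscale c W *v v = c *s (W *v v)"
  by (simp add: vec_eq_iff matrix_vector_mult_def sum_distrib_left mult_ac)

lemma cplx_mult: "cplx (V ** W) = cplx V ** cplx W"
  by (simp add: vec_eq_iff matrix_matrix_mult_def)

lemma cplx_mat: "cplx (mat a) = mat (of_real a)"
  by (simp add: vec_eq_iff mat_def)

lemma cplx_add: "cplx (V + W) = cplx V + cplx W"
  and cplx_uminus: "cplx (- V) = - cplx V"
  and cplx_0: "cplx 0 = 0"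
  by (simp_all add: vec_eq_iff)

lemma ctranspose_cplx: "ctranspose (cplx W) = cplx (transpose W)"
  by (simp add: vec_eq_iff transpose_def)

section \<open>The Hermitian form of a matrix\<close>

definition cinner :: "complex ^ 'k \<Rightarrow> complex ^ 'k::finite \<Rightarrow> complex" where
  "cinner u v = (\<Sum>i\<in>UNIV. cnj (u $ i) * v $ i)"

lemma qform_cinner: "qform W v = cinner v (W *v v)"
  by (simp add: qform_def cinner_def matrix_vector_mult_def sum_distrib_left mult_ac)

lemma cinner_adjoint: "cinner (W *v u) v = cinner u (ctranspose W *v v)"
proof -
  have "cinner (W *v u) v = (\<Sum>i\<in>UNIV. \<Sum>j\<in>UNIV. cnj (u $ j) * (cnj (W $ i $ j) * v $ i))"
    by (simp add: cinner_def matrix_vector_mult_def sum_distrib_left sum_distrib_right mult_ac)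
  also have "\<dots> = (\<Sum>j\<in>UNIV. \<Sum>i\<in>UNIV. cnj (u $ j) * (cnj (W $ i $ j) * v $ i))"
    by (rule sum.swap)
  finally show ?thesis
    by (simp add: cinner_def matrix_vector_mult_def sum_distrib_left)
qed

lemma cnj_cinner: "cnj (cinner u v) = cinner v u"
  by (simp add: cinner_def mult.commute)

lemma cinner_self: "cinner v v = of_real ((norm v)\<^sup>2)"
proof -
  have "cinner v v = of_real (\<Sum>i\<in>UNIV. (norm (v $ i))\<^sup>2)"
    by (simp add: cinner_def complex_norm_square mult.commute flip: of_real_power)
  then show ?thesis by (simp add: norm_vec_def L2_set_def sum_nonneg)
qed

lemma cinner_bound: "norm (cinner u v) \<le> norm u * norm v"
proof -
  have "norm (cinner u v) \<le> (\<Sum>i\<in>UNIV. \<bar>norm (u $ i)\<bar> * \<bar>norm (v $ i)\<bar>)"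
    unfolding cinner_def by (rule sum_norm_le) (simp add: norm_mult)
  also have "\<dots> \<le> norm u * norm v"
    unfolding norm_vec_def by (rule L2_set_mult_ineq)
  finally show ?thesis .
qed

lemma qform_mscale: "qform (mscale c W) v = c * qform W v"
  by (simp add: qform_def sum_distrib_left mult_ac)

lemma qform_diff: "qform (V - W) v = qform V v - qform W v"
  by (simp add: qform_def algebra_simps sum_subtractf)

lemma qform_uminus: "qform (- W) v = - qform W v"
  by (simp add: qform_def sum_negf)

lemma qform_ctranspose: "qform (ctranspose W) v = cnj (qform W v)"
  by (metis cinner_adjoint cnj_cinner qform_cinner)

lemma hermitian_iff: "ctranspose W = W \<longleftrightarrow> (\<forall>v. qform W v \<in> \<real>)"
proof
  assume "ctranspose W = W"
  then show "\<forall>v. qform W v \<in> \<real>" using qform_ctranspose[of W] by (simp add: Reals_cnj_iff)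
next
  assume "\<forall>v. qform W v \<in> \<real>"
  then show "ctranspose W = W"
    by (intro qform_polarization) (simp add: qform_ctranspose Reals_cnj_iff)
qed

lemma psd_qform: "psd W \<longleftrightarrow> (\<forall>v. qform W v \<in> \<real> \<and> 0 \<le> Re (qform W v))"
  by (auto simp: psd_def hermitian_iff)

lemma matrix_Im_hermitian: "ctranspose (matrix_Im W) = matrix_Im W"
  by (simp add: matrix_Im_def vec_eq_iff) (simp add: algebra_simps minus_divide_left)

text \<open>Turns admissibility into sign conditions on scalar functions, the form in which it is
  used throughout.\<close>

lemma qform_matrix_Im: "qform (matrix_Im W) v = of_real (Im (qform W v))"
  by (simp add: matrix_Im_def qform_mscale qform_diff qform_ctranspose complex_diff_cnj)
    (simp add: complex_eq_iff)

lemma psd_matrix_Im: "psd (matrix_Im W) \<longleftrightarrow> (\<forall>v. 0 \<le> Im (qform W v))"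
  by (simp add: psd_def matrix_Im_hermitian qform_matrix_Im)

lemma pd_matrix_Im: "pd (matrix_Im W) \<longleftrightarrow> (\<forall>v. v \<noteq> 0 \<longrightarrow> 0 < Im (qform W v))"
  by (simp add: pd_def matrix_Im_hermitian qform_matrix_Im)

lemma qform_bound: "norm (qform W v) \<le> (\<Sum>i\<in>UNIV. \<Sum>j\<in>UNIV. norm (W $ i $ j)) * (norm v)\<^sup>2"
proof -
  have "norm (qform W v) \<le> (\<Sum>i\<in>UNIV. \<Sum>j\<in>UNIV. norm (W $ i $ j) * (norm v)\<^sup>2)"
    unfolding qform_def
  proof (intro sum_norm_le)
    fix i j
    have "norm (cnj (v $ i) * W $ i $ j * v $ j) = norm (W $ i $ j) * (norm (v $ i) * norm (v $ j))"
      by (simp add: norm_mult)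
    also have "\<dots> \<le> norm (W $ i $ j) * (norm v * norm v)"
      by (intro mult_left_mono mult_mono Finite_Cartesian_Product.norm_nth_le norm_ge_zero)
    finally show "norm (cnj (v $ i) * W $ i $ j * v $ j) \<le> norm (W $ i $ j) * (norm v)\<^sup>2"
      by (simp add: power2_eq_square)
  qed
  then show ?thesis by (simp add: sum_distrib_right)
qed

lemma qform_mat: "qform (mat c) v = c * of_real ((norm v)\<^sup>2)"
proof -
  have "qform (mat 1) v = of_real ((norm v)\<^sup>2)"
    by (simp add: qform_cinner cinner_self)
  then have "qform (mscale c (mat 1)) v = c * of_real ((norm v)\<^sup>2)"
    by (simp add: qform_mscale)
  then show ?thesis by (simp add: mscale_mat)
qed

text \<open>The sum of the entry norms bounds the form. Positivity of a map speaks of psd matrices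
  only; this shift brings all Hermitian ones within its reach.\<close>

lemma hermitian_plus_scalar_psd:
  assumes "ctranspose H = H"
  shows "\<exists>c::real. psd (H + mat (of_real c))"
proof -
  define c where "c = (\<Sum>i\<in>UNIV. \<Sum>j\<in>UNIV. norm (H $ i $ j))"
  have "psd (H + mat (of_real c))"
    unfolding psd_def
  proof (intro conjI allI)
    show "ctranspose (H + mat (complex_of_real c)) = H + mat (complex_of_real c)"
      by (simp add: ctranspose_add assms ctranspose_mat)
    fix v
    have "\<bar>Re (qform H v)\<bar> \<le> c * (norm v)\<^sup>2"
      using abs_Re_le_cmod[of "qform H v"] qform_bound[of H v] unfolding c_def by linarith
    then show "0 \<le> Re (qform (H + mat (complex_of_real c)) v)"
      by (simp add: qform_add qform_mat flip: of_real_power)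
  qed
  then show ?thesis by blast
qed

section \<open>Linear maps and inverses\<close>

lemma bounded_bilinear_matrix_mult:
  "bounded_bilinear ((**) :: complex ^ 'm ^ 'n \<Rightarrow> complex ^ 'p ^ 'm \<Rightarrow> complex ^ 'p ^ 'n)"
  unfolding bilinear_conv_bounded_bilinear[symmetric] bilinear_def linear_iff
  by (simp add: vec_eq_iff matrix_matrix_mult_def sum.distrib scaleR_sum_right algebra_simps)

lemma bounded_bilinear_mscale:
  "bounded_bilinear (mscale :: complex \<Rightarrow> complex ^ 'm ^ 'n \<Rightarrow> complex ^ 'm ^ 'n)"
  unfolding bilinear_conv_bounded_bilinear[symmetric] bilinear_def linear_iff
  by (simp add: vec_eq_iff algebra_simps)

lemmas tendsto_matrix_mult = bounded_bilinear.tendsto[OF bounded_bilinear_matrix_mult]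
lemmas tendsto_mscale = bounded_bilinear.tendsto[OF bounded_bilinear_mscale]

lemma norm_mscale: "norm (mscale c W) = norm c * norm W"
proof -
  have "norm (mscale c W $ i) = norm c * norm (W $ i)" for i
    by (simp add: norm_vec_def norm_mult L2_set_right_distrib)
  then show ?thesis by (simp add: norm_vec_def[of W] norm_vec_def[of "mscale c W"] L2_set_right_distrib)
qed

lemma mscale_linear_iff:
  "Vector_Spaces.linear mscale mscale f \<longleftrightarrow>
    (\<forall>V W. f (V + W) = f V + f W) \<and> (\<forall>c W. f (mscale c W) = mscale c (f W))"
  by (simp add: Vector_Spaces.linear_iff vector_space_mscale)

lemma mscale_linear_imp_bounded_linear:
  fixes f :: "complex ^ 'm ^ 'n \<Rightarrow> complex ^ 'p ^ 'q"
  assumes "Vector_Spaces.linear mscale mscale f"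
  shows "bounded_linear f"
proof -
  have s: "c *\<^sub>R W = mscale (of_real c) W" for c and W :: "complex ^ 'x ^ 'y"
    by (simp add: vec_eq_iff) (simp add: scaleR_conv_of_real)
  have "linear f"
    using assms unfolding mscale_linear_iff by (intro linearI) (simp_all add: s)
  then show ?thesis by (simp add: linear_conv_bounded_linear)
qed

lemma mscale_linear_sum:
  assumes "Vector_Spaces.linear mscale mscale f"
  shows "f (\<Sum>i\<in>I. g i) = (\<Sum>i\<in>I. f (g i))"
  using linear_sum[OF bounded_linear.linear[OF mscale_linear_imp_bounded_linear[OF assms]]] .

text \<open>Values of \<open>f\<close> as fixed matrices weighted by the entries of
  \<open>W\<close>, which makes it evident that \<open>f\<close> preserves entrywise
  holomorphy.\<close>

lemma mscale_linear_expand: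
  fixes f :: "complex ^ 'm ^ 'n \<Rightarrow> complex ^ 'p ^ 'q"
  assumes "Vector_Spaces.linear mscale mscale f"
  shows "f W = (\<Sum>i\<in>UNIV. \<Sum>j\<in>UNIV. mscale (W $ i $ j) (f (\<chi> k l. if k = i \<and> l = j then 1 else 0)))"
proof -
  have "W = (\<Sum>i\<in>UNIV. \<Sum>j\<in>UNIV. mscale (W $ i $ j) (\<chi> k l. if k = i \<and> l = j then 1 else 0))"
  proof -
    have "(\<Sum>i\<in>UNIV. \<Sum>j\<in>UNIV. W $ i $ j * (if k = i \<and> l = j then 1 else 0)) = W $ k $ l" for k l
    proof -
      have "(\<Sum>i\<in>UNIV. \<Sum>j\<in>UNIV. W $ i $ j * (if k = i \<and> l = j then 1 else 0))
        = (\<Sum>i\<in>UNIV. \<Sum>j\<in>UNIV. if l = j then (if k = i then W $ i $ j else 0) else 0)"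
        by (intro sum.cong) auto
      then show ?thesis by simp
    qed
    then show ?thesis by (simp add: vec_eq_iff)
  qed
  then have "f W = f (\<Sum>i\<in>UNIV. \<Sum>j\<in>UNIV. mscale (W $ i $ j) (\<chi> k l. if k = i \<and> l = j then 1 else 0))"
    by simp
  also have "\<dots> = (\<Sum>i\<in>UNIV. \<Sum>j\<in>UNIV. mscale (W $ i $ j) (f (\<chi> k l. if k = i \<and> l = j then 1 else 0)))"
    using assms unfolding mscale_linear_sum[OF assms] by (simp add: mscale_linear_iff)
  finally show ?thesis .
qed

lemma holomorphic_on_mscale_linear:
  fixes f :: "complex ^ 'm ^ 'n \<Rightarrow> complex ^ 'p ^ 'q"
  assumes "Vector_Spaces.linear mscale mscale f" "\<And>i j. (\<lambda>z. W z $ i $ j) holomorphic_on U"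
  shows "(\<lambda>z. f (W z) $ i $ j) holomorphic_on U"
  by (subst mscale_linear_expand[OF assms(1)]) (auto intro!: holomorphic_intros assms(2))

section \<open>Inverses: holomorphy and perturbation\<close>

lemma matrix_inv:
  fixes A :: "'a::field ^ 'k ^ 'k"
  assumes "invertible A"
  shows "A ** matrix_inv A = mat 1" "matrix_inv A ** A = mat 1"
  using assms someI_ex[of "\<lambda>A'. A ** A' = mat 1 \<and> A' ** A = mat 1"]
  unfolding invertible_def matrix_inv_def by blast+

lemma matrix_inv_eq:
  fixes A :: "'a::field ^ 'k ^ 'k"
  assumes "A ** B = mat 1"
  shows "matrix_inv A = B" "invertible A"
proof -
  show i: "invertible A" using assms by (auto simp: invertible_right_inverse)
  show "matrix_inv A = B"
    using matrix_inv(2)[OF i] assms by (metis matrix_mul_assoc matrix_mul_lid matrix_mul_rid)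
qed

lemma invertible_kernel:
  fixes A :: "'a::field ^ 'k ^ 'k"
  assumes "\<And>v. A *v v = 0 \<Longrightarrow> v = 0"
  shows "invertible A"
  using assms by (simp add: invertible_left_inverse matrix_left_invertible_ker)

text \<open>By Cramer's rule the entries of the inverse are quotients of determinants, hence of
  polynomials in the entries.\<close>

lemma holomorphic_on_matrix_inv:
  fixes A :: "complex \<Rightarrow> complex ^ 'k ^ 'k"
  assumes "\<And>i j. (\<lambda>z. A z $ i $ j) holomorphic_on U" "\<And>z. z \<in> U \<Longrightarrow> invertible (A z)"
  shows "(\<lambda>z. matrix_inv (A z) $ i $ j) holomorphic_on U"
proof -
  have det: "(\<lambda>z. det (B z)) holomorphic_on U" if "\<And>i j. (\<lambda>z. B z $ i $ j) holomorphic_on U"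
    for B :: "complex \<Rightarrow> complex ^ 'k ^ 'k"
    unfolding det_def by (intro holomorphic_intros that)
  have eq: "matrix_inv (A z) $ i $ j = det (\<chi> k l. if l = i then axis j 1 $ k else A z $ k $ l) / det (A z)"
    if "z \<in> U" for z
  proof -
    have d: "det (A z) \<noteq> 0" using assms(2)[OF that] by (simp add: invertible_det_nz)
    have "A z *v (matrix_inv (A z) *v axis j 1) = axis j 1"
      by (simp add: matrix_vector_mul_assoc matrix_inv(1)[OF assms(2)[OF that]])
    then have "matrix_inv (A z) *v axis j 1 = (\<chi> i. det (\<chi> k l. if l = i then axis j 1 $ k else A z $ k $ l) / det (A z))"
      unfolding cramer[OF d] .
    moreover have "(matrix_inv (A z) *v axis j 1) $ i = matrix_inv (A z) $ i $ j"
      by (simp add: matrix_vector_mult_def axis_def if_distrib cong: if_cong)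
    ultimately show ?thesis by simp
  qed
  have "(\<lambda>z. det (\<chi> k l. if l = i then axis j 1 $ k else A z $ k $ l) / det (A z)) holomorphic_on U"
  proof (intro holomorphic_on_divide det assms(1))
    show "(\<lambda>z. (\<chi> k l. if l = i then axis j 1 $ k else A z $ k $ l) $ k $ l) holomorphic_on U" for k l
      by (cases "l = i") (auto intro!: assms(1))
    show "det (A z) \<noteq> 0" if "z \<in> U" for z
      using assms(2)[OF that] by (simp add: invertible_det_nz)
  qed
  then show ?thesis
    by (rule holomorphic_transform) (simp add: eq)
qed

text \<open>Every \<open>X\<close> is \<open>D' ** (T ** X)\<close> minus
  \<open>D' ** ((T - D) ** X)\<close>, and for \<open>T\<close> near \<open>D\<close> the second
  term is at most half of \<open>X\<close> in norm. The first term therefore controls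
  \<open>X\<close> up to a factor 2. Applied to kernel vectors this gives invertibility, applied to
  the inverse its bound. The factor 2 later fixes the radius of the ball of the contraction.\<close>

lemma inverse_perturbation:
  fixes D D' :: "complex ^ 'k ^ 'k"
  assumes "D ** D' = mat 1"
  shows "\<exists>\<delta>>0. \<exists>C. \<forall>T. norm (T - D) < \<delta> \<longrightarrow> invertible T \<and> norm (matrix_inv T) \<le> 2 * norm D'
    \<and> norm (matrix_inv T - D') \<le> C * norm (T - D)"
proof -
  obtain K where K: "0 < K" "\<And>(A :: complex ^ 'k ^ 'k) (B :: complex ^ 'k ^ 'k). norm (A ** B) \<le> norm A * norm B * K"
    using bounded_bilinear.pos_bounded[OF bounded_bilinear_matrix_mult] by blast
  \<comment> \<open>Makes \<open>K * K * norm D' * \<delta>\<close> at most 1/2; \<open>K\<close> is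
    the constant in the norm of a product and occurs twice because two products are
    estimated.\<close>
  define \<delta> where "\<delta> = 1 / (2 * (K * K * (norm D' + 1)))"
  have pos: "0 < K * K * (norm D' + 1)" using K by (simp add: add_nonneg_pos)
  have D'D: "D' ** D = mat 1" using assms matrix_left_right_inverse by blast
  have three: "norm (D' ** (E ** X)) \<le> K * K * norm D' * norm E * norm X" for E X :: "complex ^ 'k ^ 'k"
  proof -
    have "norm (D' ** (E ** X)) \<le> norm D' * norm (E ** X) * K" by (rule K)
    also have "\<dots> \<le> norm D' * (norm E * norm X * K) * K"
      using K by (intro mult_left_mono mult_right_mono) auto
    finally show ?thesis by (simp add: mult_ac)
  qed
  have id: "X = D' ** (T ** X) - D' ** ((T - D) ** X)" for T X :: "complex ^ 'k ^ 'k"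
  proof -
    have "D' ** (T ** X) - D' ** ((T - D) ** X) = (D' ** D) ** X"
      by (simp add: matrix_mul_assoc bounded_bilinear.diff_left[OF bounded_bilinear_matrix_mult]
          bounded_bilinear.diff_right[OF bounded_bilinear_matrix_mult])
    then show ?thesis by (simp add: D'D)
  qed
  have est: "norm X \<le> 2 * norm (D' ** (T ** X))" if T: "norm (T - D) < \<delta>" for T X :: "complex ^ 'k ^ 'k"
  proof -
    have "K * K * norm D' * norm (T - D) \<le> K * K * (norm D' + 1) * \<delta>"
      using T K by (intro mult_mono) auto
    also have "\<dots> = 1 / 2"
    proof -
      have "P * (1 / (2 * P)) = 1 / 2" if "0 < P" for P :: real using that by simp
      from this[OF pos] show ?thesis by (simp only: \<delta>_def)
    qed
    finally have "K * K * norm D' * norm (T - D) * norm X \<le> 1 / 2 * norm X"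
      by (rule mult_right_mono) simp
    then have "norm (D' ** ((T - D) ** X)) \<le> 1 / 2 * norm X"
      using three order_trans by blast
    moreover have "norm X \<le> norm (D' ** (T ** X)) + norm (D' ** ((T - D) ** X))"
      by (subst id[of X T]) (rule norm_triangle_ineq4)
    ultimately show ?thesis by simp
  qed
  have "invertible T \<and> norm (matrix_inv T) \<le> 2 * norm D'
    \<and> norm (matrix_inv T - D') \<le> (K * K * norm D' * (2 * norm D')) * norm (T - D)" if T: "norm (T - D) < \<delta>" for T
  proof (intro conjI)
    show inv: "invertible T"
    proof (rule invertible_kernel)
      fix v assume v: "T *v v = 0"
      \<comment> \<open>The vector is repeated in every column so that the matrix estimate
        \<open>est\<close> applies to it.\<close>
      define X :: "complex ^ 'k ^ 'k" where "X = (\<chi> i j. v $ i)"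
      have "(T ** X) $ i $ j = (T *v v) $ i" for i j
        by (simp add: matrix_matrix_mult_def matrix_vector_mult_def X_def)
      then have "T ** X = 0" using v by (simp add: vec_eq_iff)
      then have "X = 0" using est[OF T, of X] by simp
      then show "v = 0" by (simp add: X_def vec_eq_iff)
    qed
    show n: "norm (matrix_inv T) \<le> 2 * norm D'"
      using est[OF T, of "matrix_inv T"] matrix_inv(1)[OF inv] by simp
    have "matrix_inv T - D' = - (D' ** ((T - D) ** matrix_inv T))"
      using id[of "matrix_inv T" T] matrix_inv(1)[OF inv] by (simp add: algebra_simps)
    then have "norm (matrix_inv T - D') \<le> K * K * norm D' * norm (T - D) * norm (matrix_inv T)"
      using three by simp
    also have "\<dots> \<le> K * K * norm D' * norm (T - D) * (2 * norm D')"
      using n K by (intro mult_left_mono) auto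
    finally show "norm (matrix_inv T - D') \<le> (K * K * norm D' * (2 * norm D')) * norm (T - D)"
      by (simp add: mult_ac)
  qed
  moreover have "0 < \<delta>" using pos by (simp add: \<delta>_def)
  ultimately show ?thesis by blast
qed

lemma tendsto_matrix_inv:
  fixes T :: "'b \<Rightarrow> complex ^ 'k ^ 'k"
  assumes T: "(T \<longlongrightarrow> D) F" and D: "invertible D"
  shows "((\<lambda>x. matrix_inv (T x)) \<longlongrightarrow> matrix_inv D) F" "eventually (\<lambda>x. invertible (T x)) F"
proof -
  obtain \<delta> C where \<delta>: "0 < \<delta>" and *: "\<And>T. norm (T - D) < \<delta> \<Longrightarrow> invertible T \<and> norm (matrix_inv T - matrix_inv D) \<le> C * norm (T - D)"
    using inverse_perturbation[OF matrix_inv(1)[OF D]] by blast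
  have ev: "eventually (\<lambda>x. norm (T x - D) < \<delta>) F"
    using tendstoD[OF T \<delta>] by (simp add: dist_norm)
  then show "eventually (\<lambda>x. invertible (T x)) F" by eventually_elim (use * in blast)
  have "((\<lambda>x. matrix_inv (T x) - matrix_inv D) \<longlongrightarrow> 0) F"
  proof (rule Lim_null_comparison)
    show "eventually (\<lambda>x. norm (matrix_inv (T x) - matrix_inv D) \<le> C * norm (T x - D)) F"
      using ev by eventually_elim (use * in blast)
    have "((\<lambda>x. C * norm (T x - D)) \<longlongrightarrow> C * norm (D - D)) F"
      by (intro tendsto_intros T)
    then show "((\<lambda>x. C * norm (T x - D)) \<longlongrightarrow> 0) F" by simp
  qed
  then show "((\<lambda>x. matrix_inv (T x)) \<longlongrightarrow> matrix_inv D) F" by (simp add: LIM_zero_iff)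
qed

section \<open>Block matrices\<close>

definition block12 :: "'a ^ ('n::finite + 'd::finite) ^ ('n + 'd) \<Rightarrow> 'a ^ 'd ^ 'n" where
  "block12 W = (\<chi> i j. W $ Inl i $ Inr j)"

definition block21 :: "'a ^ ('n::finite + 'd::finite) ^ ('n + 'd) \<Rightarrow> 'a ^ 'n ^ 'd" where
  "block21 W = (\<chi> i j. W $ Inr i $ Inl j)"

definition block22 :: "'a ^ ('n::finite + 'd::finite) ^ ('n + 'd) \<Rightarrow> 'a ^ 'd ^ 'd" where
  "block22 W = (\<chi> i j. W $ Inr i $ Inr j)"

lemmas block_defs = block11_def block12_def block21_def block22_def

lemma block_nth [simp]:
  "block a b c d $ Inl i $ Inl j = a $ i $ j" "block a b c d $ Inl i $ Inr l = b $ i $ l"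
  "block a b c d $ Inr k $ Inl j = c $ k $ j" "block a b c d $ Inr k $ Inr l = d $ k $ l"
  by (simp_all add: block_def)

lemma sum_UNIV_Plus:
  fixes g :: "'n::finite + 'd::finite \<Rightarrow> 'a::comm_monoid_add"
  shows "(\<Sum>i\<in>UNIV. g i) = (\<Sum>i\<in>UNIV. g (Inl i)) + (\<Sum>i\<in>UNIV. g (Inr i))"
  by (subst UNIV_Plus_UNIV[symmetric], subst sum.Plus) (simp_all add: o_def)

lemma all_Plus: "(\<forall>i::'a + 'b. Q i) \<longleftrightarrow> (\<forall>i. Q (Inl i)) \<and> (\<forall>i. Q (Inr i))"
  by (metis old.sum.exhaust)

lemma block_eq_iff:
  fixes V :: "'a ^ ('n::finite + 'd::finite) ^ ('n + 'd)"
  shows "V = W \<longleftrightarrow> block11 V = block11 W \<and> block12 V = block12 W \<and> block21 V = block21 W \<and> block22 V = block22 W"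
  by (auto simp: vec_eq_iff block_defs all_Plus)

lemma blocks_block [simp]:
  "block11 (block a b c d) = a" "block12 (block a b c d) = b"
  "block21 (block a b c d) = c" "block22 (block a b c d) = d"
  by (simp_all add: vec_eq_iff block_defs)

lemma block_blocks: "block (block11 W) (block12 W) (block21 W) (block22 W) = W"
  by (simp add: block_eq_iff)

lemma block_add: "block a b c d + block a' b' c' d' = block (a + a') (b + b') (c + c') (d + d')"
  by (simp add: vec_eq_iff all_Plus)

lemma block_mult: "block a b c d ** block a' b' c' d'
    = block (a ** a' + b ** c') (a ** b' + b ** d') (c ** a' + d ** c') (c ** b' + d ** d')"
  for a :: "'a::semiring_1 ^ 'n ^ 'n"
  by (simp add: vec_eq_iff all_Plus matrix_matrix_mult_def sum_UNIV_Plus)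

lemma blocks_mult:
  "block11 (V ** W) = block11 V ** block11 W + block12 V ** block21 W"
  "block12 (V ** W) = block11 V ** block12 W + block12 V ** block22 W"
  "block21 (V ** W) = block21 V ** block11 W + block22 V ** block21 W"
  "block22 (V ** W) = block21 V ** block12 W + block22 V ** block22 W"
  for V :: "'a::semiring_1 ^ ('n::finite + 'd::finite) ^ ('n + 'd)"
  by (simp_all add: vec_eq_iff block_defs matrix_matrix_mult_def sum_UNIV_Plus)

lemma blocks_add:
  "block11 (V + W) = block11 V + block11 W" "block12 (V + W) = block12 V + block12 W"
  "block21 (V + W) = block21 V + block21 W" "block22 (V + W) = block22 V + block22 W"
  by (simp_all add: vec_eq_iff block_defs)

lemma blocks_diff:
  "block11 (V - W) = block11 V - block11 W" "block12 (V - W) = block12 V - block12 W"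
  "block21 (V - W) = block21 V - block21 W" "block22 (V - W) = block22 V - block22 W"
  for V :: "'a::ab_group_add ^ ('n::finite + 'd::finite) ^ ('n + 'd)"
  by (simp_all add: vec_eq_iff block_defs)

lemma blocks_mscale:
  "block11 (mscale c W) = mscale c (block11 W)" "block12 (mscale c W) = mscale c (block12 W)"
  "block21 (mscale c W) = mscale c (block21 W)" "block22 (mscale c W) = mscale c (block22 W)"
  by (simp_all add: vec_eq_iff block_defs)

lemma mscale_block: "mscale c (block a b e d) = block (mscale c a) (mscale c b) (mscale c e) (mscale c d)"
  by (simp add: vec_eq_iff all_Plus)

lemma cplx_block: "cplx (block a b c d) = block (cplx a) (cplx b) (cplx c) (cplx d)"
  by (simp add: vec_eq_iff all_Plus)

lemma ctranspose_block: "ctranspose (block a b c d) = block (ctranspose a) (ctranspose c) (ctranspose b) (ctranspose d)"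
  by (simp add: vec_eq_iff all_Plus)

lemma mat_block: "mat a = block (mat a) 0 0 (mat a)"
  by (simp add: vec_eq_iff all_Plus mat_def)

lemma mat_blocks:
  "block11 (mat a) = mat a" "block12 (mat a) = 0" "block21 (mat a) = 0" "block22 (mat a) = mat a"
  by (simp_all add: mat_block)

lemma blocks_Lam: "block11 Lam = mat 1" "block12 Lam = 0" "block21 Lam = 0" "block22 Lam = 0"
  by (simp_all add: Lam_def)

lemma bounded_linear_blocks:
  "bounded_linear (block11 :: complex ^ ('n::finite + 'd::finite) ^ ('n + 'd) \<Rightarrow> _)"
  "bounded_linear (block12 :: complex ^ ('n + 'd) ^ ('n + 'd) \<Rightarrow> _)"
  "bounded_linear (block21 :: complex ^ ('n + 'd) ^ ('n + 'd) \<Rightarrow> _)"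
  "bounded_linear (block22 :: complex ^ ('n + 'd) ^ ('n + 'd) \<Rightarrow> _)"
  unfolding linear_conv_bounded_linear[symmetric] linear_iff
  by (simp_all add: vec_eq_iff block_defs)

lemmas tendsto_block11 = bounded_linear.tendsto[OF bounded_linear_blocks(1)]
  and tendsto_block12 = bounded_linear.tendsto[OF bounded_linear_blocks(2)]
  and tendsto_block21 = bounded_linear.tendsto[OF bounded_linear_blocks(3)]
  and tendsto_block22 = bounded_linear.tendsto[OF bounded_linear_blocks(4)]

lemma tendsto_block:
  assumes "(a \<longlongrightarrow> a') F" "(b \<longlongrightarrow> b') F" "(c \<longlongrightarrow> c') F" "(d \<longlongrightarrow> d') F"
  shows "((\<lambda>x. block (a x) (b x) (c x) (d x)) \<longlongrightarrow> block a' b' c' d') F"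
proof (intro vec_tendstoI)
  fix i j
  show "((\<lambda>x. block (a x) (b x) (c x) (d x) $ i $ j) \<longlongrightarrow> block a' b' c' d' $ i $ j) F"
    by (cases i; cases j) (auto intro!: tendsto_vec_nth assms)
qed

definition top :: "complex ^ ('n::finite + 'd::finite) \<Rightarrow> complex ^ 'n" where
  "top v = (\<chi> i. v $ Inl i)"

definition bot :: "complex ^ ('n::finite + 'd::finite) \<Rightarrow> complex ^ 'd" where
  "bot v = (\<chi> i. v $ Inr i)"

definition join :: "complex ^ 'n \<Rightarrow> complex ^ 'd \<Rightarrow> complex ^ ('n::finite + 'd::finite)" where
  "join u w = (\<chi> i. case i of Inl i \<Rightarrow> u $ i | Inr i \<Rightarrow> w $ i)"

lemma top_bot_join [simp]: "top (join u w) = u" "bot (join u w) = w"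
  by (simp_all add: vec_eq_iff top_def bot_def join_def)

lemma top_bot_eq_iff: "v = w \<longleftrightarrow> top v = top w \<and> bot v = bot w"
  by (auto simp: vec_eq_iff top_def bot_def all_Plus)

lemma top_bot_0 [simp]: "top 0 = 0" "bot 0 = 0"
  by (simp_all add: vec_eq_iff top_def bot_def)

lemma top_bot_mult:
  "top (W *v v) = block11 W *v top v + block12 W *v bot v"
  "bot (W *v v) = block21 W *v top v + block22 W *v bot v"
  by (simp_all add: vec_eq_iff top_def bot_def block_defs matrix_vector_mult_def sum_UNIV_Plus)

lemma cinner_top_bot: "cinner u v = cinner (top u) (top v) + cinner (bot u) (bot v)"
  by (simp add: cinner_def top_def bot_def sum_UNIV_Plus)

lemma cinner_0 [simp]: "cinner 0 v = 0" "cinner u 0 = 0"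
  by (simp_all add: cinner_def)

lemma qform_join_0: "qform W (join u 0) = qform (block11 W) u"
  by (simp add: qform_cinner cinner_top_bot top_bot_mult)

lemma admissible_values_iff:
  "W \<in> admissible_values \<longleftrightarrow> (\<forall>v. 0 \<le> Im (qform W v)) \<and> (\<forall>u. u \<noteq> 0 \<longrightarrow> 0 < Im (qform (block11 W) u))"
  by (simp add: admissible_values_def psd_matrix_Im pd_matrix_Im)

lemma ctranspose_0 [simp]: "ctranspose 0 = 0"
  by (simp add: vec_eq_iff)

lemma invertible_ctranspose:
  fixes A :: "complex ^ 'k ^ 'k"
  assumes "invertible A"
  shows "invertible (ctranspose A)" "matrix_inv (ctranspose A) = ctranspose (matrix_inv A)"
proof -
  have "ctranspose A ** ctranspose (matrix_inv A) = mat 1"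
    using matrix_inv(2)[OF assms] ctranspose_mult[of "matrix_inv A" A] by (simp add: ctranspose_mat)
  from matrix_inv_eq[OF this] show "invertible (ctranspose A)" "matrix_inv (ctranspose A) = ctranspose (matrix_inv A)"
    by auto
qed

lemma matrix_mult_diff_distrib:
  fixes V W :: "complex ^ 'm ^ 'n" and X Y :: "complex ^ 'p ^ 'm"
  shows "(V - W) ** X = V ** X - W ** X" "V ** (X - Y) = V ** X - V ** Y"
  by (rule bounded_bilinear.diff_left[OF bounded_bilinear_matrix_mult]
      bounded_bilinear.diff_right[OF bounded_bilinear_matrix_mult])+

lemma matrix_mult_add_distrib:
  fixes V W :: "complex ^ 'm ^ 'n" and X Y :: "complex ^ 'p ^ 'm"
  shows "(V + W) ** X = V ** X + W ** X" "V ** (X + Y) = V ** X + V ** Y"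
  by (rule bounded_bilinear.add_left[OF bounded_bilinear_matrix_mult]
      bounded_bilinear.add_right[OF bounded_bilinear_matrix_mult])+

lemma matrix_mult_minus:
  fixes V :: "complex ^ 'm ^ 'n" and X :: "complex ^ 'p ^ 'm"
  shows "(- V) ** X = - (V ** X)" "V ** (- X) = - (V ** X)"
  by (rule bounded_bilinear.minus_left[OF bounded_bilinear_matrix_mult]
      bounded_bilinear.minus_right[OF bounded_bilinear_matrix_mult])+

section \<open>The Dyson iteration\<close>

text \<open>
  \<open>H\<close> stands for \<open>E L\<close>. The last assumption is the only place where the covariance structure of
  \<open>S\<close> enters: it makes \<open>H - S W - z \<Lambda>\<close> invertible although its imaginary part may be degenerate.
\<close>

locale matrix_dyson =
  fixes H :: "('n::finite + 'd::finite) cmat" and S :: "('n + 'd) cmat \<Rightarrow> ('n + 'd) cmat"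
  assumes H_hermitian: "ctranspose H = H"
    and H22: "invertible (block22 H)"
    and S_linear: "Vector_Spaces.linear mscale mscale S"
    and S_pos: "positivity_preserving S"
    and S_rest: "block11 V = block11 W \<Longrightarrow>
      block12 (S V) = block12 (S W) \<and> block21 (S V) = block21 (S W) \<and> block22 (S V) = block22 (S W)"
    and S_kernel: "W \<in> admissible_values \<Longrightarrow> top v = 0 \<Longrightarrow> Im (qform (S W) v) = 0 \<Longrightarrow> S W *v v = 0"
begin

section \<open>The map \<open>S\<close>, adjoints and imaginary parts\<close>

lemma S_add: "S (V + W) = S V + S W"
  and S_mscale: "S (mscale c W) = mscale c (S W)"
  using S_linear by (auto simp: mscale_linear_iff)

text \<open>A shift by a multiple of the identity makes \<open>W\<close> psd, so the shifted image
  is Hermitian. The image of the identity is Hermitian too and can be subtracted by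
  linearity.\<close>

lemma S_hermitian:
  assumes "ctranspose W = W"
  shows "ctranspose (S W) = S W"
proof -
  obtain c :: real where c: "psd (W + mat (of_real c))"
    using hermitian_plus_scalar_psd[OF assms] by blast
  have "psd (mat 1 :: ('n + 'd) cmat)"
    by (auto simp: psd_qform qform_mat)
  then have 1: "ctranspose (S (mat 1)) = S (mat 1)"
    using S_pos by (simp add: positivity_preserving_def psd_def)
  have 2: "ctranspose (S (W + mat (of_real c))) = S (W + mat (of_real c))"
    using c S_pos by (simp add: positivity_preserving_def psd_def)
  have "S (W + mat (of_real c)) = S W + mscale (of_real c) (S (mat 1))"
    by (simp add: S_add flip: S_mscale) (simp add: mscale_mat)
  with 1 2 show ?thesis
    by (simp add: ctranspose_add ctranspose_mscale)
qed

lemma cartesian_decomposition: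
  obtains X Y where "W = X + mscale \<i> Y" "ctranspose X = X" "Y = matrix_Im W" "ctranspose Y = Y"
proof
  show "W = (W - mscale \<i> (matrix_Im W)) + mscale \<i> (matrix_Im W)" by simp
  show "ctranspose (W - mscale \<i> (matrix_Im W)) = W - mscale \<i> (matrix_Im W)"
    by (simp add: matrix_Im_def vec_eq_iff) (simp add: field_simps)
qed (simp_all add: matrix_Im_hermitian)

text \<open>Complex linearity plus preservation of the two Hermitian parts. It allows the iteration
  to be reflected across the real axis.\<close>

lemma S_ctranspose: "S (ctranspose W) = ctranspose (S W)"
proof -
  obtain X Y where W: "W = X + mscale \<i> Y" and h: "ctranspose X = X" "ctranspose Y = Y"
    using cartesian_decomposition by metis
  show ?thesis
    by (simp add: W ctranspose_add ctranspose_mscale h S_add S_mscale S_hermitian)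
qed

text \<open>The Hermitian part contributes a real number to the form, and positivity of
  \<open>S\<close> applies to the imaginary part.\<close>

lemma S_Im_nonneg:
  assumes "\<And>v. 0 \<le> Im (qform W v)"
  shows "0 \<le> Im (qform (S W) v)"
proof -
  obtain X Y where W: "W = X + mscale \<i> Y" and h: "ctranspose X = X" "Y = matrix_Im W"
    using cartesian_decomposition by metis
  have "psd Y" using assms by (simp add: h psd_matrix_Im)
  then have "psd (S Y)" using S_pos by (simp add: positivity_preserving_def)
  moreover have "qform (S X) v \<in> \<real>"
    using S_hermitian[OF h(1)] by (simp add: hermitian_iff)
  then have "Im (qform (S X) v) = 0" by (simp add: complex_is_Real_iff)
  ultimately show ?thesis
    by (subst W) (simp add: S_add S_mscale qform_add qform_mscale psd_def)
qed

section \<open>The pencil and its inverse on admissible matrices\<close>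

definition pencil :: "complex \<Rightarrow> ('n + 'd) cmat \<Rightarrow> ('n + 'd) cmat" where
  "pencil z W = H - S W - mscale z Lam"

lemma qform_Lam: "qform Lam v = of_real ((norm (top v))\<^sup>2)"
  by (simp add: qform_cinner cinner_top_bot top_bot_mult blocks_Lam cinner_self)

lemma Im_qform_H: "Im (qform H v) = 0"
  using H_hermitian by (simp add: hermitian_iff complex_is_Real_iff)

lemma Im_qform_pencil: "Im (qform (pencil z W) v) = - Im (qform (S W) v) - Im z * (norm (top v))\<^sup>2"
  by (simp add: pencil_def qform_diff qform_mscale qform_Lam Im_qform_H flip: of_real_power)

text \<open>The imaginary part of the form is minus a sum of two nonnegative terms, so both vanish:
  the top of \<open>w\<close> is 0, and \<open>S_kernel\<close> removes \<open>S W\<close>. What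
  remains is the invertible \<open>block22 H\<close> acting on the bottom. Only the bottom of the
  image is assumed to be 0, because strict positivity of the inverse needs it for images of the form
  \<open>join u 0\<close>.\<close>

lemma pencil_kernel:
  assumes W: "W \<in> admissible_values" and z: "0 < Im z"
    and w: "bot (pencil z W *v w) = 0" "Im (qform (pencil z W) w) = 0"
  shows "w = 0"
proof -
  have nn: "0 \<le> Im (qform (S W) w)"
    using W by (intro S_Im_nonneg) (simp add: admissible_values_iff)
  moreover have "0 \<le> Im z * (norm (top w))\<^sup>2" using z by simp
  ultimately have "Im (qform (S W) w) = 0" "Im z * (norm (top w))\<^sup>2 = 0"
    using w(2) unfolding Im_qform_pencil by linarith+
  then have top: "top w = 0" and "S W *v w = 0"
    using z S_kernel[OF W, of w] by auto
  moreover have "Lam *v w = 0"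
    using top by (simp add: top_bot_eq_iff top_bot_mult blocks_Lam)
  ultimately have "pencil z W *v w = H *v w"
    by (simp add: pencil_def matrix_vector_mult_diff_rdistrib mscale_vector)
  then have "block22 H *v bot w = 0"
    using w(1) top by (simp add: top_bot_mult)
  then have "bot w = 0"
    using H22 by (metis matrix_inv(2) matrix_vector_mul_assoc matrix_vector_mul_lid matrix_vector_mult_0_right)
  with top show ?thesis by (simp add: top_bot_eq_iff)
qed

lemma pencil_invertible:
  assumes "W \<in> admissible_values" "0 < Im z"
  shows "invertible (pencil z W)"
  by (rule invertible_kernel, rule pencil_kernel[OF assms]) (simp_all add: qform_cinner)

lemma qform_matrix_inv:
  assumes "invertible T"
  shows "qform (matrix_inv T) u = cnj (qform T (matrix_inv T *v u))"
proof -
  have "T *v (matrix_inv T *v u) = u"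
    by (simp add: matrix_vector_mul_assoc matrix_inv(1)[OF assms])
  then show ?thesis by (simp add: qform_cinner cnj_cinner)
qed

text \<open>The form of the inverse at \<open>u\<close> is the conjugate of the form of the pencil
  at the preimage of \<open>u\<close>, which reverses the sign of the imaginary part. If it vanished
  at \<open>join u 0\<close>, then \<open>pencil_kernel\<close> would make the preimage 0.\<close>

lemma matrix_inv_pencil_admissible:
  assumes W: "W \<in> admissible_values" and z: "0 < Im z"
  shows "matrix_inv (pencil z W) \<in> admissible_values"
proof -
  let ?T = "pencil z W"
  note inv = pencil_invertible[OF W z]
  have Im: "Im (qform (matrix_inv ?T) u) = - Im (qform ?T (matrix_inv ?T *v u))" for u
    by (simp add: qform_matrix_inv[OF inv])
  have nn: "0 \<le> Im (qform (matrix_inv ?T) u)" for u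
  proof -
    have "0 \<le> Im (qform (S W) v)" for v
      using W by (intro S_Im_nonneg) (simp add: admissible_values_iff)
    then show ?thesis using z by (simp add: Im Im_qform_pencil)
  qed
  moreover have "0 < Im (qform (block11 (matrix_inv ?T)) u)" if u: "u \<noteq> 0" for u
  proof (rule ccontr)
    let ?w = "matrix_inv ?T *v join u 0"
    assume "\<not> ?thesis"
    then have "Im (qform (matrix_inv ?T) (join u 0)) = 0"
      using nn[of "join u 0"] by (simp add: qform_join_0)
    then have "Im (qform ?T ?w) = 0" by (simp add: Im)
    moreover have Tw: "?T *v ?w = join u 0"
      by (simp add: matrix_vector_mul_assoc matrix_inv(1)[OF inv])
    ultimately have "?w = 0" using pencil_kernel[OF W z, of ?w] by simp
    then have "join u 0 = (0 :: complex ^ ('n + 'd))" using Tw by simp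
    then show False using u by (metis top_bot_0(1) top_bot_join(1))
  qed
  ultimately show ?thesis by (simp add: admissible_values_iff)
qed

definition Qi :: "'d cmat" where "Qi = matrix_inv (block22 H)"

lemma Qi: "block22 H ** Qi = mat 1" "Qi ** block22 H = mat 1"
  using matrix_inv[OF H22] by (simp_all add: Qi_def)

lemma block22_H_hermitian: "ctranspose (block22 H) = block22 H"
  using H_hermitian by (simp add: vec_eq_iff block_defs)

lemma Qi_hermitian: "ctranspose Qi = Qi"
  using invertible_ctranspose(2)[OF H22] by (simp add: Qi_def block22_H_hermitian)

text \<open>When \<open>s * s * z = 1\<close>, the start is
  \<open>rescale s ** D0i ** rescale s\<close>: in rescaled coordinates the iteration begins at the
  same constant matrix for every \<open>z\<close>.\<close>

primrec iter :: "nat \<Rightarrow> complex \<Rightarrow> ('n + 'd) cmat" where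
  "iter 0 z = block (mat (- 1 / z)) 0 0 Qi"
| "iter (Suc k) z = matrix_inv (pencil z (iter k z))"

lemma iter_admissible: "0 < Im z \<Longrightarrow> iter k z \<in> admissible_values"
proof (induction k)
  case 0
  have "qform (iter 0 z) v = (- 1 / z) * of_real ((norm (top v))\<^sup>2) + qform Qi (bot v)" for v
    using qform_mat[of "- 1 / z" "top v"]
    by (simp add: qform_cinner cinner_top_bot top_bot_mult)
  moreover have "Im (qform Qi w) = 0" for w
    using Qi_hermitian by (simp add: hermitian_iff complex_is_Real_iff)
  moreover have Im: "0 < Im (- 1 / z)"
  proof -
    have "0 < (Re z)\<^sup>2 + (Im z)\<^sup>2" using 0 by (simp add: add_nonneg_pos)
    then show ?thesis using 0 by (simp add: Im_divide)
  qed
  moreover have "Im (a * of_real x) = Im a * x" for a x by simp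
  ultimately have eq: "Im (qform (iter 0 z) v) = Im (- 1 / z) * (norm (top v))\<^sup>2" for v
    by (simp only: plus_complex.sel add_0_right)
  then have "0 < Im (qform (block11 (iter 0 z)) u)" if "u \<noteq> 0" for u
    unfolding qform_join_0[symmetric] eq using that Im by (simp add: mult_neg_pos)
  then show ?case using eq Im by (simp only: admissible_values_iff) (auto simp: mult_le_0_iff)
next
  case (Suc k) then show ?case by (simp add: matrix_inv_pencil_admissible)
qed

lemma pencil_ctranspose: "ctranspose (pencil z W) = pencil (cnj z) (ctranspose W)"
proof -
  have "ctranspose Lam = (Lam :: ('n + 'd) cmat)"
    by (simp add: Lam_def ctranspose_block ctranspose_mat)
  then show ?thesis
    by (simp add: pencil_def ctranspose_diff ctranspose_mscale H_hermitian S_ctranspose)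
qed

section \<open>The iteration near infinity\<close>

text \<open>
  \<open>rescale s\<close> is used with \<open>s\<^sup>2 z = 1\<close>, so that \<open>rescale s\<close> cancels the factor \<open>z\<close> in front of \<open>\<Lambda>\<close>
  and the rescaled pencil depends polynomially on \<open>s\<close>, with constant term \<open>D0\<close>.
\<close>

definition rescale :: "complex \<Rightarrow> ('n + 'd) cmat" where "rescale s = block (mat s) 0 0 (mat 1)"

definition D0 :: "('n + 'd) cmat" where "D0 = block (mat (- 1)) 0 0 (block22 H)"

definition D0i :: "('n + 'd) cmat" where "D0i = block (mat (- 1)) 0 0 Qi"

text \<open>The limit of the solution at infinity and the constant term of its representation. It
  lacks the upper left block of \<open>D0i\<close>, which is of order 1/z before rescaling.\<close>

definition Dinf :: "('n + 'd) cmat" where "Dinf = block 0 0 0 Qi"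

lemma mat_mult: "mat a ** W = mscale a W" "W ** mat a = mscale a W"
  for W :: "complex ^ 'm ^ 'k"
proof -
  have "mat a = mscale a (mat 1)" for a :: complex by (simp add: mscale_mat)
  then show "mat a ** W = mscale a W" "W ** mat a = mscale a W"
    by (metis mscale_mult_left matrix_mul_lid, metis mscale_mult_right matrix_mul_rid)
qed

lemma D0_D0i: "D0 ** D0i = mat 1"
  by (simp add: D0_def D0i_def block_mult mat_mult mscale_mat Qi mat_block[of 1])

lemma blocks_rescale:
  "block11 (rescale s ** W ** rescale s) = mscale (s * s) (block11 W)"
  "block12 (rescale s ** W ** rescale s) = mscale s (block12 W)"
  "block21 (rescale s ** W ** rescale s) = mscale s (block21 W)"
  "block22 (rescale s ** W ** rescale s) = block22 W"
  by (simp_all add: rescale_def blocks_mult mat_mult mscale_mscale)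

text \<open>The blocks of \<open>S\<close> gain the factor \<open>s * s\<close> in different ways.
  The corner may depend on the whole argument and gains it from the outer multiplication; the other
  blocks see only the upper left block of the argument, where the inner rescaling supplies
  it.\<close>

definition corner :: "('n + 'd) cmat \<Rightarrow> ('n + 'd) cmat" where
  "corner W = block (block11 (S W)) 0 0 0"

definition border :: "('n + 'd) cmat \<Rightarrow> ('n + 'd) cmat" where
  "border W = S W - corner W"

lemma corner_linear: "Vector_Spaces.linear mscale mscale corner"
  unfolding mscale_linear_iff
  by (simp add: corner_def S_add S_mscale block_add blocks_add blocks_mscale mscale_block)

lemma border_linear: "Vector_Spaces.linear mscale mscale border"
  using corner_linear S_linear unfolding mscale_linear_iff
  by (simp add: border_def) (simp add: vec_eq_iff algebra_simps)

lemma blocks_border: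
  "block11 (border W) = 0" "block12 (border W) = block12 (S W)" "block21 (border W) = block21 (S W)" "block22 (border W) = block22 (S W)"
  by (simp_all add: border_def corner_def blocks_diff)

lemma blocks_S_cong:
  assumes "block11 V = mscale c (block11 W)"
  shows "block12 (S V) = mscale c (block12 (S W))" "block21 (S V) = mscale c (block21 (S W))"
    "block22 (S V) = mscale c (block22 (S W))"
proof -
  have "block11 V = block11 (mscale c W)" using assms by (simp add: blocks_mscale)
  from S_rest[OF this] show "block12 (S V) = mscale c (block12 (S W))" "block21 (S V) = mscale c (block21 (S W))"
    "block22 (S V) = mscale c (block22 (S W))"
    by (simp_all add: S_mscale blocks_mscale)
qed

text \<open>What is left of the rescaled \<open>S\<close> once \<open>s * s\<close> is pulled out.
  Only nonnegative powers of \<open>s\<close> remain, so it is bounded for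
  \<open>norm s \<le> 1\<close>.\<close>

definition scaled_S :: "complex \<Rightarrow> ('n + 'd) cmat \<Rightarrow> ('n + 'd) cmat" where
  "scaled_S s W = corner (rescale s ** W ** rescale s) + rescale s ** border W ** rescale s"

definition coupling :: "complex \<Rightarrow> ('n + 'd) cmat" where
  "coupling s = mscale s (block (block11 H) 0 0 0) + block 0 (block12 H) (block21 H) 0"

definition scaled :: "complex \<Rightarrow> ('n + 'd) cmat \<Rightarrow> ('n + 'd) cmat" where
  "scaled s W = D0 + mscale s (coupling s) - mscale (s * s) (scaled_S s W)"

lemma rescale_S: "rescale s ** S (rescale s ** W ** rescale s) ** rescale s = mscale (s * s) (scaled_S s W)"
proof -
  have "block11 (rescale s ** W ** rescale s) = mscale (s * s) (block11 W)" by (simp add: blocks_rescale)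
  note c = blocks_S_cong[OF this]
  show ?thesis
    unfolding block_eq_iff scaled_S_def blocks_mscale blocks_add blocks_rescale blocks_border c
    by (simp add: corner_def mscale_mscale mult_ac)
qed

lemma rescale_pencil:
  assumes "s * s * z = 1"
  shows "rescale s ** pencil z (rescale s ** W ** rescale s) ** rescale s = scaled s W"
proof -
  have "rescale s ** pencil z (rescale s ** W ** rescale s) ** rescale s
     = rescale s ** H ** rescale s - rescale s ** S (rescale s ** W ** rescale s) ** rescale s - rescale s ** mscale z Lam ** rescale s"
    by (simp add: pencil_def matrix_mult_diff_distrib)
  moreover have "rescale s ** H ** rescale s - rescale s ** mscale z Lam ** rescale s = D0 + mscale s (coupling s)"
    using assms unfolding block_eq_iff blocks_add blocks_diff blocks_rescale blocks_mscale coupling_def D0_def blocks_Lam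
    by (simp add: mscale_mat mscale_mscale mat_def vec_eq_iff)
  ultimately show ?thesis by (simp add: rescale_S scaled_def algebra_simps)
qed

lemma matrix_inv_pencil:
  assumes "s * s * z = 1" "invertible (scaled s W)"
  shows "invertible (pencil z (rescale s ** W ** rescale s))"
    "matrix_inv (pencil z (rescale s ** W ** rescale s)) = rescale s ** matrix_inv (scaled s W) ** rescale s"
proof -
  let ?T = "pencil z (rescale s ** W ** rescale s)"
  have "rescale s ** (?T ** rescale s ** matrix_inv (scaled s W)) = mat 1"
    using matrix_inv(1)[OF assms(2)] rescale_pencil[OF assms(1), of W] by (simp add: matrix_mul_assoc)
  then have "?T ** rescale s ** matrix_inv (scaled s W) ** rescale s = mat 1"
    by (simp only: matrix_left_right_inverse)
  then have "?T ** (rescale s ** matrix_inv (scaled s W) ** rescale s) = mat 1"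
    by (simp add: matrix_mul_assoc)
  from matrix_inv_eq[OF this] show "invertible ?T" "matrix_inv ?T = rescale s ** matrix_inv (scaled s W) ** rescale s"
    by auto
qed

lemma scaled_S_diff: "scaled_S s V - scaled_S s W = scaled_S s (V - W)"
proof -
  have "corner (V - W) = corner V - corner W" "border (V - W) = border V - border W" for V W
    using linear_diff[OF bounded_linear.linear[OF mscale_linear_imp_bounded_linear[OF corner_linear]]]
      linear_diff[OF bounded_linear.linear[OF mscale_linear_imp_bounded_linear[OF border_linear]]] by auto
  then show ?thesis by (simp add: scaled_S_def matrix_mult_diff_distrib)
qed

section \<open>Uniform bounds and the contraction\<close>

lemma rescale_bound: "\<exists>c>0. \<forall>s W. norm s \<le> 1 \<longrightarrow> norm (rescale s ** W ** rescale s) \<le> c * norm W"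
proof -
  obtain K where K: "0 < K" "\<And>(A :: ('n + 'd) cmat) B. norm (A ** B) \<le> norm A * norm (B :: ('n + 'd) cmat) * K"
    using bounded_bilinear.pos_bounded[OF bounded_bilinear_matrix_mult] by blast
  define p where "p = norm (Lam :: ('n + 'd) cmat) + norm (block 0 0 0 (mat 1) :: ('n + 'd) cmat)"
  have p: "norm (rescale s) \<le> p" if "norm s \<le> 1" for s
  proof -
    have "rescale s = mscale s Lam + block 0 0 0 (mat 1)"
      by (simp add: rescale_def Lam_def mscale_block block_add mscale_mat)
    then have "norm (rescale s) \<le> norm (mscale s Lam :: ('n + 'd) cmat) + norm (block 0 0 0 (mat 1) :: ('n + 'd) cmat)"
      by (simp add: norm_triangle_ineq)
    also have "norm (mscale s Lam :: ('n + 'd) cmat) \<le> 1 * norm (Lam :: ('n + 'd) cmat)"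
      unfolding norm_mscale by (intro mult_right_mono that) auto
    finally show ?thesis by (simp add: p_def)
  qed
  have p0: "0 \<le> p" by (simp add: p_def)
  have "norm (rescale s ** W ** rescale s) \<le> (p * K * (p * K) + 1) * norm W" if "norm s \<le> 1" for s W
  proof -
    have "norm (rescale s ** W ** rescale s) \<le> norm (rescale s ** W) * norm (rescale s) * K" by (rule K)
    also have "\<dots> \<le> (norm (rescale s) * norm W * K) * norm (rescale s) * K"
      using K by (intro mult_right_mono) auto
    also have "\<dots> \<le> (p * norm W * K) * p * K"
      using K(1) p[OF that] p0 by (intro mult_mono mult_nonneg_nonneg) auto
    also have "\<dots> = (p * K * (p * K)) * norm W" by (simp add: mult_ac)
    also have "\<dots> \<le> (p * K * (p * K) + 1) * norm W" by (intro mult_right_mono) auto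
    finally show ?thesis .
  qed
  moreover have "0 < p * K * (p * K) + 1" using p0 K(1) by (intro add_nonneg_pos) auto
  ultimately show ?thesis by blast
qed

lemma scaled_S_bound: "\<exists>c>0. \<forall>s W. norm s \<le> 1 \<longrightarrow> norm (scaled_S s W) \<le> c * norm W"
proof -
  obtain c where c: "0 < c" "\<And>s W. norm s \<le> 1 \<Longrightarrow> norm (rescale s ** W ** rescale s) \<le> c * norm W"
    using rescale_bound by blast
  obtain u where u: "0 < u" "\<And>W. norm (corner W) \<le> norm W * u"
    using bounded_linear.pos_bounded[OF mscale_linear_imp_bounded_linear[OF corner_linear]] by blast
  obtain r where r: "0 < r" "\<And>W. norm (border W) \<le> norm W * r"
    using bounded_linear.pos_bounded[OF mscale_linear_imp_bounded_linear[OF border_linear]] by blast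
  have "norm (scaled_S s W) \<le> (c * u + c * r) * norm W" if "norm s \<le> 1" for s W
  proof -
    have "norm (scaled_S s W) \<le> norm (corner (rescale s ** W ** rescale s)) + norm (rescale s ** border W ** rescale s)"
      unfolding scaled_S_def by (rule norm_triangle_ineq)
    also have "\<dots> \<le> (c * norm W) * u + c * (norm W * r)"
    proof (rule add_mono)
      show "norm (corner (rescale s ** W ** rescale s)) \<le> (c * norm W) * u"
        using u(2)[of "rescale s ** W ** rescale s"] mult_right_mono[OF c(2)[OF that, of W], of u] u(1) by linarith
      show "norm (rescale s ** border W ** rescale s) \<le> c * (norm W * r)"
        using c(2)[OF that, of "border W"] mult_left_mono[OF r(2)[of W], of c] c(1) by linarith
    qed
    finally show ?thesis by (simp add: algebra_simps)
  qed
  moreover have "0 < c * u + c * r" using c u r by (simp add: add_pos_pos)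
  ultimately show ?thesis by blast
qed

text \<open>The radius \<open>2 * norm D0i\<close> is the bound that
  \<open>inverse_perturbation\<close> yields, so the ball is mapped into itself. A difference of two
  inverses contains the difference of the scaled pencils, which carries the small factor
  \<open>s * s\<close>.\<close>

lemma scaled_contraction:
  "\<exists>s0>0. \<exists>C. s0 \<le> 1 \<and> (\<forall>s W. norm s < s0 \<longrightarrow> norm W \<le> 2 * norm D0i \<longrightarrow>
     invertible (scaled s W) \<and> norm (matrix_inv (scaled s W)) \<le> 2 * norm D0i
     \<and> norm (matrix_inv (scaled s W) - D0i) \<le> C * norm s) \<and>
   (\<forall>s V W. norm s < s0 \<longrightarrow> norm V \<le> 2 * norm D0i \<longrightarrow> norm W \<le> 2 * norm D0i \<longrightarrow>
     norm (matrix_inv (scaled s V) - matrix_inv (scaled s W)) \<le> 1 / 2 * norm (V - W))"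
proof -
  define K where "K = 2 * norm D0i"
  have K: "0 \<le> K" by (simp add: K_def)
  obtain \<delta> C where \<delta>: "0 < \<delta>" and per: "\<And>T. norm (T - D0) < \<delta> \<Longrightarrow> invertible T \<and> norm (matrix_inv T) \<le> K
      \<and> norm (matrix_inv T - D0i) \<le> C * norm (T - D0)"
    using inverse_perturbation[OF D0_D0i] unfolding K_def by blast
  obtain g where g: "0 < g" "\<And>s W. norm s \<le> 1 \<Longrightarrow> norm (scaled_S s W) \<le> g * norm W"
    using scaled_S_bound by blast
  obtain m where m: "0 < m" "\<And>(A :: ('n + 'd) cmat) B. norm (A ** B) \<le> norm A * norm (B :: ('n + 'd) cmat) * m"
    using bounded_bilinear.pos_bounded[OF bounded_bilinear_matrix_mult] by blast
  define n where "n = norm (block (block11 H) 0 0 0 :: ('n + 'd) cmat) + norm (block 0 (block12 H) (block21 H) 0 :: ('n + 'd) cmat)"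
  have n: "norm (coupling s) \<le> n" if "norm s \<le> 1" for s
  proof -
    have "norm (coupling s) \<le> norm (mscale s (block (block11 H) 0 0 0 :: ('n + 'd) cmat)) + norm (block 0 (block12 H) (block21 H) 0 :: ('n + 'd) cmat)"
      unfolding coupling_def by (rule norm_triangle_ineq)
    also have "norm (mscale s (block (block11 H) 0 0 0 :: ('n + 'd) cmat)) \<le> 1 * norm (block (block11 H) 0 0 0 :: ('n + 'd) cmat)"
      unfolding norm_mscale by (intro mult_right_mono that) auto
    finally show ?thesis by (simp add: n_def)
  qed
  define c where "c = n + g * K + 1"
  have c: "0 < c" unfolding c_def n_def using g K by (intro add_nonneg_pos add_nonneg_nonneg) auto
  define q where "q = K * K * (m * m) * g + 1"
  have q: "0 < q" unfolding q_def using g K m by (intro add_nonneg_pos) auto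
  \<comment> \<open>The bound 1 serves the estimates on \<open>rescale s\<close>,
    \<open>\<delta> / c\<close> keeps the scaled pencil within \<delta> of \<open>D0\<close>, and
    \<open>1 / (2 * q)\<close> gives the Lipschitz constant 1/2.\<close>
  define s0 where "s0 = min 1 (min (\<delta> / c) (1 / (2 * q)))"
  have s0: "0 < s0" "s0 \<le> 1" using c q \<delta> by (auto simp: s0_def)
  have near: "norm (scaled s W - D0) \<le> c * norm s" if s: "norm s < s0" and W: "norm W \<le> K" for s W
  proof -
    have s1: "norm s \<le> 1" using s s0 by simp
    have "norm (scaled s W - D0) = norm (mscale s (coupling s) - mscale (s * s) (scaled_S s W))"
      by (simp add: scaled_def)
    also have "\<dots> \<le> norm s * norm (coupling s) + norm s * norm s * norm (scaled_S s W)"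
      using norm_triangle_ineq4[of "mscale s (coupling s)" "mscale (s * s) (scaled_S s W)"] by (simp add: norm_mscale norm_mult)
    also have "\<dots> \<le> norm s * n + norm s * 1 * (g * K)"
    proof (intro add_mono mult_mono mult_nonneg_nonneg)
      have "norm (scaled_S s W) \<le> g * norm W" by (rule g(2)[OF s1])
      also have "\<dots> \<le> g * K" using g W by (intro mult_left_mono) auto
      finally show "norm (scaled_S s W) \<le> g * K" .
    qed (use n[OF s1] s1 in auto)
    also have "\<dots> \<le> c * norm s" by (simp add: c_def algebra_simps)
    finally show ?thesis .
  qed
  have near\<delta>: "norm (scaled s W - D0) < \<delta>" if s: "norm s < s0" and W: "norm W \<le> K" for s W
  proof -
    have "norm s < \<delta> / c" using s by (simp add: s0_def)
    then have "c * norm s < \<delta>" using c by (simp add: field_simps)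
    with near[OF s W] show ?thesis by simp
  qed
  have first: "invertible (scaled s W) \<and> norm (matrix_inv (scaled s W)) \<le> K
     \<and> norm (matrix_inv (scaled s W) - D0i) \<le> (\<bar>C\<bar> * c) * norm s" if s: "norm s < s0" and W: "norm W \<le> K" for s W
  proof -
    have "C * norm (scaled s W - D0) \<le> \<bar>C\<bar> * (c * norm s)"
      using near[OF s W] by (intro mult_mono) auto
    with per[OF near\<delta>[OF s W]] show ?thesis by (simp add: mult.assoc)
  qed
  have "norm (matrix_inv (scaled s V) - matrix_inv (scaled s W)) \<le> 1 / 2 * norm (V - W)"
    if s: "norm s < s0" and V: "norm V \<le> K" and W: "norm W \<le> K" for s V W
  proof -
    let ?A = "matrix_inv (scaled s V)" and ?B = "matrix_inv (scaled s W)"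
    have s1: "norm s \<le> 1" using s s0 by simp
    \<comment> \<open>Resolvent identity: the outer factors are bounded by \<open>K\<close>, the
      middle one is linear in \<open>V - W\<close>.\<close>
    have "?A - ?B = ?A ** ((scaled s W - scaled s V) ** ?B)"
    proof -
      have "?A ** ((scaled s W - scaled s V) ** ?B) = ?A ** (scaled s W ** ?B) - (?A ** scaled s V) ** ?B"
        by (simp add: matrix_mult_diff_distrib matrix_mul_assoc)
      then show ?thesis
        using matrix_inv(1)[of "scaled s W"] matrix_inv(2)[of "scaled s V"] first[OF s V] first[OF s W] by simp
    qed
    also have "scaled s W - scaled s V = mscale (s * s) (scaled_S s (V - W))"
      unfolding scaled_S_diff[symmetric] by (simp add: scaled_def vec_eq_iff algebra_simps)
    also have "norm (?A ** (mscale (s * s) (scaled_S s (V - W)) ** ?B)) \<le> norm ?A * (norm (mscale (s * s) (scaled_S s (V - W))) * norm ?B * m) * m"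
      using m by (intro order_trans[OF m(2)] mult_right_mono mult_left_mono) auto
    also have "\<dots> \<le> K * ((norm s * 1 * (g * norm (V - W))) * K * m) * m"
    proof (intro mult_right_mono mult_mono)
      show "norm (mscale (s * s) (scaled_S s (V - W))) \<le> norm s * 1 * (g * norm (V - W))"
        unfolding norm_mscale norm_mult by (intro mult_mono g(2) s1) auto
    qed (use first[OF s V] first[OF s W] K m g in auto)
    also have "\<dots> = norm s * (K * K * (m * m) * g) * norm (V - W)" by (simp add: mult_ac)
    also have "\<dots> \<le> norm s * q * norm (V - W)"
      by (intro mult_right_mono mult_left_mono) (auto simp: q_def)
    also have "\<dots> \<le> 1 / 2 * norm (V - W)"
    proof (rule mult_right_mono)
      have "norm s < 1 / (2 * q)" using s by (simp add: s0_def)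
      then show "norm s * q \<le> 1 / 2" using q by (simp add: field_simps)
    qed simp
    finally show ?thesis .
  qed
  then show ?thesis using s0 first unfolding K_def by blast
qed

text \<open>Undoes the rescaling with \<open>s = 1 / csqrt z\<close>. The contraction never uses the
  sign of \<open>Im z\<close>, so real \<open>z\<close> and the lower half plane are included. The
  last bound will show that the upper left block of the limit does not degenerate.\<close>

lemma iter_near_infinity:
  "\<exists>r K C. 0 < r \<and> (\<forall>z k. r < norm z \<longrightarrow> invertible (pencil z (iter k z)) \<and> norm (iter k z) \<le> K
     \<and> norm (iter k z - Dinf) \<le> C / sqrt (norm z)
     \<and> norm (iter (Suc k) z - iter k z) \<le> K * (1 / 2) ^ k
     \<and> norm (mscale z (block11 (iter k z)) + mat 1) \<le> C / sqrt (norm z))"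
proof -
  define K where "K = 2 * norm D0i"
  have K: "0 \<le> K" by (simp add: K_def)
  obtain s0 C where s0: "0 < s0" "s0 \<le> 1"
    and first: "\<And>s W. norm s < s0 \<Longrightarrow> norm W \<le> K \<Longrightarrow>
     invertible (scaled s W) \<and> norm (matrix_inv (scaled s W)) \<le> K \<and> norm (matrix_inv (scaled s W) - D0i) \<le> C * norm s"
    and contr: "\<And>s V W. norm s < s0 \<Longrightarrow> norm V \<le> K \<Longrightarrow> norm W \<le> K \<Longrightarrow>
     norm (matrix_inv (scaled s V) - matrix_inv (scaled s W)) \<le> 1 / 2 * norm (V - W)"
    using scaled_contraction unfolding K_def by blast
  obtain p where p: "0 < p" "\<And>s W. norm s \<le> 1 \<Longrightarrow> norm (rescale s ** W ** rescale s) \<le> p * norm W"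
    using rescale_bound by blast
  obtain b where b: "0 < b" "\<And>W :: ('n + 'd) cmat. norm (block11 W) \<le> norm W * b"
    using bounded_linear.pos_bounded[OF bounded_linear_blocks(1)] by blast
  define l where "l = norm (Lam :: ('n + 'd) cmat)"
  define C' where "C' = max (p * \<bar>C\<bar> + l) (\<bar>C\<bar> * b)"
  \<comment> \<open>The 2 covers the first increment, estimated by the norms of \<open>w 1\<close>
    and \<open>w 0\<close>; later increments halve.\<close>
  define K' where "K' = p * (2 * K)"
  have "invertible (pencil z (iter k z)) \<and> norm (iter k z) \<le> K'
     \<and> norm (iter k z - Dinf) \<le> C' / sqrt (norm z)
     \<and> norm (iter (Suc k) z - iter k z) \<le> K' * (1 / 2) ^ k
     \<and> norm (mscale z (block11 (iter k z)) + mat 1) \<le> C' / sqrt (norm z)"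
    if z: "1 / s0\<^sup>2 < norm z" for z k
  proof -
    define s where "s = 1 / csqrt z"
    have z0: "z \<noteq> 0" using z s0 by (auto simp: field_simps)
    have "csqrt z * csqrt z = z" using power2_csqrt[of z] by (simp only: power2_eq_square)
    then have sz: "s * s * z = 1" using z0 by (simp add: s_def)
    have z1: "1 / z = s * s" using sz z0 by (simp add: field_simps)
    have ns: "norm s = 1 / sqrt (norm z)"
      by (simp add: s_def norm_divide norm_csqrt)
    have s: "norm s < s0"
    proof -
      have "1 / s0 = sqrt (1 / s0\<^sup>2)" using s0 by (simp add: real_sqrt_divide)
      also have "\<dots> < sqrt (norm z)" using z by (intro real_sqrt_less_mono)
      finally show ?thesis using s0 z0 unfolding ns by (simp add: field_simps)
    qed
    then have s1: "norm s \<le> 1" using s0 by simp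
    define w where "w k = ((\<lambda>W. matrix_inv (scaled s W)) ^^ k) D0i" for k
    have w0: "w 0 = D0i" and wS: "w (Suc k) = matrix_inv (scaled s (w k))" for k by (simp_all add: w_def)
    have wK: "norm (w k) \<le> K" for k
      by (induction k) (use first[OF s] K in \<open>auto simp: w0 wS K_def\<close>)
    have wC: "norm (w k - D0i) \<le> \<bar>C\<bar> * norm s" for k
    proof (cases k)
      case (Suc j)
      have "norm (w k - D0i) \<le> C * norm s" using first[OF s wK[of j]] by (simp add: Suc wS)
      also have "\<dots> \<le> \<bar>C\<bar> * norm s" by (intro mult_right_mono) auto
      finally show ?thesis .
    qed (simp add: w0)
    have wd: "norm (w (Suc k) - w k) \<le> 2 * K * (1 / 2) ^ k" for k
    proof (induction k)
      case 0
      show ?case using norm_triangle_ineq4[of "w 1" "w 0"] wK[of 1] wK[of 0] by simp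
    next
      case (Suc k)
      have "norm (w (Suc (Suc k)) - w (Suc k)) \<le> 1 / 2 * norm (w (Suc k) - w k)"
        unfolding wS[of "Suc k"] wS[of k] using contr[OF s] wK wS by metis
      with Suc show ?case by simp
    qed
    have it: "iter k z = rescale s ** w k ** rescale s \<and> invertible (pencil z (iter k z))" for k
    proof (induction k)
      case 0
      have "iter 0 z = rescale s ** w 0 ** rescale s"
        unfolding block_eq_iff blocks_rescale w0 D0i_def iter.simps
        by (simp add: mscale_mat z1)
      then show ?case using matrix_inv_pencil(1)[OF sz] first[OF s wK[of 0]] by simp
    next
      case (Suc k)
      have "iter (Suc k) z = rescale s ** w (Suc k) ** rescale s"
        using Suc matrix_inv_pencil(2)[OF sz] first[OF s wK[of k]] by (simp add: wS)
      then show ?case using matrix_inv_pencil(1)[OF sz] first[OF s wK[of "Suc k"]] by simp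
    qed
    have "norm (iter k z) \<le> K'"
    proof -
      have "norm (iter k z) \<le> p * norm (w k)" using it p(2)[OF s1] by simp
      also have "\<dots> \<le> p * (2 * K)" using p(1) wK[of k] K by (intro mult_left_mono) auto
      finally show ?thesis by (simp add: K'_def)
    qed
    moreover have "norm (iter k z - Dinf) \<le> C' / sqrt (norm z)"
    proof -
      have "rescale s ** D0i ** rescale s - Dinf = mscale (- (s * s)) Lam"
        unfolding block_eq_iff blocks_diff blocks_rescale D0i_def Dinf_def blocks_mscale blocks_Lam
        by (simp add: mscale_mat)
      then have "iter k z - Dinf = rescale s ** (w k - D0i) ** rescale s + mscale (- (s * s)) Lam"
        using it by (simp add: matrix_mult_diff_distrib algebra_simps)
      then have "norm (iter k z - Dinf) \<le> norm (rescale s ** (w k - D0i) ** rescale s) + norm (mscale (- (s * s)) Lam :: ('n + 'd) cmat)"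
        by (simp add: norm_triangle_ineq)
      also have "\<dots> \<le> p * (\<bar>C\<bar> * norm s) + norm s * l"
      proof (rule add_mono)
        show "norm (rescale s ** (w k - D0i) ** rescale s) \<le> p * (\<bar>C\<bar> * norm s)"
          using p(2)[OF s1, of "w k - D0i"] mult_left_mono[OF wC[of k], of p] p(1) by linarith
        have "norm (s * s) \<le> norm s * 1" unfolding norm_mult by (intro mult_left_mono s1) auto
        then show "norm (mscale (- (s * s)) Lam :: ('n + 'd) cmat) \<le> norm s * l"
          unfolding norm_mscale l_def by (intro mult_right_mono) auto
      qed
      also have "\<dots> = (p * \<bar>C\<bar> + l) * norm s" by (simp add: algebra_simps)
      also have "\<dots> \<le> C' * norm s" by (intro mult_right_mono) (auto simp: C'_def)
      finally show ?thesis by (simp add: ns)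
    qed
    moreover have "norm (iter (Suc k) z - iter k z) \<le> K' * (1 / 2) ^ k"
    proof -
      have "iter (Suc k) z - iter k z = rescale s ** (w (Suc k) - w k) ** rescale s"
        using it[of k] it[of "Suc k"] by (simp only: matrix_mult_diff_distrib)
      then have "norm (iter (Suc k) z - iter k z) \<le> p * norm (w (Suc k) - w k)"
        using p(2)[OF s1] by simp
      also have "\<dots> \<le> p * (2 * K * (1 / 2) ^ k)" using p(1) wd by (intro mult_left_mono) auto
      finally show ?thesis by (simp add: K'_def)
    qed
    moreover have "norm (mscale z (block11 (iter k z)) + mat 1) \<le> C' / sqrt (norm z)"
    proof -
      have "mscale z (block11 (iter k z)) + mat 1 = block11 (w k - D0i)"
      proof -
        have "z * (s * s) = 1" using sz by (simp add: mult.commute)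
        then have "mscale z (block11 (iter k z)) = block11 (w k)"
          using it by (simp add: blocks_rescale mscale_mscale)
        then show ?thesis by (simp add: blocks_diff D0i_def) (simp add: vec_eq_iff mat_def)
      qed
      then have "norm (mscale z (block11 (iter k z)) + mat 1) \<le> norm (w k - D0i) * b"
        using b by simp
      also have "\<dots> \<le> \<bar>C\<bar> * norm s * b" using wC[of k] b(1) by (intro mult_right_mono) auto
      also have "\<dots> \<le> C' * norm s" using mult_right_mono[of "\<bar>C\<bar> * b" C' "norm s"] by (simp add: C'_def mult_ac)
      finally show ?thesis by (simp add: ns)
    qed
    ultimately show ?thesis using it by blast
  qed
  moreover have "0 < 1 / s0\<^sup>2" using s0 by simp
  ultimately show ?thesis by blast
qed

end

section \<open>Recovering a matrix from its quadratic form\<close>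

lemma qform_expand:
  "qform W (u + c *s v) = qform W u + c * cinner u (W *v v) + cnj c * cinner v (W *v u) + cnj c * c * qform W v"
  by (simp add: qform_cinner cinner_def matrix_vector_right_distrib vector_scalar_commute
      sum.distrib sum_distrib_left algebra_simps)

lemma matrix_vector_mult_axis: "(W *v axis j 1) $ i = W $ i $ j"
  for W :: "complex ^ 'm ^ 'n"
  by (simp add: matrix_vector_mult_def axis_def if_distrib cong: if_cong)

lemma cinner_axis: "cinner (axis i 1) v = v $ i"
  by (simp add: cinner_def axis_def if_distrib[of cnj] if_distrib[of "\<lambda>x. x * _"] cong: if_cong)

text \<open>Over the fourth roots of unity \<open>c\<close>, the weight \<open>cnj c\<close> keeps
  the term of \<open>qform_expand\<close> that is linear in \<open>c\<close>; the other three sum to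
  0.\<close>

lemma qform_polar:
  "4 * W $ i $ j = (\<Sum>p<4::nat. cnj (\<i> ^ p) * qform W (axis i 1 + \<i> ^ p *s axis j 1))"
  by (simp add: qform_expand cinner_axis matrix_vector_mult_axis eval_nat_numeral algebra_simps)

lemma bounded_linear_qform: "bounded_linear (\<lambda>W. qform W v)"
  unfolding linear_conv_bounded_linear[symmetric] linear_iff qform_def
  by (simp add: sum.distrib scaleR_sum_right algebra_simps)

lemmas tendsto_qform = bounded_linear.tendsto[OF bounded_linear_qform]

lemma tendsto_matrix_if_qform:
  fixes W :: "'b \<Rightarrow> 'k::finite cmat"
  assumes "\<And>v. \<exists>l. ((\<lambda>x. qform (W x) v) \<longlongrightarrow> l) F"
  shows "\<exists>L. (W \<longlongrightarrow> L) F"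
proof -
  obtain l where l: "\<And>v. ((\<lambda>x. qform (W x) v) \<longlongrightarrow> l v) F" using assms by metis
  define L :: "'k cmat" where "L = (\<chi> i j. (\<Sum>p<4::nat. cnj (\<i> ^ p) * l (axis i 1 + \<i> ^ p *s axis j 1)) / 4)"
  have "(W \<longlongrightarrow> L) F"
  proof (intro vec_tendstoI)
    fix i j
    have "((\<lambda>x. (\<Sum>p<4::nat. cnj (\<i> ^ p) * qform (W x) (axis i 1 + \<i> ^ p *s axis j 1)) / 4) \<longlongrightarrow> L $ i $ j) F"
      unfolding L_def by (auto intro!: tendsto_intros l)
    then show "((\<lambda>x. W x $ i $ j) \<longlongrightarrow> L $ i $ j) F"
      unfolding qform_polar[symmetric] by simp
  qed
  then show ?thesis by blast
qed

lemma holomorphic_on_matrix_if_qform: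
  fixes W :: "complex \<Rightarrow> 'k::finite cmat"
  assumes "\<And>v. (\<lambda>z. qform (W z) v) holomorphic_on A"
  shows "(\<lambda>z. W z $ i $ j) holomorphic_on A"
proof -
  have "(\<lambda>z. (\<Sum>p<4::nat. cnj (\<i> ^ p) * qform (W z) (axis i 1 + \<i> ^ p *s axis j 1)) / 4) holomorphic_on A"
    by (intro holomorphic_intros assms) auto
  then show ?thesis unfolding qform_polar[symmetric] by simp
qed

lemma holomorphic_on_qform:
  assumes "\<And>i j. (\<lambda>z. W z $ i $ j) holomorphic_on A"
  shows "(\<lambda>z. qform (W z) v) holomorphic_on A"
  unfolding qform_def by (intro holomorphic_intros assms)

section \<open>The Joukowsky map\<close>

definition joukowsky :: "complex \<Rightarrow> complex" where "joukowsky w = w + 1 / w"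

lemma Im_joukowsky: "Im (joukowsky w) = Im w * (1 - 1 / (norm w)\<^sup>2)"
  by (simp add: joukowsky_def Im_divide cmod_def algebra_simps)

text \<open>Inside the disc the map exchanges the half planes. This is the origin of the minus sign
  when forms of the iterates are made typically real.\<close>

lemma joukowsky_Im_sign:
  assumes "norm w < 1" "0 < Im w"
  shows "Im (joukowsky w) < 0"
proof -
  have "w \<noteq> 0" using assms(2) by auto
  then have "1 < 1 / (norm w)\<^sup>2" using assms(1) by (simp add: power_less_one_iff)
  then show ?thesis using assms(2) by (simp add: Im_joukowsky mult_pos_neg)
qed

lemma cnj_joukowsky: "joukowsky (cnj w) = cnj (joukowsky w)"
  by (simp add: joukowsky_def)

text \<open>Ensures that, after scaling by \<open>r\<close>, real points of the disc land where the
  iteration is controlled without positivity.\<close>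

lemma norm_joukowsky_real:
  assumes "norm w < 1" "w \<noteq> 0" "Im w = 0"
  shows "1 < norm (joukowsky w)"
proof -
  define x where "x = Re w"
  have w: "w = of_real x" using assms(3) by (simp add: x_def complex_eq_iff)
  have x: "\<bar>x\<bar> < 1" "x \<noteq> 0" using assms by (auto simp: w)
  have "joukowsky w = of_real (x + 1 / x)" by (simp add: joukowsky_def w)
  then have n: "norm (joukowsky w) = \<bar>x + 1 / x\<bar>" by (simp only: norm_of_real)
  have "x + 1 / x = (x * x + 1) / x" using x by (simp add: field_simps)
  then have "\<bar>x + 1 / x\<bar> = (x * x + 1) / \<bar>x\<bar>" by (simp add: abs_divide abs_of_nonneg)
  moreover have "1 < (x * x + 1) / \<bar>x\<bar>"
    using x by (simp add: pos_less_divide_eq add_strict_increasing2)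
  ultimately show ?thesis using n by simp
qed

lemma norm_joukowsky_ge:
  assumes "norm w \<le> 1 / 2" "w \<noteq> 0"
  shows "1 / (2 * norm w) \<le> norm (joukowsky w)" "1 < norm (joukowsky w)"
proof -
  have n: "0 < norm w" using assms by simp
  have "1 / norm w - norm w \<le> norm (joukowsky w)"
    using norm_triangle_ineq2[of "1 / w" "- w"] by (simp add: joukowsky_def norm_divide add.commute)
  moreover have "norm w * norm w \<le> 1 / 2 * (1 / 2)" using assms(1) by (intro mult_mono) auto
  then have "norm w \<le> 1 / (4 * norm w)" using n by (simp add: field_simps)
  moreover have "1 / norm w - 1 / (4 * norm w) = 3 / (4 * norm w)" "1 / (2 * norm w) = 2 / (4 * norm w)"
    using n by (simp_all add: field_simps)
  moreover have "2 / (4 * norm w) \<le> 3 / (4 * norm w)" using n by (intro divide_right_mono) auto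
  moreover have "1 < 3 / (4 * norm w)" using n assms(1) by (simp add: pos_less_divide_eq)
  ultimately show "1 / (2 * norm w) \<le> norm (joukowsky w)" "1 < norm (joukowsky w)" by linarith+
qed

lemma inj_on_joukowsky: "inj_on joukowsky (ball 0 1 - {0})"
proof (rule inj_onI)
  fix w u assume w: "w \<in> ball 0 1 - {0}" and u: "u \<in> ball 0 1 - {0}" and eq: "joukowsky w = joukowsky u"
  have "(w - u) * (w * u - 1) = 0"
    using eq w u by (simp add: joukowsky_def field_simps)
  moreover have "norm (w * u) < 1 * 1"
    unfolding norm_mult using w u by (intro mult_strict_mono) auto
  then have "w * u \<noteq> 1" by auto
  ultimately show "w = u" by simp
qed

text \<open>\<open>a\<close> and \<open>b\<close> are the roots of \<open>w * w - z * w + 1\<close>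
  and have product 1. If neither lies inside the disc, both lie on the circle, are conjugate, and
  have a real sum \<open>z\<close>.\<close>

lemma joukowsky_surj:
  assumes "Im z \<noteq> 0"
  obtains w where "norm w < 1" "w \<noteq> 0" "joukowsky w = z"
proof -
  define d where "d = csqrt (z\<^sup>2 - 4)"
  define a b where "a = (z + d) / 2" and "b = (z - d) / 2"
  have "d * d = z * z - 4" using power2_csqrt[of "z\<^sup>2 - 4"] by (simp add: d_def power2_eq_square)
  then have ab: "a * b = 1" by (simp add: a_def b_def field_simps)
  have s: "a + b = z" by (simp add: a_def b_def field_simps)
  have nz: "a \<noteq> 0" "b \<noteq> 0" using ab by auto
  have inv: "1 / a = b" "1 / b = a" using ab nz by (simp_all add: field_simps)
  have n: "norm a * norm b = 1" using ab by (metis norm_mult norm_one)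
  consider "norm a < 1" | "norm b < 1" | "1 \<le> norm a" "1 \<le> norm b" by linarith
  then show ?thesis
  proof cases
    case 1 then show ?thesis using that[of a] nz s inv by (simp add: joukowsky_def)
  next
    case 2 then show ?thesis using that[of b] nz s inv by (simp add: joukowsky_def add.commute)
  next
    case 3
    have "norm a \<le> norm a * norm b" using 3 by (simp add: mult_le_cancel_left1)
    then have "norm a = 1" using 3 n by simp
    then have "b = cnj a" using ab complex_norm_square[of a] nz(1)
      by (metis mult_left_cancel of_real_1 one_power2)
    then have "Im z = 0" using s by auto
    with assms show ?thesis by simp
  qed
qed

text \<open>An injective holomorphic map has a holomorphic inverse, which spares choosing a branch
  of the square root.\<close>

lemma joukowsky_inverse:
  obtains g where "g holomorphic_on joukowsky ` (ball 0 1 - {0})"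
    "\<And>w. w \<in> ball 0 1 - {0} \<Longrightarrow> g (joukowsky w) = w"
proof -
  have "joukowsky holomorphic_on ball 0 1 - {0}"
    unfolding joukowsky_def[abs_def] by (intro holomorphic_intros) auto
  from holomorphic_has_inverse[OF this _ inj_on_joukowsky] that show ?thesis by auto
qed

section \<open>Convergence of the iteration off a real interval\<close>

context matrix_dyson
begin

text \<open>Below the axis the pencils are adjoints of those above. Symmetry and invertibility go
  through one induction because the adjoint of an inverse is known only for invertible matrices, and
  \<open>z\<close> is arbitrary because \<open>cnj z\<close> enters.\<close>

lemma iter_reflect:
  assumes r: "\<And>z k. r < norm z \<Longrightarrow> invertible (pencil z (iter k z))"
    and z: "Im z \<noteq> 0 \<or> r < norm z"
  shows "iter k (cnj z) = ctranspose (iter k z) \<and> invertible (pencil z (iter k z))"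
  using z
proof (induction k arbitrary: z)
  have inv: "invertible (pencil z (iter k z))"
    if D: "Im z \<noteq> 0 \<or> r < norm z" and reflect: "iter k z = ctranspose (iter k (cnj z))" for z k
  proof -
    consider "0 < Im z" | "r < norm z" | "0 < Im (cnj z)" using D by (cases "0 < Im z") auto
    then show ?thesis
    proof cases
      case 1 then show ?thesis by (intro pencil_invertible iter_admissible)
    next
      case 2 then show ?thesis by (rule r)
    next
      case 3
      then have "invertible (pencil (cnj z) (iter k (cnj z)))"
        by (intro pencil_invertible iter_admissible)
      from invertible_ctranspose(1)[OF this] show ?thesis
        by (simp add: pencil_ctranspose reflect[symmetric])
    qed
  qed
  {
    case 0
    have eq: "iter 0 (cnj z) = ctranspose (iter 0 z)" for z
      by (simp add: ctranspose_block ctranspose_mat Qi_hermitian)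
    show ?case using inv[OF 0, of 0] eq[of z] eq[of "cnj z"] by simp
  next
    case (Suc k)
    have eq: "iter (Suc k) (cnj z) = ctranspose (iter (Suc k) z)" if "Im z \<noteq> 0 \<or> r < norm z" for z
    proof -
      have "iter k (cnj z) = ctranspose (iter k z)" and i: "invertible (pencil z (iter k z))"
        using Suc.IH[OF that] by auto
      then show ?thesis
        by (simp add: pencil_ctranspose[symmetric] invertible_ctranspose(2)[OF i])
    qed
    have "Im (cnj z) \<noteq> 0 \<or> r < norm (cnj z)" using Suc.prems by simp
    from eq[OF this] have "iter (Suc k) z = ctranspose (iter (Suc k) (cnj z))"
      by (simp only: complex_cnj_cnj)
    then show ?case using inv[OF Suc.prems, of "Suc k"] eq[OF Suc.prems] by blast
  }
qed

lemma holomorphic_on_pencil: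
  assumes "\<And>i j. (\<lambda>z. W z $ i $ j) holomorphic_on A"
  shows "(\<lambda>z. pencil z (W z) $ i $ j) holomorphic_on A"
  unfolding pencil_def
  by (auto intro!: holomorphic_intros holomorphic_on_mscale_linear[OF S_linear] assms)

lemma iter_holomorphic:
  assumes "0 \<notin> A" "\<And>z k. z \<in> A \<Longrightarrow> invertible (pencil z (iter k z))"
  shows "(\<lambda>z. iter k z $ i $ j) holomorphic_on A"
proof (induction k arbitrary: i j)
  case 0
  show ?case
    by (cases i; cases j; cases "i = j") (use assms(1) in \<open>auto simp: mat_def intro!: holomorphic_intros\<close>)
next
  case (Suc k)
  then show ?case unfolding iter.simps
    by (intro holomorphic_on_matrix_inv holomorphic_on_pencil assms(2))
qed

lemma Im_qform_Dinf: "Im (qform Dinf v) = 0"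
proof -
  have "ctranspose Dinf = Dinf" by (simp add: Dinf_def ctranspose_block Qi_hermitian)
  then show ?thesis by (simp add: hermitian_iff complex_is_Real_iff)
qed

text \<open>For every vector, the form of the iterate minus its value at infinity becomes a
  typically real function of \<open>w\<close>, bounded and geometrically convergent for
  \<open>norm w < 1 / 2\<close>. The forms then converge on the whole disc, and polarization returns
  the matrices.\<close>

lemma iter_limit:
  "\<exists>r M C. (0::real) < r \<and>
     (\<forall>w. norm w < 1 \<longrightarrow> w \<noteq> 0 \<longrightarrow> (\<lambda>k. iter k (complex_of_real r * joukowsky w)) \<longlonglongrightarrow> M (complex_of_real r * joukowsky w)) \<and>
     (\<forall>v. typically_real (\<lambda>w. if w = 0 then 0 else - qform (M (complex_of_real r * joukowsky w) - Dinf) v)) \<and>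
     (\<forall>z k. r < norm z \<longrightarrow> norm (mscale z (block11 (iter k z)) + mat 1) \<le> C / sqrt (norm z))"
proof -
  obtain r K C where r: "0 < r"
    and inv: "\<And>z k. r < norm z \<Longrightarrow> invertible (pencil z (iter k z))"
    and inf: "\<And>z k. r < norm z \<Longrightarrow> norm (iter k z - Dinf) \<le> C / sqrt (norm z)"
    and dif: "\<And>z k. r < norm z \<Longrightarrow> norm (iter (Suc k) z - iter k z) \<le> K * (1 / 2) ^ k"
    and b11: "\<And>z k. r < norm z \<Longrightarrow> norm (mscale z (block11 (iter k z)) + mat 1) \<le> C / sqrt (norm z)"
    using iter_near_infinity by blast
  define D where "D = {z. Im z \<noteq> 0 \<or> r < norm z}"
  have D0: "0 \<notin> D" using r by (simp add: D_def)
  have refl: "iter k (cnj z) = ctranspose (iter k z)" "invertible (pencil z (iter k z))" if "z \<in> D" for z k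
    using iter_reflect[OF inv] that by (auto simp: D_def)
  define J where "J w = r * joukowsky w" for w
  have JD: "J w \<in> D" if "norm w < 1" "w \<noteq> 0" for w
  proof (cases "Im w = 0")
    case True
    then show ?thesis using norm_joukowsky_real[OF that] r by (simp add: D_def J_def norm_mult)
  next
    case False
    have "Im (J w) \<noteq> 0"
    proof (cases "0 < Im w")
      case True then show ?thesis using joukowsky_Im_sign[OF that(1)] r by (simp add: J_def)
    next
      case neg: False
      then have "0 < Im (cnj w)" using False by simp
      with joukowsky_Im_sign[of "cnj w"] that(1) r show ?thesis by (simp add: J_def cnj_joukowsky)
    qed
    then show ?thesis by (simp add: D_def)
  qed
  have cnjJ: "J (cnj w) = cnj (J w)" for w by (simp add: J_def cnj_joukowsky)
  have hJ: "J holomorphic_on ball 0 1 - {0}"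
    unfolding J_def[abs_def] joukowsky_def by (intro holomorphic_intros) auto
  have Jr: "r < norm (J w)" "r / (2 * norm w) \<le> norm (J w)" if "norm w \<le> 1 / 2" "w \<noteq> 0" for w
    using norm_joukowsky_ge[OF that] r mult_left_mono[OF norm_joukowsky_ge(1)[OF that], of r]
    by (auto simp: J_def norm_mult)
  have holD: "(\<lambda>z. iter k z $ i $ j) holomorphic_on D" for k i j
    by (rule iter_holomorphic[OF D0 refl(2)])
  \<comment> \<open>The value at 0 is the limit for \<open>J w\<close> tending to infinity, and the
    minus sign compensates the exchange of half planes by the Joukowsky map.\<close>
  define F where "F v k w = (if w = 0 then 0 else - qform (iter k (J w) - Dinf) v)" for v k w
  have lim: "\<exists>L. typically_real L \<and> (\<forall>w. norm w < 1 \<longrightarrow> (\<lambda>k. F v k w) \<longlonglongrightarrow> L w)" for v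
  proof -
    obtain q where q: "0 < q" "\<And>W :: ('n + 'd) cmat. norm (qform W v) \<le> norm W * q"
      using bounded_linear.pos_bounded[OF bounded_linear_qform] by blast
    \<comment> \<open>The decay like the inverse square root of \<open>norm z\<close> becomes a
      bound by the square root of \<open>norm w\<close>. This is weaker than order \<open>w\<close>
      but enough to remove the singularity at 0.\<close>
    have bd: "norm (F v k w) \<le> \<bar>C\<bar> * q * sqrt (2 * norm w / r)" if w: "norm w \<le> 1 / 2" for k w
    proof (cases "w = 0")
      case False
      have "C / sqrt (norm (J w)) \<le> \<bar>C\<bar> / sqrt (r / (2 * norm w))"
        using Jr[OF w False] r False by (intro frac_le real_sqrt_le_mono) auto
      also have "\<dots> = \<bar>C\<bar> * sqrt (2 * norm w / r)"
        by (simp add: real_sqrt_divide)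
      finally have "norm (iter k (J w) - Dinf) \<le> \<bar>C\<bar> * sqrt (2 * norm w / r)"
        using inf[OF Jr(1)[OF w False], of k] by simp
      then have "norm (iter k (J w) - Dinf) * q \<le> \<bar>C\<bar> * sqrt (2 * norm w / r) * q"
        using q(1) by (intro mult_right_mono) auto
      with q(2)[of "iter k (J w) - Dinf"] False show ?thesis
        by (simp add: F_def mult_ac)
    qed (simp add: F_def)
    have cont0: "isCont (F v k) 0" for k
    proof -
      have "((\<lambda>w. \<bar>C\<bar> * q * sqrt (2 * norm w / r)) \<longlongrightarrow> \<bar>C\<bar> * q * sqrt (2 * norm (0::complex) / r)) (at 0)"
        by (intro tendsto_intros) (use r tendsto_norm_zero[OF tendsto_ident_at] in auto)
      then have "((\<lambda>w. \<bar>C\<bar> * q * sqrt (2 * norm w / r)) \<longlongrightarrow> 0) (at (0::complex))" by simp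
      moreover have "eventually (\<lambda>w. norm (F v k w) \<le> \<bar>C\<bar> * q * sqrt (2 * norm w / r)) (at (0::complex))"
        unfolding eventually_at by (intro exI[of _ "1 / 2"]) (use bd in auto)
      ultimately have "(F v k \<longlongrightarrow> 0) (at 0)" by (rule Lim_null_comparison[rotated])
      then show ?thesis by (simp add: isCont_def F_def)
    qed
    have tr: "typically_real (F v k)" for k
    proof
      have h: "F v k holomorphic_on ball 0 1 - {0}"
      proof (rule holomorphic_transform)
        have "(\<lambda>w. iter k (J w) $ i $ j) holomorphic_on ball 0 1 - {0}" for i j
          by (rule holomorphic_on_compose_gen[OF hJ holD, unfolded o_def]) (auto intro!: JD)
        then show "(\<lambda>w. - qform (iter k (J w) - Dinf) v) holomorphic_on ball 0 1 - {0}"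
          by (auto intro!: holomorphic_intros holomorphic_on_qform)
      qed (simp add: F_def)
      have "continuous_on (ball 0 1) (F v k)"
      proof (rule continuous_at_imp_continuous_on, rule ballI)
        fix w :: complex assume w: "w \<in> ball 0 1"
        show "isCont (F v k) w"
        proof (cases "w = 0")
          case False
          then show ?thesis
            using holomorphic_on_imp_continuous_on[OF h] w
            by (simp add: continuous_on_eq_continuous_at open_delete)
        qed (simp add: cont0)
      qed
      then show "F v k holomorphic_on ball 0 1"
        using no_isolated_singularity[of "ball 0 1" "F v k" "{0}"] h by simp
      show "F v k 0 = 0" by (simp add: F_def)
      show "F v k (cnj w) = cnj (F v k w)" if w: "norm w < 1" for w
      proof (cases "w = 0")
        case False
        have "iter k (J (cnj w)) - Dinf = ctranspose (iter k (J w) - Dinf)"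
          using refl(1)[OF JD[OF w False]]
          by (simp add: cnjJ ctranspose_diff Dinf_def ctranspose_block Qi_hermitian)
        then show ?thesis using False by (simp add: F_def qform_ctranspose)
      qed (simp add: F_def)
      show "0 \<le> Im (F v k w)" if w: "norm w < 1" "0 < Im w" for w
      proof -
        have w0: "w \<noteq> 0" using w(2) by auto
        have "0 < Im (cnj (J w))" using joukowsky_Im_sign[OF w] r by (simp add: J_def mult_pos_neg)
        then have "0 \<le> Im (qform (iter k (cnj (J w))) v)"
          using iter_admissible by (simp add: admissible_values_iff)
        then have "0 \<le> - Im (qform (iter k (J w)) v)"
          using refl(1)[OF JD[OF w(1) w0]] by (simp add: qform_ctranspose)
        then show ?thesis using w0 by (simp add: F_def qform_diff Im_qform_Dinf)
      qed
    qed
    show ?thesis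
    proof (rule typically_real_convergent[OF tr])
      show "norm (F v k w) \<le> \<bar>C\<bar> * q * sqrt (1 / r)" if w: "norm w < 1 / 2" for k w
      proof -
        have "sqrt (2 * norm w / r) \<le> sqrt (1 / r)"
          using w r by (intro real_sqrt_le_mono divide_right_mono) auto
        then have "\<bar>C\<bar> * q * sqrt (2 * norm w / r) \<le> \<bar>C\<bar> * q * sqrt (1 / r)"
          using q(1) by (intro mult_left_mono) auto
        with bd[of w k] w show ?thesis by simp
      qed
      show "norm (F v (Suc k) w - F v k w) \<le> (\<bar>K\<bar> * q) * (1 / 2) ^ k" if w: "norm w < 1 / 2" for k w
      proof (cases "w = 0")
        case False
        have "F v (Suc k) w - F v k w = - qform (iter (Suc k) (J w) - iter k (J w)) v"
          using False by (simp add: F_def qform_diff)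
        then have "norm (F v (Suc k) w - F v k w) \<le> norm (iter (Suc k) (J w) - iter k (J w)) * q"
          using q(2)[of "iter (Suc k) (J w) - iter k (J w)"] by (simp only: norm_minus_cancel)
        also have "\<dots> \<le> (K * (1 / 2) ^ k) * q"
          using dif[OF Jr(1)[of w]] w False q(1) by (intro mult_right_mono) auto
        also have "\<dots> \<le> (\<bar>K\<bar> * (1 / 2) ^ k) * q"
          using q(1) by (intro mult_right_mono) auto
        finally show ?thesis by (simp add: mult_ac)
      qed (use q in \<open>simp add: F_def\<close>)
    qed
  qed
  then obtain L where L: "\<And>v. typically_real (L v)" "\<And>v w. norm w < 1 \<Longrightarrow> (\<lambda>k. F v k w) \<longlonglongrightarrow> L v w"
    by metis
  have "\<exists>X. (\<lambda>k. iter k (J w)) \<longlonglongrightarrow> X" if w: "norm w < 1" "w \<noteq> 0" for w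
  proof (rule tendsto_matrix_if_qform)
    fix v
    have "(\<lambda>k. qform Dinf v - F v k w) \<longlonglongrightarrow> qform Dinf v - L v w"
      by (intro tendsto_intros L w)
    then show "\<exists>l. (\<lambda>k. qform (iter k (J w)) v) \<longlonglongrightarrow> l"
      using w(2) by (auto simp: F_def qform_diff)
  qed
  moreover define M where "M z = lim (\<lambda>k. iter k z)" for z
  ultimately have M: "(\<lambda>k. iter k (J w)) \<longlonglongrightarrow> M (J w)" if "norm w < 1" "w \<noteq> 0" for w
    using that by (metis limI)
  have "typically_real (\<lambda>w. if w = 0 then 0 else - qform (M (J w) - Dinf) v)" for v
  proof -
    interpret typically_real "L v" by (rule L)
    have eq: "(if w = 0 then 0 else - qform (M (J w) - Dinf) v) = L v w" if w: "norm w < 1" for w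
    proof (cases "w = 0")
      case False
      have "(\<lambda>k. F v k w) \<longlonglongrightarrow> - qform (M (J w) - Dinf) v"
        unfolding F_def using False by (auto intro!: tendsto_intros tendsto_qform M w)
      then show ?thesis using L(2)[OF w] False LIMSEQ_unique by auto
    qed (simp add: zero)
    show ?thesis
    proof
      show "(\<lambda>w. if w = 0 then 0 else - qform (M (J w) - Dinf) v) holomorphic_on ball 0 1"
        by (rule holomorphic_transform[OF hol]) (simp add: eq)
    qed (use sym pos eq in \<open>auto simp only: complex_mod_cnj, auto\<close>)
  qed
  then show ?thesis using r M b11 unfolding J_def by blast
qed

end

section \<open>Existence of the solution\<close>

lemma cauchy_kernel_integrable:
  assumes "finite_measure \<mu>" "sets \<mu> = sets borel" "0 < Im z"
  shows "integrable \<mu> (\<lambda>x. 1 / (complex_of_real x - z))"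
proof -
  interpret finite_measure \<mu> by (rule assms)
  show ?thesis
    by (rule integrable_const_bound[where B = "1 / Im z"])
      (use cauchy_kernel_bound[OF assms(3)] in \<open>auto simp: measurable_cong_sets[OF assms(2)]\<close>)
qed

text \<open>The kernel has positive imaginary part everywhere, so the measure is null. The
  conclusion concerns every \<open>f\<close> so that a single point \<open>z\<close> decides the
  transform at all others.\<close>

lemma cauchy_transform_real_imp_zero:
  assumes \<mu>: "finite_measure \<mu>" "sets \<mu> = sets borel" and z: "0 < Im z"
    and Im: "Im (\<integral>x. 1 / (complex_of_real x - z) \<partial>\<mu>) \<le> 0"
  shows "(\<integral>x. f x \<partial>\<mu>) = (0 :: complex)"
proof -
  have pos: "0 < Im (1 / (complex_of_real x - z))" for x
  proof -
    have "0 < (Re (complex_of_real x - z))\<^sup>2 + (Im (complex_of_real x - z))\<^sup>2"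
      using z by (simp add: add_nonneg_pos)
    then show ?thesis using z by (simp add: Im_divide)
  qed
  have int: "integrable \<mu> (\<lambda>x. Im (1 / (complex_of_real x - z)))"
    by (rule integrable_bounded_linear[OF bounded_linear_Im cauchy_kernel_integrable[OF \<mu> z]])
  have "(\<integral>x. Im (1 / (complex_of_real x - z)) \<partial>\<mu>) \<le> 0"
    using Im integral_bounded_linear[OF bounded_linear_Im cauchy_kernel_integrable[OF \<mu> z]] by simp
  moreover have "0 \<le> (\<integral>x. Im (1 / (complex_of_real x - z)) \<partial>\<mu>)"
    using pos by (intro integral_nonneg_AE) (simp add: less_imp_le)
  ultimately have "(\<integral>x. Im (1 / (complex_of_real x - z)) \<partial>\<mu>) = 0" by simp
  then have "AE x in \<mu>. Im (1 / (complex_of_real x - z)) = 0"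
    using pos by (subst (asm) integral_nonneg_eq_0_iff_AE[OF int]) (auto simp: less_imp_le)
  then have "AE x in \<mu>. f x = 0" using pos by (auto simp: less_le elim!: eventually_mono)
  then show ?thesis by (rule integral_eq_zero_AE)
qed

context typically_real
begin

lemma cauchy_representation:
  assumes r: "0 < r"
  shows "\<exists>\<mu>. finite_measure \<mu> \<and> sets \<mu> = sets borel \<and> emeasure \<mu> (- {-2 * r..2 * r}) = 0
    \<and> (\<forall>w. norm w < 1 \<longrightarrow> w \<noteq> 0 \<longrightarrow>
       - F w = (\<integral>x. 1 / (complex_of_real x - of_real r * joukowsky w) \<partial>\<mu>))"
proof -
  obtain \<mu> where \<mu>: "finite_measure \<mu>" "sets \<mu> = sets borel" "emeasure \<mu> (- {-2..2}) = 0"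
    and F: "\<And>w. norm w < 1 \<Longrightarrow> w \<noteq> 0 \<Longrightarrow> F w = (\<integral>x. 1 / (w + 1 / w - complex_of_real x) \<partial>\<mu>)"
    using measure_representation by blast
  interpret \<mu>: finite_measure \<mu> by (rule \<mu>)
  have [measurable_cong]: "sets \<mu> = sets borel" by (rule \<mu>)
  have sp: "space \<mu> = UNIV" using sets_eq_imp_space_eq[OF \<mu>(2)] by simp
  \<comment> \<open>The weight \<open>r\<close> makes up for the factor \<open>1 / r\<close> that
    the dilation by \<open>r\<close> takes out of the Cauchy kernel.\<close>
  define d where "d = density \<mu> (\<lambda>_. ennreal r)"
  have [measurable_cong]: "sets d = sets borel" by (simp add: d_def \<mu>)
  have d: "emeasure d X = ennreal r * emeasure \<mu> X" if "X \<in> sets borel" for X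
    unfolding d_def using that \<mu> by (subst emeasure_density) (auto simp: nn_integral_cmult_indicator)
  have spd: "space d = UNIV" by (simp add: d_def sp)
  define \<nu> where "\<nu> = distr d borel (\<lambda>x. r * x)"
  have "finite_measure \<nu>"
  proof (rule finite_measureI)
    have "emeasure \<nu> (space \<nu>) = ennreal r * emeasure \<mu> UNIV"
      unfolding \<nu>_def by (subst emeasure_distr) (auto simp: spd d)
    then show "emeasure \<nu> (space \<nu>) \<noteq> \<infinity>"
      using \<mu>.emeasure_finite[of UNIV] by (simp add: ennreal_mult_eq_top_iff)
  qed
  moreover have "emeasure \<nu> (- {-2 * r..2 * r}) = 0"
  proof -
    have "(\<lambda>x. r * x) -` (- {-2 * r..2 * r}) \<inter> space d = - {-2..2}"
    proof -
      have "r * x \<in> {-2 * r..2 * r} \<longleftrightarrow> x \<in> {-2..2}" for x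
        using mult_le_cancel_left_pos[OF r, of "-2" x] mult_le_cancel_left_pos[OF r, of x 2]
        by (simp add: mult.commute)
      then show ?thesis by (auto simp: spd)
    qed
    then show ?thesis unfolding \<nu>_def by (subst emeasure_distr) (auto simp: d \<mu>)
  qed
  moreover have "- F w = (\<integral>x. 1 / (complex_of_real x - of_real r * joukowsky w) \<partial>\<nu>)" if w: "norm w < 1" "w \<noteq> 0" for w
  proof -
    have "(\<integral>x. 1 / (complex_of_real x - of_real r * joukowsky w) \<partial>\<nu>)
       = (\<integral>x. 1 / (complex_of_real (r * x) - of_real r * joukowsky w) \<partial>d)"
      unfolding \<nu>_def by (rule integral_distr) auto
    also have "\<dots> = (\<integral>x. r *\<^sub>R (1 / (complex_of_real (r * x) - of_real r * joukowsky w)) \<partial>\<mu>)"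
      unfolding d_def using r by (intro integral_density) auto
    also have "(\<lambda>x. r *\<^sub>R (1 / (complex_of_real (r * x) - of_real r * joukowsky w)))
        = (\<lambda>x. - (1 / (w + 1 / w - complex_of_real x)))"
    proof
      fix x
      have "r *\<^sub>R (1 / (complex_of_real (r * x) - of_real r * joukowsky w))
          = of_real r * 1 / (of_real r * (complex_of_real x - joukowsky w))"
        by (simp add: scaleR_conv_of_real right_diff_distrib)
      also have "\<dots> = 1 / (complex_of_real x - joukowsky w)"
        using r by (subst mult_divide_mult_cancel_left) auto
      also have "\<dots> = - (1 / (w + 1 / w - complex_of_real x))"
        unfolding joukowsky_def by (metis minus_diff_eq minus_divide_right)
      finally show "r *\<^sub>R (1 / (complex_of_real (r * x) - of_real r * joukowsky w))
        = - (1 / (w + 1 / w - complex_of_real x))" .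
    qed
    finally show ?thesis using F[OF w] by simp
  qed
  ultimately show ?thesis by (intro exI[of _ \<nu>]) (auto simp: \<nu>_def)
qed

end

context matrix_dyson
begin

lemma existence:
  "\<exists>r M. (\<forall>i j. (\<lambda>z. M z $ i $ j) holomorphic_on upper_half_plane) \<and>
    (\<forall>z\<in>upper_half_plane. M z \<in> admissible_values \<and> pencil z (M z) ** M z = mat 1) \<and>
    (\<forall>v. \<exists>\<mu>. finite_measure \<mu> \<and> sets \<mu> = sets borel \<and> emeasure \<mu> (- {-r..r}) = 0 \<and>
      (\<forall>z\<in>upper_half_plane. qform (M z - Dinf) v = (\<integral>x. 1 / (complex_of_real x - z) \<partial>\<mu>)))"
proof -
  obtain r :: real and M C where r: "0 < r"
    and lim: "\<And>w. norm w < 1 \<Longrightarrow> w \<noteq> 0 \<Longrightarrow> (\<lambda>k. iter k (r * joukowsky w)) \<longlonglongrightarrow> M (r * joukowsky w)"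
    and tr: "\<And>v. typically_real (\<lambda>w. if w = 0 then 0 else - qform (M (r * joukowsky w) - Dinf) v)"
    and b11: "\<And>z k. r < norm z \<Longrightarrow> norm (mscale z (block11 (iter k z)) + mat 1) \<le> C / sqrt (norm z)"
    using iter_limit by blast
  have J: "\<exists>w. norm w < 1 \<and> w \<noteq> 0 \<and> z = r * joukowsky w" if "0 < Im z" for z
  proof -
    have "Im (z / of_real r) \<noteq> 0" using that r by simp
    from joukowsky_surj[OF this] obtain w where "norm w < 1" "w \<noteq> 0" "joukowsky w = z / of_real r" .
    then show ?thesis using r by (intro exI[of _ w]) simp
  qed
  have lim': "(\<lambda>k. iter k z) \<longlonglongrightarrow> M z" if "0 < Im z" for z
    using J[OF that] lim by blast
  have hol: "(\<lambda>z. M z $ i $ j) holomorphic_on upper_half_plane" for i j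
  proof (rule holomorphic_on_matrix_if_qform)
    fix v
    interpret typically_real "\<lambda>w. if w = 0 then 0 else - qform (M (r * joukowsky w) - Dinf) v" by (rule tr)
    obtain g where g: "g holomorphic_on joukowsky ` (ball 0 1 - {0})"
      "\<And>w. w \<in> ball 0 1 - {0} \<Longrightarrow> g (joukowsky w) = w"
      by (rule joukowsky_inverse) blast
    have sub: "(\<lambda>z. z / of_real r) ` upper_half_plane \<subseteq> joukowsky ` (ball 0 1 - {0})"
    proof
      fix y assume "y \<in> (\<lambda>z. z / of_real r) ` upper_half_plane"
      then obtain z where z: "0 < Im z" "y = z / of_real r" by (auto simp: upper_half_plane_def)
      then obtain w where "norm w < 1" "w \<noteq> 0" "z = r * joukowsky w" using J by blast
      then show "y \<in> joukowsky ` (ball 0 1 - {0})" using r z by (intro image_eqI[of _ _ w]) auto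
    qed
    have g1: "(\<lambda>z. g (z / of_real r)) holomorphic_on upper_half_plane"
      by (rule holomorphic_on_compose_gen[OF _ g(1) sub, unfolded o_def]) (use r in \<open>auto intro!: holomorphic_intros\<close>)
    have gb: "g (z / of_real r) \<in> ball 0 1 - {0} \<and> z = r * joukowsky (g (z / of_real r))" if zH: "z \<in> upper_half_plane" for z
    proof -
      obtain w where w: "norm w < 1" "w \<noteq> 0" "z = r * joukowsky w"
        using J[of z] zH by (auto simp: upper_half_plane_def)
      then have "g (z / of_real r) = w" using g(2)[of w] r by simp
      then show ?thesis using w by simp
    qed
    \<comment> \<open>The form of \<open>M\<close> as a holomorphic function on the disc composed
      with the inverse \<open>g\<close>; the values of \<open>g\<close> are nonzero, so the
      exceptional case is never met.\<close>
    have "(\<lambda>z. qform Dinf v - (if g (z / of_real r) = 0 then 0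
        else - qform (M (r * joukowsky (g (z / of_real r))) - Dinf) v)) holomorphic_on upper_half_plane"
      using gb by (intro holomorphic_intros holomorphic_on_compose_gen[OF g1 hol, unfolded o_def]) auto
    then show "(\<lambda>z. qform (M z) v) holomorphic_on upper_half_plane"
      by (rule holomorphic_transform) (use gb in \<open>auto simp: qform_diff\<close>)
  qed
  have eq: "pencil z (M z) ** M z = mat 1" if z: "0 < Im z" for z
  proof -
    have "(\<lambda>k. pencil z (iter k z) ** iter (Suc k) z) \<longlonglongrightarrow> pencil z (M z) ** M z"
      unfolding pencil_def
      by (intro tendsto_matrix_mult tendsto_intros LIMSEQ_Suc[OF lim'[OF z]] lim'[OF z]
          bounded_linear.tendsto[OF mscale_linear_imp_bounded_linear[OF S_linear]])
    moreover have "pencil z (iter k z) ** iter (Suc k) z = mat 1" for k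
      using matrix_inv(1)[OF pencil_invertible[OF iter_admissible[OF z] z]] by simp
    ultimately show ?thesis by (simp only: LIMSEQ_const_iff)
  qed
  have rep: "\<exists>\<mu>. finite_measure \<mu> \<and> sets \<mu> = sets borel \<and> emeasure \<mu> (- {- (2 * r)..2 * r}) = 0 \<and>
      (\<forall>z\<in>upper_half_plane. qform (M z - Dinf) v = (\<integral>x. 1 / (complex_of_real x - z) \<partial>\<mu>))" for v
  proof -
    obtain \<mu> where \<mu>: "finite_measure \<mu>" "sets \<mu> = sets borel" "emeasure \<mu> (- {-2 * r..2 * r}) = 0"
      and f: "\<And>w. norm w < 1 \<Longrightarrow> w \<noteq> 0 \<Longrightarrow>
       - (if w = 0 then 0 else - qform (M (r * joukowsky w) - Dinf) v)
         = (\<integral>x. 1 / (complex_of_real x - of_real r * joukowsky w) \<partial>\<mu>)"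
      using typically_real.cauchy_representation[OF tr r, of v] by blast
    have "qform (M z - Dinf) v = (\<integral>x. 1 / (complex_of_real x - z) \<partial>\<mu>)" if "z \<in> upper_half_plane" for z
      using J[of z] that f by (auto simp: upper_half_plane_def)
    with \<mu> show ?thesis by (intro exI[of _ \<mu>]) auto
  qed
  have adm: "M z \<in> admissible_values" if z: "0 < Im z" for z
    unfolding admissible_values_iff
  proof (intro conjI allI impI)
    fix v
    show "0 \<le> Im (qform (M z) v)"
    proof (rule LIMSEQ_le_const)
      show "(\<lambda>k. Im (qform (iter k z) v)) \<longlonglongrightarrow> Im (qform (M z) v)"
        by (intro tendsto_intros tendsto_qform lim' z)
    qed (use iter_admissible[OF z] in \<open>auto simp: admissible_values_iff\<close>)
  next
    fix u :: "complex ^ 'n" assume u: "u \<noteq> 0"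
    define v where "v = (join u 0 :: complex ^ ('n + 'd))"
    have qv: "qform (W - Dinf) v = qform (block11 W) u" for W
      unfolding v_def qform_join_0 by (simp add: blocks_diff Dinf_def)
    obtain \<mu> where \<mu>: "finite_measure \<mu>" "sets \<mu> = sets borel"
      and f: "\<And>z. 0 < Im z \<Longrightarrow> qform (block11 (M z)) u = (\<integral>x. 1 / (complex_of_real x - z) \<partial>\<mu>)"
      using rep[of v] by (auto simp: qv upper_half_plane_def)
    \<comment> \<open>The limit preserves only the weak inequality. If the form were real at
      \<open>z\<close>, its measure would be null and the form 0 on the half plane, which
      contradicts the smallness of \<open>z\<close> times the block plus 1 far up the axis.\<close>
    show "0 < Im (qform (block11 (M z)) u)"
    proof (rule ccontr)
      assume "\<not> ?thesis"
      then have "Im (\<integral>x. 1 / (complex_of_real x - z) \<partial>\<mu>) \<le> 0" using f[OF z] by simp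
      from cauchy_transform_real_imp_zero[OF \<mu> z this]
      have 0: "qform (block11 (M y)) u = 0" if "0 < Im y" for y using f[OF that] by simp
      obtain q where q: "0 < q" "\<And>W :: 'n cmat. norm (qform W u) \<le> norm W * q"
        using bounded_linear.pos_bounded[OF bounded_linear_qform] by blast
      have nu: "0 < (norm u)\<^sup>2" using u by simp
      \<comment> \<open>With a vanishing form the left side below is
        \<open>(norm u)\<^sup>2\<close>; this \<open>y\<close> makes the bound
        \<open>\<bar>C\<bar> / sqrt y * q\<close> smaller than that, and \<open>r + 1\<close> keeps
        the point in the region where the bound holds.\<close>
      define y where "y = r + 1 + (q * \<bar>C\<bar> / (norm u)\<^sup>2)\<^sup>2"
      have y: "r < y" "0 < y" using r by (auto simp: y_def add_pos_nonneg intro: add_strict_increasing2 add_nonneg_pos)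
      let ?z = "\<i> * complex_of_real y"
      have Imz: "0 < Im ?z" using y by simp
      have "norm (mscale ?z (block11 (M ?z)) + mat 1) \<le> C / sqrt y"
      proof (rule LIMSEQ_le_const2)
        show "(\<lambda>k. norm (mscale ?z (block11 (iter k ?z)) + mat 1)) \<longlonglongrightarrow> norm (mscale ?z (block11 (M ?z)) + mat 1)"
          by (intro tendsto_intros tendsto_mscale tendsto_block11 lim' Imz)
        show "\<exists>N. \<forall>k\<ge>N. norm (mscale ?z (block11 (iter k ?z)) + mat 1) \<le> C / sqrt y"
          using b11[of ?z] y by (auto simp: norm_mult)
      qed
      then have "norm (mscale ?z (block11 (M ?z)) + mat 1) * q \<le> C / sqrt y * q"
        using q(1) by (intro mult_right_mono) auto
      then have "norm (qform (mscale ?z (block11 (M ?z)) + mat 1) u) \<le> C / sqrt y * q"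
        using q(2) order_trans by blast
      moreover have "qform (mscale ?z (block11 (M ?z)) + mat 1) u = of_real ((norm u)\<^sup>2)"
        by (simp only: qform_add qform_mscale 0[OF Imz] qform_mat) simp
      ultimately have "(norm u)\<^sup>2 \<le> C / sqrt y * q"
        by (simp only: norm_of_real abs_of_pos[OF nu])
      also have "\<dots> \<le> \<bar>C\<bar> / sqrt y * q"
        using q(1) y by (intro mult_right_mono divide_right_mono) auto
      finally have "(norm u)\<^sup>2 * sqrt y \<le> q * \<bar>C\<bar>" using y by (simp add: field_simps)
      then have "sqrt y \<le> q * \<bar>C\<bar> / (norm u)\<^sup>2" using nu by (simp add: pos_le_divide_eq mult.commute)
      then have "(sqrt y)\<^sup>2 \<le> (q * \<bar>C\<bar> / (norm u)\<^sup>2)\<^sup>2" using y by (intro power_mono) auto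
      then show False using y r by (simp add: y_def)
    qed
  qed
  show ?thesis
    using hol eq rep adm
    by (intro exI[of _ "2 * r"] exI[of _ M]) (auto simp: upper_half_plane_def)
qed

end

section \<open>Asymptotics and uniqueness of solutions\<close>

context matrix_dyson
begin

definition solves :: "complex \<Rightarrow> ('n + 'd) cmat \<Rightarrow> bool" where
  "solves z W \<longleftrightarrow> W \<in> admissible_values \<and> pencil z W ** W = mat 1"

text \<open>The imaginary part of the equation gives
  \<open>Im z * (norm ?x)\<^sup>2 \<le> Im (qform (block11 W) u)\<close>; Cauchy-Schwarz bounds the
  right side, and one factor \<open>norm ?x\<close> cancels.\<close>

lemma block11_bound:
  assumes W: "solves z W" and z: "0 < Im z"
  shows "norm (block11 W *v u) \<le> norm u / Im z"
proof -
  let ?x = "block11 W *v u"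
  let ?v = "join u 0 :: complex ^ ('n + 'd)"
  have A: "W \<in> admissible_values" and inv: "pencil z W ** W = mat 1" using W by (auto simp: solves_def)
  have "qform W ?v = cnj (qform (pencil z W) (W *v ?v))"
    using qform_matrix_inv[of "pencil z W" ?v] matrix_inv_eq[OF inv] by simp
  then have "Im (qform W ?v) = Im (qform (S W) (W *v ?v)) + Im z * (norm (top (W *v ?v)))\<^sup>2"
    by (simp add: Im_qform_pencil)
  moreover have "0 \<le> Im (qform (S W) (W *v ?v))"
    using A by (intro S_Im_nonneg) (simp add: admissible_values_iff)
  moreover have "top (W *v ?v) = ?x" by (simp add: top_bot_mult)
  ultimately have "Im z * (norm ?x)\<^sup>2 \<le> Im (qform (block11 W) u)"
    by (simp add: qform_join_0)
  also have "\<dots> \<le> norm (cinner u ?x)" unfolding qform_cinner by (rule abs_Im_le_cmod[THEN order_trans[OF abs_ge_self]])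
  also have "\<dots> \<le> norm u * norm ?x" by (rule cinner_bound)
  finally have le: "(Im z * norm ?x) * norm ?x \<le> norm u * norm ?x" by (simp add: power2_eq_square mult.assoc)
  have "Im z * norm ?x \<le> norm u"
  proof (cases "norm ?x = 0")
    case False then show ?thesis using mult_right_le_imp_le[OF le] by simp
  qed simp
  then show ?thesis using z by (simp add: pos_le_divide_eq mult.commute)
qed

definition top_left :: "'n cmat \<Rightarrow> ('n + 'd) cmat" where "top_left X = block X 0 0 0"

lemma blocks_S_top_left:
  "block12 (S W) = block12 (S (top_left (block11 W)))"
  "block21 (S W) = block21 (S (top_left (block11 W)))"
  "block22 (S W) = block22 (S (top_left (block11 W)))"
  using S_rest[of W "top_left (block11 W)"] by (simp_all add: top_left_def)

text \<open>\<open>block21 H ** block12 H\<close> comes from the mean of B and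
  \<open>block22 (S Lam)\<close> is its covariance, so in the application their sum is the
  expectation of B times its transpose.\<close>

definition total_mass :: "('n + 'd) cmat" where
  "total_mass = block (mat 1) (- (block12 H ** Qi)) (- (Qi ** block21 H))
     (Qi ** (block21 H ** block12 H + block22 (S Lam)) ** Qi)"

section \<open>Asymptotics of an arbitrary solution along the imaginary axis\<close>

context
  fixes M :: "complex \<Rightarrow> ('n + 'd) cmat"
  assumes M: "\<And>z. 0 < Im z \<Longrightarrow> solves z (M z)"
begin

abbreviation (input) ray :: "real \<Rightarrow> complex" where "ray y \<equiv> \<i> * complex_of_real y"

text \<open>Immediate from \<open>block11_bound\<close>; the limits of all other blocks are
  bootstrapped from this one.\<close>

lemma M_block11: "((\<lambda>y. block11 (M (ray y))) \<longlongrightarrow> 0) at_top"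
proof (intro vec_tendstoI)
  fix i j
  have "eventually (\<lambda>y. norm (block11 (M (ray y)) $ i $ j) \<le> 1 / y) at_top"
    using eventually_gt_at_top[of 0]
  proof eventually_elim
    case (elim y)
    have "norm (block11 (M (ray y)) $ i $ j) \<le> norm (block11 (M (ray y)) *v axis j 1)"
      unfolding matrix_vector_mult_axis[symmetric] by (rule Finite_Cartesian_Product.norm_nth_le)
    also have "\<dots> \<le> 1 / y"
      using block11_bound[OF M, of "ray y" "axis j 1"] elim by simp
    finally show ?case .
  qed
  moreover have "((\<lambda>y::real. 1 / y) \<longlongrightarrow> 0) at_top"
    by (intro tendsto_divide_0[OF tendsto_const] filterlim_at_top_imp_at_infinity filterlim_ident)
  ultimately have "((\<lambda>y. block11 (M (ray y)) $ i $ j) \<longlongrightarrow> 0) at_top"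
    by (rule Lim_null_comparison)
  then show "((\<lambda>y. block11 (M (ray y)) $ i $ j) \<longlongrightarrow> (0 :: 'n cmat) $ i $ j) at_top" by simp
qed

lemma tendsto_S_top_left:
  assumes "(f \<longlongrightarrow> X) F"
  shows "((\<lambda>y. S (top_left (f y))) \<longlongrightarrow> S (top_left X)) F"
  unfolding top_left_def
  by (intro bounded_linear.tendsto[OF mscale_linear_imp_bounded_linear[OF S_linear]] tendsto_block assms tendsto_const)

lemma S_top_left_0: "S (top_left 0) = 0"
proof -
  have "top_left 0 = 0" by (simp add: top_left_def vec_eq_iff all_Plus)
  then show ?thesis using S_mscale[of 0 0] by simp
qed

abbreviation (input) t12 where "t12 y \<equiv> block12 H - block12 (S (M (ray y)))"
abbreviation (input) t21 where "t21 y \<equiv> block21 H - block21 (S (M (ray y)))"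
abbreviation (input) t22 where "t22 y \<equiv> block22 H - block22 (S (M (ray y)))"

text \<open>These blocks depend on \<open>M\<close> through its upper left block alone. The upper
  left block of \<open>S\<close> must wait until the limit of all of \<open>M\<close> is
  known.\<close>

lemma S_rest_tendsto:
  "((\<lambda>y. block12 (S (M (ray y)))) \<longlongrightarrow> 0) at_top"
  "((\<lambda>y. block21 (S (M (ray y)))) \<longlongrightarrow> 0) at_top"
  "((\<lambda>y. block22 (S (M (ray y)))) \<longlongrightarrow> 0) at_top"
proof -
  note t = tendsto_S_top_left[OF M_block11, unfolded S_top_left_0]
  have z: "block12 0 = (0 :: complex ^ 'd ^ 'n)" "block21 0 = (0 :: complex ^ 'n ^ 'd)" "block22 0 = (0 :: 'd cmat)"
    by (simp_all add: vec_eq_iff block_defs)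
  show "((\<lambda>y. block12 (S (M (ray y)))) \<longlongrightarrow> 0) at_top"
    "((\<lambda>y. block21 (S (M (ray y)))) \<longlongrightarrow> 0) at_top"
    "((\<lambda>y. block22 (S (M (ray y)))) \<longlongrightarrow> 0) at_top"
    using tendsto_block12[OF t] tendsto_block21[OF t] tendsto_block22[OF t]
    unfolding z blocks_S_top_left[symmetric] .
qed

lemma t_tendsto:
  "(t12 \<longlongrightarrow> block12 H) at_top" "(t21 \<longlongrightarrow> block21 H) at_top" "(t22 \<longlongrightarrow> block22 H) at_top"
  using tendsto_diff[OF tendsto_const S_rest_tendsto(1)] tendsto_diff[OF tendsto_const S_rest_tendsto(2)]
    tendsto_diff[OF tendsto_const S_rest_tendsto(3)] by fastforce+

lemma t22_inv: "((\<lambda>y. matrix_inv (t22 y)) \<longlongrightarrow> Qi) at_top" "eventually (\<lambda>y. invertible (t22 y)) at_top"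
  unfolding Qi_def by (rule tendsto_matrix_inv[OF t_tendsto(3) H22])+

text \<open>Block entries of the equation, solved for the blocks of \<open>M\<close>. The formula
  for \<open>block12\<close> uses the product in reverse order,
  \<open>M z ** pencil z (M z)\<close>, so that \<open>block11\<close> stands on the left. In the
  last relation \<open>Qi\<close> is subtracted so that each term on the right has a factor of order
  1/z.\<close>

lemma block_relations:
  assumes y: "0 < y" and inv: "invertible (t22 y)"
  shows "block21 (M (ray y)) = - (matrix_inv (t22 y) ** (t21 y ** block11 (M (ray y))))"
    "block12 (M (ray y)) = - ((block11 (M (ray y)) ** t12 y) ** matrix_inv (t22 y))"
    "block22 (M (ray y)) = matrix_inv (t22 y) ** (mat 1 - t21 y ** block12 (M (ray y)))"
    "mscale (ray y) (block11 (M (ray y))) = (block11 H - block11 (S (M (ray y)))) ** block11 (M (ray y))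
       + t12 y ** block21 (M (ray y)) - mat 1"
    "block22 (M (ray y)) - Qi = Qi ** block22 (S (M (ray y))) ** block22 (M (ray y)) - Qi ** t21 y ** block12 (M (ray y))"
proof -
  let ?W = "M (ray y)"
  have TW: "pencil (ray y) ?W ** ?W = mat 1" using M[of "ray y"] y by (simp add: solves_def)
  then have WT: "?W ** pencil (ray y) ?W = mat 1" by (simp only: matrix_left_right_inverse)
  have blocks: "block12 (pencil (ray y) ?W) = t12 y" "block21 (pencil (ray y) ?W) = t21 y" "block22 (pencil (ray y) ?W) = t22 y"
    "block11 (pencil (ray y) ?W) = block11 H - block11 (S ?W) - mat (ray y)"
    by (simp_all add: pencil_def blocks_diff blocks_mscale blocks_Lam mscale_mat)
  note * = arg_cong[OF TW, of block21, unfolded blocks_mult blocks mat_blocks]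
    arg_cong[OF WT, of block12, unfolded blocks_mult blocks mat_blocks]
    arg_cong[OF TW, of block22, unfolded blocks_mult blocks mat_blocks]
    arg_cong[OF TW, of block11, unfolded blocks_mult blocks mat_blocks]
  have left: "matrix_inv (t22 y) ** (t22 y ** X) = X" for X :: "complex ^ 'x ^ 'd"
    by (simp add: matrix_mul_assoc matrix_inv(2)[OF inv])
  have right: "(X ** t22 y) ** matrix_inv (t22 y) = X" for X :: "complex ^ 'd ^ 'x"
    by (simp add: matrix_mul_assoc[symmetric] matrix_inv(1)[OF inv])
  have "t22 y ** block21 ?W = - (t21 y ** block11 ?W)"
    using *(1) by (simp add: add_eq_0_iff)
  then show "block21 ?W = - (matrix_inv (t22 y) ** (t21 y ** block11 ?W))"
    using left[of "block21 ?W"] by (metis matrix_mult_minus(2))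
  have "block12 ?W ** t22 y = - (block11 ?W ** t12 y)"
    using *(2) by (simp add: add_eq_0_iff)
  then show "block12 ?W = - ((block11 ?W ** t12 y) ** matrix_inv (t22 y))"
    using right[of "block12 ?W"] by (metis matrix_mult_minus(1))
  have e: "t22 y ** block22 ?W = mat 1 - t21 y ** block12 ?W"
    using *(3) by (simp add: algebra_simps)
  then show "block22 ?W = matrix_inv (t22 y) ** (mat 1 - t21 y ** block12 ?W)"
    using left[of "block22 ?W"] by metis
  have "mat (ray y) ** block11 ?W = (block11 H - block11 (S ?W)) ** block11 ?W + t12 y ** block21 ?W - mat 1"
    using *(4) by (simp add: matrix_mult_diff_distrib) (simp add: algebra_simps)
  then show "mscale (ray y) (block11 ?W) = (block11 H - block11 (S ?W)) ** block11 ?W + t12 y ** block21 ?W - mat 1"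
    by (simp only: mat_mult)
  have "block22 H ** block22 ?W = mat 1 - t21 y ** block12 ?W + block22 (S ?W) ** block22 ?W"
    using e by (simp add: matrix_mult_diff_distrib) (simp add: algebra_simps)
  then have "Qi ** (block22 H ** block22 ?W) = Qi ** (mat 1 - t21 y ** block12 ?W + block22 (S ?W) ** block22 ?W)"
    by simp
  moreover have "Qi ** (block22 H ** block22 ?W) = block22 ?W"
    by (simp add: matrix_mul_assoc Qi)
  moreover have "Qi ** (mat 1 - t21 y ** block12 ?W + block22 (S ?W) ** block22 ?W)
      = Qi - Qi ** t21 y ** block12 ?W + Qi ** block22 (S ?W) ** block22 ?W"
    by (simp only: matrix_mult_add_distrib matrix_mult_diff_distrib matrix_mul_assoc matrix_mul_rid)
  ultimately show "block22 ?W - Qi = Qi ** block22 (S ?W) ** block22 ?W - Qi ** t21 y ** block12 ?W"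
    by (simp add: algebra_simps)
qed

lemma eventually_block_relations: "eventually (\<lambda>y. 0 < y \<and> invertible (t22 y)) at_top"
  using eventually_gt_at_top[of 0] t22_inv(2) by eventually_elim simp

lemma M_tendsto:
  "((\<lambda>y. block21 (M (ray y))) \<longlongrightarrow> 0) at_top" "((\<lambda>y. block12 (M (ray y))) \<longlongrightarrow> 0) at_top"
  "((\<lambda>y. block22 (M (ray y))) \<longlongrightarrow> Qi) at_top" "((\<lambda>y. M (ray y)) \<longlongrightarrow> Dinf) at_top"
proof -
  have "((\<lambda>y. - (matrix_inv (t22 y) ** (t21 y ** block11 (M (ray y))))) \<longlongrightarrow> - (Qi ** (block21 H ** 0))) at_top"
    by (intro tendsto_minus tendsto_matrix_mult t22_inv t_tendsto M_block11)
  then have 21: "((\<lambda>y. block21 (M (ray y))) \<longlongrightarrow> - (Qi ** (block21 H ** 0))) at_top"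
    by (rule Lim_transform_eventually) (use eventually_block_relations in eventually_elim, use block_relations(1) in simp)
  then show m21: "((\<lambda>y. block21 (M (ray y))) \<longlongrightarrow> 0) at_top" by simp
  have "((\<lambda>y. - ((block11 (M (ray y)) ** t12 y) ** matrix_inv (t22 y))) \<longlongrightarrow> - ((0 ** block12 H) ** Qi)) at_top"
    by (intro tendsto_minus tendsto_matrix_mult t22_inv t_tendsto M_block11)
  then have "((\<lambda>y. block12 (M (ray y))) \<longlongrightarrow> - ((0 ** block12 H) ** Qi)) at_top"
    by (rule Lim_transform_eventually) (use eventually_block_relations in eventually_elim, use block_relations(2) in simp)
  then show m12: "((\<lambda>y. block12 (M (ray y))) \<longlongrightarrow> 0) at_top" by simp
  have "((\<lambda>y. matrix_inv (t22 y) ** (mat 1 - t21 y ** block12 (M (ray y)))) \<longlongrightarrow> Qi ** (mat 1 - block21 H ** 0)) at_top"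
    by (intro tendsto_diff tendsto_const tendsto_matrix_mult t22_inv t_tendsto m12)
  then have "((\<lambda>y. block22 (M (ray y))) \<longlongrightarrow> Qi ** (mat 1 - block21 H ** 0)) at_top"
    by (rule Lim_transform_eventually) (use eventually_block_relations in eventually_elim, use block_relations(3) in simp)
  then show m22: "((\<lambda>y. block22 (M (ray y))) \<longlongrightarrow> Qi) at_top" by simp
  show "((\<lambda>y. M (ray y)) \<longlongrightarrow> Dinf) at_top"
    using tendsto_block[OF M_block11 m12 m21 m22] by (simp add: block_blocks Dinf_def)
qed

text \<open>Multiplying the relations by \<open>z\<close>, the upper left block comes first and
  feeds the off-diagonal ones, and these the lower right one. The sign of the limit agrees with
  \<open>z / (x - z)\<close> tending to -1.\<close>

lemma scaled_M_tendsto: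
  "((\<lambda>y. mscale (ray y) (block11 (M (ray y)))) \<longlongrightarrow> mat (- 1)) at_top"
  "((\<lambda>y. mscale (ray y) (block21 (M (ray y)))) \<longlongrightarrow> Qi ** block21 H) at_top"
  "((\<lambda>y. mscale (ray y) (block12 (M (ray y)))) \<longlongrightarrow> block12 H ** Qi) at_top"
  "((\<lambda>y. mscale (ray y) (M (ray y) - Dinf)) \<longlongrightarrow> - total_mass) at_top"
proof -
  note S_tendsto = bounded_linear.tendsto[OF mscale_linear_imp_bounded_linear[OF S_linear]]
  have "((\<lambda>y. (block11 H - block11 (S (M (ray y)))) ** block11 (M (ray y)) + t12 y ** block21 (M (ray y)) - mat 1)
     \<longlongrightarrow> (block11 H - block11 (S Dinf)) ** 0 + block12 H ** 0 - mat 1) at_top"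
    by (intro tendsto_diff tendsto_add tendsto_matrix_mult tendsto_const tendsto_block11 S_tendsto M_tendsto M_block11 t_tendsto)
  then have "((\<lambda>y. mscale (ray y) (block11 (M (ray y)))) \<longlongrightarrow> (block11 H - block11 (S Dinf)) ** 0 + block12 H ** 0 - mat 1) at_top"
    by (rule Lim_transform_eventually) (use eventually_block_relations in eventually_elim, use block_relations(4) in simp)
  moreover have "- mat 1 = (mat (- 1) :: 'n cmat)" by (simp add: vec_eq_iff mat_def)
  ultimately show 11: "((\<lambda>y. mscale (ray y) (block11 (M (ray y)))) \<longlongrightarrow> mat (- 1)) at_top" by simp
  have m: "mscale c (- A) = - mscale c A" for c and A :: "complex ^ 'x ^ 'y" by (simp add: vec_eq_iff)
  have n: "mscale c (A - B) = mscale c A - mscale c B" for c and A B :: "complex ^ 'x ^ 'y"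
    by (simp add: vec_eq_iff algebra_simps)
  have "((\<lambda>y. - (matrix_inv (t22 y) ** (t21 y ** mscale (ray y) (block11 (M (ray y)))))) \<longlongrightarrow> - (Qi ** (block21 H ** mat (- 1)))) at_top"
    by (intro tendsto_minus tendsto_matrix_mult t22_inv t_tendsto 11)
  then have "((\<lambda>y. mscale (ray y) (block21 (M (ray y)))) \<longlongrightarrow> - (Qi ** (block21 H ** mat (- 1)))) at_top"
    by (rule Lim_transform_eventually) (use eventually_block_relations in eventually_elim,
      use block_relations(1) in \<open>simp add: m mscale_mult_right\<close>)
  then show 21: "((\<lambda>y. mscale (ray y) (block21 (M (ray y)))) \<longlongrightarrow> Qi ** block21 H) at_top"
    by (simp add: mat_mult mscale_minus_1 matrix_mult_minus)
  have "((\<lambda>y. - ((mscale (ray y) (block11 (M (ray y))) ** t12 y) ** matrix_inv (t22 y))) \<longlongrightarrow> - ((mat (- 1) ** block12 H) ** Qi)) at_top"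
    by (intro tendsto_minus tendsto_matrix_mult t22_inv t_tendsto 11)
  then have "((\<lambda>y. mscale (ray y) (block12 (M (ray y)))) \<longlongrightarrow> - ((mat (- 1) ** block12 H) ** Qi)) at_top"
    by (rule Lim_transform_eventually) (use eventually_block_relations in eventually_elim,
      use block_relations(2) in \<open>simp add: m mscale_mult_left\<close>)
  then show 12: "((\<lambda>y. mscale (ray y) (block12 (M (ray y)))) \<longlongrightarrow> block12 H ** Qi) at_top"
    by (simp add: mat_mult mscale_minus_1 matrix_mult_minus)
  \<comment> \<open>By linearity the factor \<open>z\<close> moves into the argument of
    \<open>S\<close>, where it meets the block that decays like 1/z.\<close>
  have s: "mscale (ray y) (block22 (S (M (ray y)))) = block22 (S (top_left (mscale (ray y) (block11 (M (ray y))))))" for y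
  proof -
    have "top_left (mscale (ray y) (block11 (M (ray y)))) = mscale (ray y) (top_left (block11 (M (ray y))))"
      by (simp add: top_left_def mscale_block)
    then show ?thesis by (subst blocks_S_top_left(3)) (simp add: S_mscale blocks_mscale)
  qed
  have tl: "top_left (mat (- 1)) = mscale (- 1) Lam"
    by (simp add: top_left_def Lam_def mscale_block mscale_mat)
  have sl: "block22 (S (top_left (mat (- 1)))) = - block22 (S Lam)"
    unfolding tl S_mscale blocks_mscale by (rule mscale_minus_1)
  have "((\<lambda>y. Qi ** mscale (ray y) (block22 (S (M (ray y)))) ** block22 (M (ray y)) - Qi ** t21 y ** mscale (ray y) (block12 (M (ray y))))
      \<longlongrightarrow> Qi ** (- block22 (S Lam)) ** Qi - Qi ** block21 H ** (block12 H ** Qi)) at_top"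
    unfolding s sl[symmetric]
    by (intro tendsto_diff tendsto_matrix_mult tendsto_const tendsto_block22 tendsto_S_top_left M_tendsto t_tendsto 11 12)
  then have 22: "((\<lambda>y. mscale (ray y) (block22 (M (ray y)) - Qi))
      \<longlongrightarrow> Qi ** (- block22 (S Lam)) ** Qi - Qi ** block21 H ** (block12 H ** Qi)) at_top"
    by (rule Lim_transform_eventually) (use eventually_block_relations in eventually_elim,
      use block_relations(5) in \<open>simp add: n mscale_mult_left mscale_mult_right\<close>)
  have fin: "Qi ** (- block22 (S Lam)) ** Qi - Qi ** block21 H ** (block12 H ** Qi)
     = - (Qi ** (block21 H ** block12 H + block22 (S Lam)) ** Qi)"
    by (simp add: matrix_mult_minus matrix_mult_add_distrib matrix_mul_assoc)
  have "mscale (ray y) (M (ray y) - Dinf) = block (mscale (ray y) (block11 (M (ray y)))) (mscale (ray y) (block12 (M (ray y))))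
      (mscale (ray y) (block21 (M (ray y)))) (mscale (ray y) (block22 (M (ray y)) - Qi))" for y
    by (simp add: block_eq_iff blocks_mscale blocks_diff Dinf_def)
  moreover have "- total_mass = block (mat (- 1)) (block12 H ** Qi) (Qi ** block21 H)
      (- (Qi ** (block21 H ** block12 H + block22 (S Lam)) ** Qi))"
    by (simp add: total_mass_def vec_eq_iff all_Plus mat_def)
  ultimately show "((\<lambda>y. mscale (ray y) (M (ray y) - Dinf)) \<longlongrightarrow> - total_mass) at_top"
    using tendsto_block[OF 11 12 21 22] by (simp only: fin)
qed

text \<open>The off-diagonal blocks are of order 1/z and vanish even after multiplication by the
  square root of \<open>z\<close>. It brings every solution, once rescaled, close to the start of
  the iteration.\<close>

lemma rescaled_M_tendsto:
  "((\<lambda>y. rescale (csqrt (ray y)) ** M (ray y) ** rescale (csqrt (ray y))) \<longlongrightarrow> D0i) at_top"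
proof -
  have c: "csqrt (ray y) * csqrt (ray y) = ray y" for y
    using power2_csqrt[of "ray y"] by (simp only: power2_eq_square)
  have "((\<lambda>y. 1 / sqrt y) \<longlongrightarrow> 0) at_top"
    by (intro tendsto_divide_0[OF tendsto_const] filterlim_at_top_imp_at_infinity sqrt_at_top)
  then have i: "((\<lambda>y. 1 / csqrt (ray y)) \<longlongrightarrow> 0) at_top"
    by (rule Lim_null_comparison[rotated]) (auto simp: norm_divide norm_csqrt norm_mult intro!: eventually_mono[OF eventually_gt_at_top[of 0]])
  have e: "mscale (1 / csqrt (ray y)) (mscale (ray y) X) = mscale (csqrt (ray y)) X" if "0 < y" for y and X :: "complex ^ 'x ^ 'y"
  proof -
    have "csqrt (ray y) \<noteq> 0" using that by simp
    then have "1 / csqrt (ray y) * ray y = csqrt (ray y)"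
      by (subst c[symmetric]) (simp add: field_simps)
    then show ?thesis by (simp only: mscale_mscale)
  qed
  have 12: "((\<lambda>y. mscale (csqrt (ray y)) (block12 (M (ray y)))) \<longlongrightarrow> 0) at_top"
    by (rule Lim_transform_eventually[OF tendsto_mscale[OF i scaled_M_tendsto(3), unfolded mscale_0]])
       (use eventually_gt_at_top[of 0] in eventually_elim, simp only: e)
  have 21: "((\<lambda>y. mscale (csqrt (ray y)) (block21 (M (ray y)))) \<longlongrightarrow> 0) at_top"
    by (rule Lim_transform_eventually[OF tendsto_mscale[OF i scaled_M_tendsto(2), unfolded mscale_0]])
       (use eventually_gt_at_top[of 0] in eventually_elim, simp only: e)
  have "rescale (csqrt (ray y)) ** M (ray y) ** rescale (csqrt (ray y)) = block (mscale (ray y) (block11 (M (ray y))))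
      (mscale (csqrt (ray y)) (block12 (M (ray y)))) (mscale (csqrt (ray y)) (block21 (M (ray y)))) (block22 (M (ray y)))" for y
    by (simp only: block_eq_iff blocks_rescale c blocks_block)
  then show ?thesis
    using tendsto_block[OF scaled_M_tendsto(1) 12 21 M_tendsto(3)] by (simp add: D0i_def)
qed

end

text \<open>Rescaled solutions are fixed points of the map that \<open>scaled_contraction\<close>
  contracts by 1/2, and far up the axis any two of them lie in its ball.\<close>

lemma unique_aux:
  assumes M: "\<And>z. 0 < Im z \<Longrightarrow> solves z (M z)" and V: "\<And>z. 0 < Im z \<Longrightarrow> solves z (V z)"
  shows "eventually (\<lambda>y. M (\<i> * complex_of_real y) = V (\<i> * complex_of_real y)) at_top"
proof -
  obtain s0 where s0: "0 < s0"
    and contr: "\<And>s V W. norm s < s0 \<Longrightarrow> norm V \<le> 2 * norm D0i \<Longrightarrow> norm W \<le> 2 * norm D0i \<Longrightarrow>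
     norm (matrix_inv (scaled s V) - matrix_inv (scaled s W)) \<le> 1 / 2 * norm (V - W)"
    using scaled_contraction by blast
  \<comment> \<open>Makes the limit \<open>D0i\<close> an interior point of the ball of radius
    \<open>2 * norm D0i\<close>, so that solutions eventually enter it.\<close>
  have "D0i \<noteq> 0"
  proof
    assume "D0i = 0"
    then have "D0i $ Inl i $ Inl i = 0" for i by simp
    then show False by (simp add: D0i_def mat_def)
  qed
  then have D: "norm D0i < 2 * norm D0i" by simp
  have small: "eventually (\<lambda>y. norm (rescale (csqrt (\<i> * complex_of_real y)) ** W (\<i> * complex_of_real y) ** rescale (csqrt (\<i> * complex_of_real y))) < 2 * norm D0i) at_top"
    if "\<And>z. 0 < Im z \<Longrightarrow> solves z (W z)" for W
    by (rule order_tendstoD(2)[OF tendsto_norm[OF rescaled_M_tendsto[OF that]] D])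
  show ?thesis
    using small[OF M, simplified] small[OF V, simplified] eventually_gt_at_top[of "1 / s0\<^sup>2"]
  proof eventually_elim
    case (elim y)
    define z where "z = \<i> * complex_of_real y"
    define c where "c = csqrt z"
    have y: "0 < y" using elim(3) s0 by (meson less_trans zero_less_divide_1_iff zero_less_power)
    have z0: "z \<noteq> 0" "0 < Im z" using y by (auto simp: z_def)
    have cc: "c * c = z" using power2_csqrt[of z] by (simp only: power2_eq_square c_def)
    then have c0: "c \<noteq> 0" using z0 by auto
    have nc: "norm (1 / c) < s0"
    proof -
      have "1 / s0 = sqrt (1 / s0\<^sup>2)" using s0 by (simp add: real_sqrt_divide)
      also have "\<dots> < sqrt y" using elim(3) by (intro real_sqrt_less_mono)
      finally have "1 / sqrt y < s0" using s0 y by (simp add: field_simps)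
      then show ?thesis using y by (simp add: norm_divide norm_csqrt c_def z_def norm_mult)
    qed
    have PP: "rescale a ** rescale b = rescale (a * b)" for a b
      by (simp add: rescale_def block_mult mat_mult mscale_mat mult.commute)
    have P1: "rescale 1 = mat 1" by (simp add: rescale_def mat_block[of 1])
    have fixed: "matrix_inv (scaled (1 / c) (rescale c ** W ** rescale c)) = rescale c ** W ** rescale c" if "solves z W" for W
    proof (rule matrix_inv_eq)
      have cancel: "rescale (1 / c) ** (rescale c ** W ** rescale c) ** rescale (1 / c) = W"
      proof -
        have "rescale (1 / c) ** (rescale c ** W ** rescale c) ** rescale (1 / c) = (rescale (1 / c) ** rescale c) ** W ** (rescale c ** rescale (1 / c))"
          by (simp only: matrix_mul_assoc)
        then show ?thesis using c0 by (simp add: PP P1)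
      qed
      have "(1 / c) * (1 / c) * z = 1" using cc c0 z0(1) by (simp add: field_simps)
      from rescale_pencil[OF this, of "rescale c ** W ** rescale c"]
      have "scaled (1 / c) (rescale c ** W ** rescale c) ** (rescale c ** W ** rescale c)
          = rescale (1 / c) ** pencil z W ** rescale (1 / c) ** (rescale c ** W ** rescale c)"
        by (simp only: cancel)
      also have "\<dots> = rescale (1 / c) ** (pencil z W ** (rescale (1 / c) ** rescale c) ** W) ** rescale c"
        by (simp only: matrix_mul_assoc)
      also have "\<dots> = mat 1"
        using that c0 by (simp add: PP P1 solves_def)
      finally show "scaled (1 / c) (rescale c ** W ** rescale c) ** (rescale c ** W ** rescale c) = mat 1" .
    qed
    have "norm (rescale c ** M z ** rescale c - rescale c ** V z ** rescale c) \<le> 1 / 2 * norm (rescale c ** M z ** rescale c - rescale c ** V z ** rescale c)"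
      using contr[OF nc, of "rescale c ** M z ** rescale c" "rescale c ** V z ** rescale c"] elim(1,2)
        fixed[OF M[OF z0(2)]] fixed[OF V[OF z0(2)]] by (simp add: z_def c_def)
    then have "rescale c ** M z ** rescale c = rescale c ** V z ** rescale c" by simp
    then have "rescale (1 / c) ** (rescale c ** M z ** rescale c) ** rescale (1 / c) = rescale (1 / c) ** (rescale c ** V z ** rescale c) ** rescale (1 / c)"
      by simp
    moreover have "rescale (1 / c) ** (rescale c ** W ** rescale c) ** rescale (1 / c) = W" for W
    proof -
      have "rescale (1 / c) ** (rescale c ** W ** rescale c) ** rescale (1 / c) = (rescale (1 / c) ** rescale c) ** W ** (rescale c ** rescale (1 / c))"
        by (simp only: matrix_mul_assoc)
      then show ?thesis using c0 by (simp add: PP P1)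
    qed
    ultimately show ?case by (simp add: z_def)
  qed
qed

lemma uniqueness:
  assumes M: "\<And>z. 0 < Im z \<Longrightarrow> solves z (M z)" "\<And>i j. (\<lambda>z. M z $ i $ j) holomorphic_on upper_half_plane"
    and V: "\<And>z. 0 < Im z \<Longrightarrow> solves z (V z)" "\<And>i j. (\<lambda>z. V z $ i $ j) holomorphic_on upper_half_plane"
    and z: "0 < Im z"
  shows "M z = V z"
proof -
  obtain N where N: "\<And>y. N \<le> y \<Longrightarrow> M (\<i> * complex_of_real y) = V (\<i> * complex_of_real y)"
    using unique_aux[OF M(1) V(1)] unfolding eventually_at_top_linorder by blast
  define m where "m = max N 1"
  \<comment> \<open>A segment of the axis: being connected with more than one point, it has its end
    point as a limit point, as the identity theorem requires.\<close>
  define T where "T = (\<lambda>y. \<i> * complex_of_real y) ` {m..m + 1}"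
  have "connected T" unfolding T_def by (intro connected_continuous_image continuous_intros) simp
  moreover have mT: "\<i> * complex_of_real m \<in> T" "\<i> * complex_of_real (m + 1) \<in> T" unfolding T_def by (intro image_eqI[OF refl], simp)+
  moreover have "T \<noteq> {x}" for x
  proof
    assume "T = {x}"
    then have "\<i> * complex_of_real (m + 1) = \<i> * complex_of_real m" using mT by simp
    then show False by (simp add: complex_eq_iff)
  qed
  ultimately have lp: "(\<i> * complex_of_real m) islimpt T" by (intro connected_imp_perfect)
  have H: "open upper_half_plane" "connected upper_half_plane"
    unfolding upper_half_plane_def by (rule open_halfspace_Im_gt, rule convex_connected, rule convex_halfspace_Im_gt)
  have "M z $ i $ j - V z $ i $ j = 0" for i j
  proof (rule analytic_continuation[where f = "\<lambda>z. M z $ i $ j - V z $ i $ j" and w = z, OF _ H _ _ lp])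
    show "(\<lambda>z. M z $ i $ j - V z $ i $ j) holomorphic_on upper_half_plane"
      by (intro holomorphic_intros M V)
    show "T \<subseteq> upper_half_plane" "\<i> * complex_of_real m \<in> upper_half_plane" "z \<in> upper_half_plane"
      using z by (auto simp: T_def upper_half_plane_def m_def)
    show "M w $ i $ j - V w $ i $ j = 0" if "w \<in> T" for w
      using that N by (auto simp: T_def m_def)
  qed
  then show ?thesis by (simp add: vec_eq_iff)
qed

end

section \<open>The matrix-valued measure\<close>

text \<open>The transforms of the separately chosen measures are forms of one matrix
  \<open>N z\<close> and hence satisfy the polarization identity; \<open>measure_relation\<close>
  carries it over to the measures.\<close>

lemma polar_measure_relation:
  fixes N :: "complex \<Rightarrow> 'k::finite cmat" and \<mu> :: "complex ^ 'k \<Rightarrow> real measure"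
  assumes \<mu>: "\<And>v. finite_measure (\<mu> v)" "\<And>v. sets (\<mu> v) = sets borel" "\<And>v. emeasure (\<mu> v) (- {-r..r}) = 0"
    and N: "\<And>v z. 0 < Im z \<Longrightarrow> qform (N z) v = (\<integral>x. 1 / (complex_of_real x - z) \<partial>\<mu> v)"
    and X: "X \<in> sets borel"
  shows "qform (\<chi> i j. (\<Sum>p<4::nat. cnj (\<i> ^ p) * of_real (measure (\<mu> (axis i 1 + \<i> ^ p *s axis j 1)) X)) / 4) v
     = of_real (measure (\<mu> v) X)"
proof -
  \<comment> \<open>\<open>None\<close> stands for the measure of \<open>v\<close> with coefficient
    -1, \<open>Some (i, j, p)\<close> for the polarization terms of entry (i, j) weighted with the
    entries of \<open>v\<close>. The relation says that these two expressions for the form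
    cancel.\<close>
  define m where "m k = (case k of None \<Rightarrow> \<mu> v | Some (i, j, p) \<Rightarrow> \<mu> (axis i 1 + \<i> ^ p *s axis j 1))"
    for k :: "('k \<times> 'k \<times> nat) option"
  define c where "c k = (case k of None \<Rightarrow> - 1 | Some (i, j, p) \<Rightarrow> cnj (v $ i) * v $ j * cnj (\<i> ^ p) / 4)"
    for k :: "('k \<times> 'k \<times> nat) option"
  define I where "I = insert None (Some ` (UNIV \<times> UNIV \<times> {..<4::nat}) :: ('k \<times> 'k \<times> nat) option set)"
  have sum_I: "(\<Sum>k\<in>I. g k) = g None + (\<Sum>i\<in>UNIV. \<Sum>j\<in>UNIV. \<Sum>p<4. g (Some (i, j, p)))"
    for g :: "('k \<times> 'k \<times> nat) option \<Rightarrow> complex"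
    unfolding I_def by (subst sum.insert) (auto simp: sum.reindex sum.cartesian_product)
  have expand: "(\<Sum>k\<in>I. c k * h (m k)) = - h (\<mu> v) + qform (\<chi> i j. (\<Sum>p<4::nat. cnj (\<i> ^ p) * h (\<mu> (axis i 1 + \<i> ^ p *s axis j 1))) / 4) v"
    for h :: "real measure \<Rightarrow> complex"
    unfolding sum_I by (simp add: c_def m_def qform_def sum_distrib_left sum_distrib_right sum_divide_distrib mult_ac)
  interpret stieltjes_relation m c I r
  proof (rule stieltjes_relation.intro)
    show "finite I" by (simp add: I_def)
    show "finite_measure (m k)" for k using \<mu> by (auto simp: m_def split: option.split)
    show "sets (m k) = sets borel" for k using \<mu> by (auto simp: m_def split: option.split)
    show "emeasure (m k) (- {-r..r}) = 0" for k using \<mu> by (auto simp: m_def split: option.split)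
    fix z assume z: "0 < Im z"
    have polar: "(\<chi> i j. (\<Sum>p<4::nat. cnj (\<i> ^ p) * qform (N z) (axis i 1 + \<i> ^ p *s axis j 1)) / 4) = N z"
      by (simp only: qform_polar[symmetric]) (simp add: vec_eq_iff)
    show "(\<Sum>k\<in>I. c k * (\<integral>x. 1 / (complex_of_real x - z) \<partial>m k)) = 0"
      unfolding expand[where h = "\<lambda>M. \<integral>x. 1 / (complex_of_real x - z) \<partial>M"]
        N[OF z, symmetric] polar by simp
  qed
  show ?thesis
    using measure_relation[OF X] unfolding expand[where h = "\<lambda>M. of_real (measure M X)"]
    by (simp only: add_eq_0_iff minus_minus)
qed

text \<open>The entries of the measure are defined by polarization, so countable additivity is
  inherited from finitely many scalar measures, while positivity is
  \<open>polar_measure_relation\<close>.\<close>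

lemma matrix_measure_exists:
  fixes N :: "complex \<Rightarrow> 'k::finite cmat"
  assumes ex: "\<And>v. \<exists>\<mu>. finite_measure \<mu> \<and> sets \<mu> = sets borel \<and> emeasure \<mu> (- {-r..r}) = 0 \<and>
      (\<forall>z\<in>upper_half_plane. qform (N z) v = (\<integral>x. 1 / (complex_of_real x - z) \<partial>\<mu>))"
    and T: "((\<lambda>y. mscale (\<i> * complex_of_real y) (N (\<i> * complex_of_real y))) \<longlongrightarrow> - T) at_top"
  shows "\<exists>\<Omega>. matrix_measure \<Omega> \<and> compactly_supported \<Omega> \<and>
    (\<forall>z\<in>upper_half_plane. has_matrix_integral (\<lambda>x. 1 / (complex_of_real x - z)) (N z) \<Omega>) \<and>
    has_matrix_integral (\<lambda>x. 1) T \<Omega>"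
proof -
  obtain \<mu> where \<mu>: "\<And>v. finite_measure (\<mu> v)" "\<And>v. sets (\<mu> v) = sets borel" "\<And>v. emeasure (\<mu> v) (- {-r..r}) = 0"
    and N: "\<And>v z. 0 < Im z \<Longrightarrow> qform (N z) v = (\<integral>x. 1 / (complex_of_real x - z) \<partial>\<mu> v)"
    using ex unfolding upper_half_plane_def by (metis mem_Collect_eq)
  define \<Omega> :: "real set \<Rightarrow> 'k cmat" where
    "\<Omega> X = (\<chi> i j. (\<Sum>p<4::nat. cnj (\<i> ^ p) * of_real (measure (\<mu> (axis i 1 + \<i> ^ p *s axis j 1)) X)) / 4)" for X
  have \<Omega>: "qform (\<Omega> X) v = of_real (measure (\<mu> v) X)" if "X \<in> sets borel" for X v
    unfolding \<Omega>_def by (rule polar_measure_relation[OF \<mu> N that])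
  have mm: "matrix_measure \<Omega>"
    unfolding matrix_measure_def
  proof (intro conjI allI impI ballI)
    show "\<Omega> {} = 0" by (simp add: \<Omega>_def vec_eq_iff)
    show "psd (\<Omega> X)" if "X \<in> bounded_borel" for X
      using that by (simp add: psd_qform \<Omega> bounded_borel_def)
    fix F :: "nat \<Rightarrow> real set"
    assume F: "range F \<subseteq> bounded_borel \<and> disjoint_family F \<and> (\<Union>i. F i) \<in> bounded_borel"
    have F': "range F \<subseteq> sets borel" using F by (auto simp: bounded_borel_def)
    have m: "(\<lambda>n. measure (\<mu> v) (F n)) sums measure (\<mu> v) (\<Union>n. F n)" for v
    proof -
      interpret finite_measure "\<mu> v" by (rule \<mu>)
      show ?thesis using F F' by (intro finite_measure_UNION) (auto simp: \<mu>(2))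
    qed
    have "(\<lambda>n. \<Omega> (F n) $ i $ j) sums \<Omega> (\<Union>n. F n) $ i $ j" for i j
      unfolding \<Omega>_def by (simp only: vec_lambda_beta) (intro sums_divide sums_sum sums_mult sums_of_real m)
    then show "(\<lambda>n. \<Omega> (F n)) sums \<Omega> (\<Union>n. F n)"
      unfolding sums_def by (intro vec_tendstoI) simp
  qed
  \<comment> \<open>Identifies the measure that the definition builds by exhaustion with the
    original one; both integral claims then reduce to it.\<close>
  have scal: "scalar_measure \<Omega> v = \<mu> v" for v
  proof (rule measure_eqI)
    show "sets (scalar_measure \<Omega> v) = sets (\<mu> v)" by (simp add: \<mu>)
    fix X assume "X \<in> sets (scalar_measure \<Omega> v)"
    then have X: "X \<in> sets borel" by simp
    interpret finite_measure "\<mu> v" by (rule \<mu>)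
    let ?A = "\<lambda>k::nat. X \<inter> {- real k..real k}"
    have "emeasure (scalar_measure \<Omega> v) X = (SUP k. ennreal (Re (qform (\<Omega> (?A k)) v)))"
      by (rule emeasure_scalar_measure[OF mm X])
    also have "\<dots> = (SUP k. emeasure (\<mu> v) (?A k))"
      using X by (simp add: \<Omega> emeasure_eq_measure)
    also have "\<dots> = emeasure (\<mu> v) (\<Union>k. ?A k)"
      using X by (intro SUP_emeasure_incseq) (auto simp: \<mu>(2) incseq_def)
    also have "(\<Union>k. ?A k) = X"
    proof -
      have "\<exists>k::nat. x \<in> {- real k..real k}" for x
        using real_arch_simple[of "\<bar>x\<bar>"] by (auto simp: abs_le_iff minus_le_iff)
      then show ?thesis by blast
    qed
    finally show "emeasure (scalar_measure \<Omega> v) X = emeasure (\<mu> v) X" .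
  qed
  have "compactly_supported \<Omega>"
    unfolding compactly_supported_def
  proof (intro exI[of _ "{-r..r}"] conjI ballI impI)
    fix X assume X: "X \<in> bounded_borel" "X \<inter> {-r..r} = {}"
    have "measure (\<mu> v) X = 0" for v
    proof -
      have "emeasure (\<mu> v) X \<le> emeasure (\<mu> v) (- {-r..r})"
        using X by (intro emeasure_mono) (auto simp: \<mu>(2))
      then show ?thesis by (simp add: \<mu>(3) measure_def)
    qed
    then show "\<Omega> X = 0" by (simp add: \<Omega>_def vec_eq_iff)
  qed simp
  moreover have "has_matrix_integral (\<lambda>x. 1 / (complex_of_real x - z)) (N z) \<Omega>" if "z \<in> upper_half_plane" for z
    unfolding has_matrix_integral_def scal
    using that cauchy_kernel_integrable[OF \<mu>(1,2)] N by (auto simp: upper_half_plane_def)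
  moreover have "has_matrix_integral (\<lambda>x. 1) T \<Omega>"
    unfolding has_matrix_integral_def scal
  proof (intro allI conjI)
    fix v
    interpret finite_measure "\<mu> v" by (rule \<mu>)
    show "integrable (\<mu> v) (\<lambda>x. 1 :: complex)" by simp
    have s: "filterlim (\<lambda>k. real (Suc k)) at_top sequentially"
      by (rule filterlim_compose[OF filterlim_real_sequentially filterlim_Suc])
    have "(\<lambda>k. qform (mscale (\<i> * complex_of_real (real (Suc k))) (N (\<i> * complex_of_real (real (Suc k))))) v) \<longlonglongrightarrow> qform (- T) v"
      by (intro tendsto_qform filterlim_compose[OF T s])
    moreover have "0 < Im (\<i> * complex_of_real (real (Suc k)))" for k by simp
    ultimately have "(\<lambda>k. \<i> * complex_of_real (real (Suc k)) * (\<integral>x. 1 / (complex_of_real x - \<i> * complex_of_real (real (Suc k))) \<partial>\<mu> v))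
        \<longlonglongrightarrow> - qform T v"
      by (simp only: qform_mscale qform_uminus N)
    \<comment> \<open>The same limit computed twice: from the asymptotics of \<open>N\<close>, and
      from dominated convergence.\<close>
    from LIMSEQ_unique[OF this
        cauchy_transform_limit[OF \<mu>(2) \<open>integrable (\<mu> v) (\<lambda>x. 1)\<close>, unfolded mult_1_left]]
    show "qform T v = (\<integral>x. 1 \<partial>\<mu> v)" by (simp only: neg_equal_iff_equal)
  qed
  ultimately show ?thesis using mm by blast
qed

lemma (in matrix_dyson) solution_theorem:
  assumes H: "H = cplx EL"
  shows "(\<exists>!M. MDE_solution EL S M) \<and>
    (\<forall>M. MDE_solution EL S M \<longrightarrow>
      (\<exists>\<Omega>. matrix_measure \<Omega> \<and> compactly_supported \<Omega> \<and>
        (\<forall>z\<in>upper_half_plane. has_matrix_integral (\<lambda>x. 1 / (complex_of_real x - z)) (M z - Dinf) \<Omega>) \<and>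
        has_matrix_integral (\<lambda>x. 1) total_mass \<Omega>))"
proof -
  obtain r M where hol: "\<And>i j. (\<lambda>z. M z $ i $ j) holomorphic_on upper_half_plane"
    and sol: "\<And>z. z \<in> upper_half_plane \<Longrightarrow> M z \<in> admissible_values \<and> pencil z (M z) ** M z = mat 1"
    and rep: "\<And>v. \<exists>\<mu>. finite_measure \<mu> \<and> sets \<mu> = sets borel \<and> emeasure \<mu> (- {-r..r}) = 0 \<and>
      (\<forall>z\<in>upper_half_plane. qform (M z - Dinf) v = (\<integral>x. 1 / (complex_of_real x - z) \<partial>\<mu>))"
    using existence by blast
  have MS: "solves z (M z)" if "0 < Im z" for z
    using sol[of z] that by (auto simp: solves_def upper_half_plane_def)
  have pencil_eq: "pencil z W = cplx EL - S W - mscale z Lam" for z W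
    unfolding pencil_def by (subst H) (rule refl)
  have iff: "MDE_solution EL S V \<longleftrightarrow> V \<in> extensional upper_half_plane \<and> (\<forall>z. 0 < Im z \<longrightarrow> solves z (V z)) \<and>
      (\<forall>i j. (\<lambda>z. V z $ i $ j) holomorphic_on upper_half_plane)" for V
    by (auto simp: MDE_solution_def admissible_def solves_def pencil_eq PiE_def upper_half_plane_def)
  have agree: "V z = M z" if "MDE_solution EL S V" "z \<in> upper_half_plane" for V z
    using that uniqueness[of V M z] MS hol by (auto simp: iff upper_half_plane_def)
  \<comment> \<open>Members of \<open>admissible\<close> are extensional, so the solution is made
    \<open>undefined\<close> off the half plane; uniqueness then is equality of functions.\<close>
  define M0 where "M0 = restrict M upper_half_plane"
  have M0: "MDE_solution EL S M0"
    unfolding iff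
  proof (intro conjI allI impI)
    show "(\<lambda>z. M0 z $ i $ j) holomorphic_on upper_half_plane" for i j
      by (rule holomorphic_transform[OF hol]) (simp add: M0_def)
  qed (use MS in \<open>auto simp: M0_def upper_half_plane_def\<close>)
  have "V = M0" if "MDE_solution EL S V" for V
  proof (rule extensionalityI)
    show "V \<in> extensional upper_half_plane" "M0 \<in> extensional upper_half_plane"
      using that M0 by (auto simp: iff)
    show "V z = M0 z" if "z \<in> upper_half_plane" for z
      using agree[OF \<open>MDE_solution EL S V\<close> that] agree[OF M0 that] by simp
  qed
  then have "\<exists>!M. MDE_solution EL S M" using M0 by (intro ex1I[of _ M0])
  moreover
  from matrix_measure_exists[OF rep scaled_M_tendsto(4)[OF MS]]
  obtain \<Omega> where \<Omega>: "matrix_measure \<Omega>" "compactly_supported \<Omega>"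
    "\<And>z. z \<in> upper_half_plane \<Longrightarrow> has_matrix_integral (\<lambda>x. 1 / (complex_of_real x - z)) (M z - Dinf) \<Omega>"
    "has_matrix_integral (\<lambda>x. 1) total_mass \<Omega>"
    by blast
  have "has_matrix_integral (\<lambda>x. 1 / (complex_of_real x - z)) (V z - Dinf) \<Omega>"
    if "MDE_solution EL S V" "z \<in> upper_half_plane" for V z
    unfolding agree[OF that] by (rule \<Omega>(3)[OF that(2)])
  ultimately show ?thesis using \<Omega>(1,2,4) by (intro conjI allI impI exI[of _ \<Omega>] ballI)
qed

section \<open>The random matrix setting\<close>

lemma bounded_linear_entry: "bounded_linear (\<lambda>W :: ('a::euclidean_space) ^ 'm ^ 'k. W $ i $ j)"
  by (rule bounded_linear_compose[OF bounded_linear_vec_nth bounded_linear_vec_nth])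

lemma integrable_entries:
  fixes f :: "'w \<Rightarrow> ('a::euclidean_space) ^ 'm ^ 'k"
  assumes "\<And>i j. integrable P (\<lambda>\<omega>. f \<omega> $ i $ j)"
  shows "integrable P f"
proof -
  have lin: "bounded_linear (\<lambda>c::'a. axis i (axis j c) :: 'a ^ 'm ^ 'k)" for i j
    unfolding linear_conv_bounded_linear[symmetric] linear_iff
    by (simp add: vec_eq_iff axis_def)
  have "integrable P (\<lambda>\<omega>. \<Sum>i\<in>UNIV. \<Sum>j\<in>UNIV. axis i (axis j (f \<omega> $ i $ j)))"
    by (intro Bochner_Integration.integrable_sum integrable_bounded_linear[OF lin] assms)
  moreover have "(\<Sum>i\<in>UNIV. \<Sum>j\<in>UNIV. axis i (axis j (W $ i $ j))) = W" for W :: "'a ^ 'm ^ 'k"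
  proof -
    have "(\<Sum>k\<in>UNIV. \<Sum>l\<in>UNIV. axis k (axis l (W $ k $ l))) $ i $ j
        = (\<Sum>k\<in>UNIV. if k = i then \<Sum>l\<in>UNIV. if l = j then W $ k $ l else 0 else 0)" for i j
      unfolding sum_component by (intro sum.cong) (auto simp: axis_def intro!: sum.cong)
    then show ?thesis by (simp add: vec_eq_iff)
  qed
  ultimately show ?thesis by simp
qed

lemma integral_entry:
  fixes f :: "'w \<Rightarrow> ('a::euclidean_space) ^ 'm ^ 'k"
  assumes "integrable P f"
  shows "(\<integral>\<omega>. f \<omega> \<partial>P) $ i $ j = (\<integral>\<omega>. f \<omega> $ i $ j \<partial>P)"
  by (rule integral_bounded_linear[OF bounded_linear_entry assms, symmetric])

lemma integrable_mult_if_square_integrable: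
  fixes f g :: "'w \<Rightarrow> real"
  assumes [measurable]: "f \<in> borel_measurable P" "g \<in> borel_measurable P"
    and sq: "integrable P (\<lambda>\<omega>. (f \<omega>)\<^sup>2)" "integrable P (\<lambda>\<omega>. (g \<omega>)\<^sup>2)"
  shows "integrable P (\<lambda>\<omega>. f \<omega> * g \<omega>)"
proof (rule Bochner_Integration.integrable_bound)
  show "integrable P (\<lambda>\<omega>. (f \<omega>)\<^sup>2 + (g \<omega>)\<^sup>2)" using sq by simp
  have "\<bar>a * b\<bar> \<le> a\<^sup>2 + b\<^sup>2" for a b :: real
  proof -
    have "2 * (\<bar>a\<bar> * \<bar>b\<bar>) \<le> a\<^sup>2 + b\<^sup>2"
      using sum_squares_bound[of "\<bar>a\<bar>" "\<bar>b\<bar>"] by simp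
    moreover have "0 \<le> \<bar>a\<bar> * \<bar>b\<bar>" by simp
    ultimately show ?thesis unfolding abs_mult by linarith
  qed
  then show "AE \<omega> in P. norm (f \<omega> * g \<omega>) \<le> norm ((f \<omega>)\<^sup>2 + (g \<omega>)\<^sup>2)" by simp
qed measurable

lemma integrable_cplx_sandwich:
  fixes C :: "'w \<Rightarrow> real ^ 'm ^ 'k" and D :: "'w \<Rightarrow> real ^ 'p ^ 'q"
  assumes "\<And>i j k l. integrable P (\<lambda>\<omega>. C \<omega> $ i $ j * D \<omega> $ k $ l)"
  shows "integrable P (\<lambda>\<omega>. cplx (C \<omega>) ** X ** cplx (transpose (D \<omega>)))"
proof (rule integrable_entries)
  fix i j
  have "integrable P (\<lambda>\<omega>. \<Sum>k\<in>UNIV. \<Sum>l\<in>UNIV. X $ l $ k * complex_of_real (C \<omega> $ i $ l * D \<omega> $ j $ k))"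
    by (intro Bochner_Integration.integrable_sum integrable_mult_right integrable_of_real assms)
  then show "integrable P (\<lambda>\<omega>. (cplx (C \<omega>) ** X ** cplx (transpose (D \<omega>))) $ i $ j)"
    by (simp add: matrix_matrix_mult_def sum_distrib_left sum_distrib_right transpose_def mult_ac)
qed

lemma qform_sandwich: "qform (C ** X ** ctranspose C) b = qform X (ctranspose C *v b)"
proof -
  have "qform (C ** X ** ctranspose C) b = cinner b (C *v (X *v (ctranspose C *v b)))"
    by (simp add: qform_cinner matrix_vector_mul_assoc matrix_mul_assoc)
  also have "\<dots> = cinner (ctranspose C *v b) (X *v (ctranspose C *v b))"
    using cinner_adjoint[of "ctranspose C" b] by simp
  finally show ?thesis by (simp add: qform_cinner)
qed

lemma bounded_linear_matrix_vector: "bounded_linear (\<lambda>W :: complex ^ 'm ^ 'k. W *v b)"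
  unfolding linear_conv_bounded_linear[symmetric] linear_iff
  by (simp add: vec_eq_iff matrix_vector_mult_def algebra_simps sum.distrib scaleR_sum_right)

lemma transpose_block: "transpose (block a b c d) = block (transpose a) (transpose c) (transpose b) (transpose d)"
  by (simp add: vec_eq_iff all_Plus transpose_def)

theorem theorem2p1:
  fixes P :: "'w measure"
    and A :: "'w \<Rightarrow> real ^ 'n::finite ^ 'n"
    and B :: "'w \<Rightarrow> real ^ 'n ^ 'd::finite"
    and Q :: "'w \<Rightarrow> real ^ 'd ^ 'd"
    and L :: "'w \<Rightarrow> real ^ ('n + 'd) ^ ('n + 'd)"
    and EA :: "real ^ 'n ^ 'n" and EB :: "real ^ 'n ^ 'd" and EQ :: "real ^ 'd ^ 'd"
    and EL :: "real ^ ('n + 'd) ^ ('n + 'd)"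
    and S11 :: "('n + 'd) cmat \<Rightarrow> 'n cmat"
    and S :: "('n + 'd) cmat \<Rightarrow> ('n + 'd) cmat"
  assumes "prob_space P"
    and "A \<in> borel_measurable P" and "B \<in> borel_measurable P" and "Q \<in> borel_measurable P"
    and L_def: "\<And>\<omega>. L \<omega> = block (A \<omega>) (transpose (B \<omega>)) (B \<omega>) (Q \<omega>)"
    and A_sym: "AE \<omega> in P. transpose (A \<omega>) = A \<omega>"
    and Q_sym: "AE \<omega> in P. transpose (Q \<omega>) = Q \<omega>"
    and second_moments: "\<And>i j. integrable P (\<lambda>\<omega>. (L \<omega> $ i $ j)\<^sup>2)"
    and EA_def: "EA = (\<integral>\<omega>. A \<omega> \<partial>P)"
    and EB_def: "EB = (\<integral>\<omega>. B \<omega> \<partial>P)"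
    and EQ_def: "EQ = (\<integral>\<omega>. Q \<omega> \<partial>P)"
    and EL_def: "EL = (\<integral>\<omega>. L \<omega> \<partial>P)"
    and Q_nonsing: "AE \<omega> in P. invertible (Q \<omega>)"
    and EQ_nonsing: "invertible EQ"
    and S11_linear: "Vector_Spaces.linear mscale mscale S11"
    and S11_pos: "positivity_preserving S11"
    and S_form: "\<And>W. S W = block
          (S11 W)
          (\<integral>\<omega>. cplx (A \<omega> - EA) ** block11 W ** cplx (transpose (B \<omega> - EB)) \<partial>P)
          (\<integral>\<omega>. cplx (B \<omega> - EB) ** block11 W ** cplx (A \<omega> - EA) \<partial>P)
          (\<integral>\<omega>. cplx (B \<omega> - EB) ** block11 W ** cplx (transpose (B \<omega> - EB)) \<partial>P)"
    and S_linear: "Vector_Spaces.linear mscale mscale S"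
    and S_pos: "positivity_preserving S"
  shows "(\<exists>!M. MDE_solution EL S M) \<and>
    (\<forall>M. MDE_solution EL S M \<longrightarrow>
      (\<exists>\<Omega>. matrix_measure \<Omega> \<and> compactly_supported \<Omega> \<and>
        (\<forall>z\<in>upper_half_plane.
           has_matrix_integral (\<lambda>x. 1 / (complex_of_real x - z))
             (M z - cplx (block 0 0 0 (matrix_inv EQ))) \<Omega>) \<and>
        has_matrix_integral (\<lambda>x. 1)
          (cplx (block
             (mat 1)
             (- ((\<integral>\<omega>. transpose (B \<omega>) \<partial>P) ** matrix_inv EQ))
             (- (matrix_inv EQ ** EB))
             (matrix_inv EQ ** (\<integral>\<omega>. B \<omega> ** transpose (B \<omega>) \<partial>P) ** matrix_inv EQ))) \<Omega>))"
proof -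
  interpret prob_space P by fact
  have entry: "(\<lambda>\<omega>. f \<omega> $ i $ j) \<in> borel_measurable P"
    if "f \<in> borel_measurable P" for f :: "'w \<Rightarrow> real ^ 'x ^ 'y" and i j
    by (rule borel_measurable_continuous_on[OF linear_continuous_on[OF bounded_linear_entry] that])
  have meas: "(\<lambda>\<omega>. L \<omega> $ i $ j) \<in> borel_measurable P" for i j
    using assms(2-4) by (cases i; cases j) (auto simp: L_def transpose_def intro!: entry)
  have int2: "integrable P (\<lambda>\<omega>. L \<omega> $ i $ j * L \<omega> $ k $ l)" for i j k l
    by (intro integrable_mult_if_square_integrable meas second_moments)
  \<comment> \<open>First moments from second ones: the other factor is the constant 1, square
    integrable on a probability space.\<close>
  have int1: "integrable P (\<lambda>\<omega>. L \<omega> $ i $ j)" for i j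
    using integrable_mult_if_square_integrable[OF meas[of i j] borel_measurable_const second_moments, of 1] by simp
  have EL: "EL $ i $ j = (\<integral>\<omega>. L \<omega> $ i $ j \<partial>P)" for i j
    unfolding EL_def by (rule integral_entry[OF integrable_entries[OF int1]])
  have intA: "integrable P A"
    by (rule integrable_entries) (use int1[of "Inl _" "Inl _"] in \<open>simp add: L_def\<close>)
  have intB: "integrable P B"
    by (rule integrable_entries) (use int1[of "Inr _" "Inl _"] in \<open>simp add: L_def\<close>)
  have intQ: "integrable P Q"
    by (rule integrable_entries) (use int1[of "Inr _" "Inr _"] in \<open>simp add: L_def\<close>)
  have EA: "EA $ i $ j = EL $ Inl i $ Inl j" for i j
    unfolding EA_def integral_entry[OF intA] EL by (simp add: L_def)
  have EB: "EB $ i $ j = EL $ Inr i $ Inl j" for i j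
    unfolding EB_def integral_entry[OF intB] EL by (simp add: L_def)
  have EQ: "EQ $ i $ j = EL $ Inr i $ Inr j" for i j
    unfolding EQ_def integral_entry[OF intQ] EL by (simp add: L_def)
  have EL12: "EL $ Inl i $ Inr j = EB $ j $ i" for i j
    unfolding EB EL by (simp add: L_def transpose_def)
  have EL_sym: "EL $ i $ j = EL $ j $ i" for i j
    unfolding EL
  proof (rule integral_cong_AE)
    show "AE \<omega> in P. L \<omega> $ i $ j = L \<omega> $ j $ i"
      using A_sym Q_sym
    proof eventually_elim
      case (elim \<omega>)
      then have "transpose (L \<omega>) = L \<omega>" by (simp add: L_def transpose_block)
      then have "transpose (L \<omega>) $ i $ j = L \<omega> $ i $ j" by simp
      then show ?case by (simp add: transpose_def)
    qed
  qed (rule meas)+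
  define c where "c i j \<omega> = L \<omega> $ i $ j - EL $ i $ j" for i j \<omega>
  have int_c: "integrable P (\<lambda>\<omega>. c i j \<omega> * c k l \<omega>)" for i j k l
  proof -
    have "integrable P (\<lambda>\<omega>. L \<omega> $ i $ j * L \<omega> $ k $ l - EL $ k $ l * L \<omega> $ i $ j - EL $ i $ j * L \<omega> $ k $ l + EL $ i $ j * EL $ k $ l)"
      by (intro Bochner_Integration.integrable_add Bochner_Integration.integrable_diff integrable_mult_right int1 int2) auto
    then show ?thesis by (simp add: c_def algebra_simps)
  qed
  have cA: "(A \<omega> - EA) $ i $ j = c (Inl i) (Inl j) \<omega>" and cB: "(B \<omega> - EB) $ k $ j = c (Inr k) (Inl j) \<omega>" for i j k \<omega>
    by (simp_all add: c_def EA EB L_def)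
  have int_12: "integrable P (\<lambda>\<omega>. cplx (A \<omega> - EA) ** X ** cplx (transpose (B \<omega> - EB)))"
    and int_22: "integrable P (\<lambda>\<omega>. cplx (B \<omega> - EB) ** X ** cplx (transpose (B \<omega> - EB)))" for X
    by (intro integrable_cplx_sandwich; simp only: cA cB int_c)+
  have bl22: "block22 (cplx EL) = cplx EQ" and bl21: "block21 (cplx EL) = cplx EB" and bl12: "block12 (cplx EL) = cplx (transpose EB)"
    by (simp_all add: vec_eq_iff block_defs EQ EB EL12[unfolded EB] transpose_def)
  have EQ_inv: "cplx EQ ** cplx (matrix_inv EQ) = mat 1"
    using matrix_inv(1)[OF EQ_nonsing] by (simp add: cplx_mat flip: cplx_mult)
  interpret matrix_dyson "cplx EL" S
  proof (rule matrix_dyson.intro)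
    show "ctranspose (cplx EL) = cplx EL"
      by (simp add: vec_eq_iff EL_sym)
    show "invertible (block22 (cplx EL))"
      unfolding bl22 by (rule matrix_inv_eq(2)[OF EQ_inv])
    show "block12 (S V) = block12 (S W) \<and> block21 (S V) = block21 (S W) \<and> block22 (S V) = block22 (S W)"
      if "block11 V = block11 W" for V W
      using that by (simp add: S_form)
    \<comment> \<open>The form is the expectation of the form of \<open>block11 W\<close> at the
      centred transpose of B applied to \<open>b\<close>. The imaginary part of that block is
      positive definite, so a zero expectation forces this random vector to vanish almost surely,
      and it is a right factor in both \<open>block12 (S W) *v b\<close> and
      \<open>block22 (S W) *v b\<close>.\<close>
    show "S W *v v = 0" if W: "W \<in> admissible_values" and top: "top v = 0" and Im: "Im (qform (S W) v) = 0" for W v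
    proof -
      let ?X = "block11 W"
      define b where "b = bot v"
      define u where "u \<omega> = cplx (transpose (B \<omega> - EB)) *v b" for \<omega>
      have pos: "0 < Im (qform ?X w)" if "w \<noteq> 0" for w
        using W that by (simp add: admissible_values_iff)
      have X: "0 \<le> Im (qform ?X w)" "Im (qform ?X w) = 0 \<Longrightarrow> w = 0" for w
        using pos[of w] by (cases "w = 0"; simp add: qform_cinner)+
      have q: "qform (cplx (B \<omega> - EB) ** ?X ** cplx (transpose (B \<omega> - EB))) b = qform ?X (u \<omega>)" for \<omega>
        using qform_sandwich[of "cplx (B \<omega> - EB)" ?X b] by (simp add: ctranspose_cplx u_def)
      have int_q: "integrable P (\<lambda>\<omega>. qform ?X (u \<omega>))"
        unfolding q[symmetric] by (rule integrable_bounded_linear[OF bounded_linear_qform int_22])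
      have "qform (S W) v = qform (block22 (S W)) b"
        using top by (simp add: qform_cinner cinner_top_bot top_bot_mult b_def)
      also have "\<dots> = (\<integral>\<omega>. qform ?X (u \<omega>) \<partial>P)"
        unfolding q[symmetric] by (simp add: S_form integral_bounded_linear[OF bounded_linear_qform int_22])
      finally have "(\<integral>\<omega>. Im (qform ?X (u \<omega>)) \<partial>P) = 0"
        using Im integral_bounded_linear[OF bounded_linear_Im int_q] by simp
      then have "AE \<omega> in P. Im (qform ?X (u \<omega>)) = 0"
        using X(1) by (subst (asm) integral_nonneg_eq_0_iff_AE[OF integrable_bounded_linear[OF bounded_linear_Im int_q]]) auto
      then have u: "AE \<omega> in P. u \<omega> = 0" using X(2) by (auto elim!: eventually_mono)
      have mult: "(V ** ?X ** cplx (transpose (B \<omega> - EB))) *v b = V *v (?X *v u \<omega>)" for V :: "complex ^ 'n ^ 'x" and \<omega>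
        by (simp add: u_def matrix_vector_mul_assoc matrix_mul_assoc)
      have "block12 (S W) *v b = (\<integral>\<omega>. cplx (A \<omega> - EA) *v (?X *v u \<omega>) \<partial>P)"
        unfolding mult[symmetric] by (simp add: S_form integral_bounded_linear[OF bounded_linear_matrix_vector int_12])
      also have "\<dots> = 0" by (rule integral_eq_zero_AE) (use u in eventually_elim, simp)
      finally have "block12 (S W) *v b = 0" .
      have "block22 (S W) *v b = (\<integral>\<omega>. cplx (B \<omega> - EB) *v (?X *v u \<omega>) \<partial>P)"
        unfolding mult[symmetric] by (simp add: S_form integral_bounded_linear[OF bounded_linear_matrix_vector int_22])
      also have "\<dots> = 0" by (rule integral_eq_zero_AE) (use u in eventually_elim, simp)
      finally have "block22 (S W) *v b = 0" .
      with \<open>block12 (S W) *v b = 0\<close> show ?thesis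
        using top by (simp add: top_bot_eq_iff top_bot_mult b_def)
    qed
  qed (rule S_linear S_pos)+
  have Qi_eq: "Qi = cplx (matrix_inv EQ)"
    unfolding Qi_def bl22 by (rule matrix_inv_eq(1)[OF EQ_inv])
  have Dinf_eq: "Dinf = cplx (block 0 0 0 (matrix_inv EQ))"
    by (simp add: Dinf_def Qi_eq cplx_block cplx_0)
  have EBT: "(\<integral>\<omega>. transpose (B \<omega>) \<partial>P) = transpose EB"
  proof -
    have "integrable P (\<lambda>\<omega>. transpose (B \<omega>))"
      by (rule integrable_entries) (use int1[of "Inr _" "Inl _"] in \<open>simp add: transpose_def L_def\<close>)
    from integral_entry[OF this] have "(\<integral>\<omega>. transpose (B \<omega>) \<partial>P) $ i $ j = (\<integral>\<omega>. B \<omega> $ j $ i \<partial>P)" for i j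
      by (simp add: transpose_def)
    also have "(\<integral>\<omega>. B \<omega> $ j $ i \<partial>P) = transpose EB $ i $ j" for i j
      unfolding EB_def transpose_def by (simp add: integral_entry[OF intB])
    finally show ?thesis by (simp add: vec_eq_iff)
  qed
  \<comment> \<open>As \<open>block11 Lam\<close> is the identity, this is the covariance of B. The
    subtracted \<open>EB ** transpose EB\<close> is restored in \<open>total_mass\<close> by the
    product of the off-diagonal blocks of the mean.\<close>
  have cov: "block22 (S Lam) = cplx ((\<integral>\<omega>. B \<omega> ** transpose (B \<omega>) \<partial>P) - EB ** transpose EB)"
  proof -
    have iBB: "integrable P (\<lambda>\<omega>. B \<omega> $ i $ k * B \<omega> $ j $ k)" for i j k
      using int2[of "Inr i" "Inl k" "Inr j" "Inl k"] by (simp add: L_def)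
    have iB: "integrable P (\<lambda>\<omega>. B \<omega> $ i $ k)" for i k
      using int1[of "Inr i" "Inl k"] by (simp add: L_def)
    have intBB: "integrable P (\<lambda>\<omega>. B \<omega> ** transpose (B \<omega>))"
      by (rule integrable_entries) (simp add: matrix_matrix_mult_def transpose_def iBB)
    have "block22 (S Lam) $ i $ j = complex_of_real (((\<integral>\<omega>. B \<omega> ** transpose (B \<omega>) \<partial>P) - EB ** transpose EB) $ i $ j)" for i j
    proof -
      have "block22 (S Lam) $ i $ j = (\<integral>\<omega>. (cplx (B \<omega> - EB) ** mat 1 ** cplx (transpose (B \<omega> - EB))) $ i $ j \<partial>P)"
        unfolding S_form blocks_block blocks_Lam by (rule integral_entry[OF int_22])
      also have "\<dots> = (\<integral>\<omega>. complex_of_real (\<Sum>k\<in>UNIV. (B \<omega> $ i $ k - EB $ i $ k) * (B \<omega> $ j $ k - EB $ j $ k)) \<partial>P)"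
        by (simp only: matrix_mul_rid) (simp add: matrix_matrix_mult_def transpose_def)
      also have "\<dots> = complex_of_real (\<integral>\<omega>. (\<Sum>k\<in>UNIV. (B \<omega> $ i $ k - EB $ i $ k) * (B \<omega> $ j $ k - EB $ j $ k)) \<partial>P)"
        by (rule integral_complex_of_real)
      also have "(\<integral>\<omega>. (\<Sum>k\<in>UNIV. (B \<omega> $ i $ k - EB $ i $ k) * (B \<omega> $ j $ k - EB $ j $ k)) \<partial>P)
          = (\<Sum>k\<in>UNIV. (\<integral>\<omega>. B \<omega> $ i $ k * B \<omega> $ j $ k \<partial>P) - EB $ i $ k * EB $ j $ k)"
      proof -
        have "(B \<omega> $ i $ k - EB $ i $ k) * (B \<omega> $ j $ k - EB $ j $ k)
            = B \<omega> $ i $ k * B \<omega> $ j $ k - EB $ j $ k * B \<omega> $ i $ k - EB $ i $ k * B \<omega> $ j $ k + EB $ i $ k * EB $ j $ k" for k \<omega>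
          by (simp add: algebra_simps)
        moreover have "(\<integral>\<omega>. B \<omega> $ i $ k \<partial>P) = EB $ i $ k" for i k
          by (simp add: EB_def integral_entry[OF intB])
        ultimately show ?thesis
          by (simp add: iBB iB prob_space)
      qed
      also have "\<dots> = ((\<integral>\<omega>. B \<omega> ** transpose (B \<omega>) \<partial>P) - EB ** transpose EB) $ i $ j"
      proof -
        have "(\<integral>\<omega>. B \<omega> ** transpose (B \<omega>) \<partial>P) $ i $ j = (\<Sum>k\<in>UNIV. \<integral>\<omega>. B \<omega> $ i $ k * B \<omega> $ j $ k \<partial>P)"
          unfolding integral_entry[OF intBB] using iBB by (simp add: matrix_matrix_mult_def transpose_def)
        then show ?thesis
          unfolding vector_minus_component by (simp add: matrix_matrix_mult_def transpose_def sum_subtractf)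
      qed
      finally show ?thesis .
    qed
    then show ?thesis by (simp add: vec_eq_iff)
  qed
  have mass_eq: "total_mass = cplx (block (mat 1)
             (- ((\<integral>\<omega>. transpose (B \<omega>) \<partial>P) ** matrix_inv EQ))
             (- (matrix_inv EQ ** EB))
             (matrix_inv EQ ** (\<integral>\<omega>. B \<omega> ** transpose (B \<omega>) \<partial>P) ** matrix_inv EQ))"
    unfolding total_mass_def bl12 bl21 Qi_eq cov EBT cplx_block
    by (simp add: cplx_mat cplx_uminus flip: cplx_mult cplx_add)
  show ?thesis
    using solution_theorem[OF refl] unfolding Dinf_eq mass_eq .
qed

end
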